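(* Let $G$ be a metric graph, let $r$ be the resistance metric on $G$, and let $\operatorname{diam}_r(G)=\max_{x,y\in G}r(x,y)$ be the diameter of $G$ with respect to $r$. Then $$\lambda_1^{\min}(G)=\frac{4}{\operatorname{diam}_r(G)}.$$ Moreover, the Borel probability measures $\mu$ on $G$ with $\lambda_1(H_\mu)=\lambda_1^{\min}(G)$ are precisely the measures $\mu_{x,y}=\frac12\delta_x+\frac12\delta_y$ for points $x,y\in G$ with $r(x,y)=\operatorname{diam}_r(G)$. If $G$ is a tree, then $$\lambda_1^{\min}(G)=\frac{4}{\operatorname{diam}_r(G)}=\frac{4}{\operatorname{diam}_\varrho(G)},$$ where $\operatorname{diam}_\varrho(G)$ is the diameter of $G$ with respect to the path metric $\varrho$.
   Context: A metric graph $G=(V,E,\ell)$ is given by a finite connected graph $(V,E)$ with at least one edge (loops and multiple edges allowed) and edge lengths $\ell:E\to(0,\infty)$: each edge $e$ is (after choosing an orientation) identified with the interval $[0,\ell(e)]$, and $G$ is the compact topological space obtained by gluing endpoints of edges corresponding to the same vertex. The path metric $\varrho(x,y)$ is the arc length of a shortest path in $G$ from $x$ to $y$. $dx$ is the Lebesgue measure on $G$. $H^1(G)$ is the space of continuous $f:G\to\mathbb{R}$ whose restriction to every open edge lies in $H^1((0,\ell(e)))$; $q(f,g)=\int_G f'g'\,dx$. A function $f\in H^1(G)$ is harmonic on an open set $O\subset G$ if $q(f,g)=0$ for all $g\in H^1(G)$ with $g\equiv 0$ on $G\setminus O$. Resistance metric: for $x,y\in G$ there is a unique $f\in H^1(G)$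 with $f(y)=0$ and $q(f,g)=g(x)-g(y)$ for all $g\in H^1(G)$; the (effective) resistance is $r(x,y):=f(x)$. This defines a metric on $G$. For a Borel probability measure $\mu$ on $G$, let $H^1(G,\mu)=\{f\in H^1(G): f \text{ harmonic on } G\setminus\operatorname{supp}\mu\}$, regarded (injectively) as a dense subspace of $L^2(G,\mu)$. $H_\mu$ is the non-negative self-adjoint operator in $L^2(G,\mu)$ associated with the closed form $q|_{H^1(G,\mu)}$: $f\in\operatorname{dom}(H_\mu)$ and $H_\mu f=g$ iff $f\in H^1(G,\mu)$ and $q(f,\varphi)=\int_G g\varphi\,d\mu$ for all $\varphi\in H^1(G,\mu)$. Its spectrum is discrete; its eigenvalues, counted with multiplicity, are $0=\lambda_0(H_\mu)<\lambda_1(H_\mu)\le\lambda_2(H_\mu)\le\cdots$, with the convention $\lambda_k(H_\mu):=+\infty$ for $k\ge\dim L^2(G,\mu)$. Let $\lambda_k^{\min}(G):=\min_{\mu}\lambda_k(H_\mu)$, the minimum being over all Borel probability measures $\mu$ on $G$ (it is attained). *)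

theory Defs
  imports "HOL-Probability.Probability"
begin

section \<open>Metric graphs\<close>

text \<open>Finite multigraphs with loops; \<open>src\<close> and \<open>tgt\<close> record the orientation
  that is chosen to identify the edge \<open>e\<close> with the interval from \<open>0\<close> to \<open>len e\<close>.\<close>

record ('v, 'e) mgraph =
  verts :: "'v set"
  edges :: "'e set"
  src :: "'e \<Rightarrow> 'v"
  tgt :: "'e \<Rightarrow> 'v"
  len :: "'e \<Rightarrow> real"

definition joins :: "('v, 'e) mgraph \<Rightarrow> 'e \<Rightarrow> 'v \<Rightarrow> 'v \<Rightarrow> bool" where
  "joins G e u v \<longleftrightarrow> e \<in> edges G \<and> {src G e, tgt G e} = {u, v}"

definition adjacent :: "('v, 'e) mgraph \<Rightarrow> ('v \<times> 'v) set" where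
  "adjacent G = {(u, v). \<exists>e. joins G e u v}"

locale metric_graph =
  fixes G :: "('v, 'e) mgraph"
  assumes finite_verts: "finite (verts G)"
    and finite_edges: "finite (edges G)"
    and edges_nonempty: "edges G \<noteq> {}"
    and src_in_verts: "\<And>e. e \<in> edges G \<Longrightarrow> src G e \<in> verts G"
    and tgt_in_verts: "\<And>e. e \<in> edges G \<Longrightarrow> tgt G e \<in> verts G"
    and len_pos: "\<And>e. e \<in> edges G \<Longrightarrow> 0 < len G e"
    and connected_graph: "\<And>u v. u \<in> verts G \<Longrightarrow> v \<in> verts G \<Longrightarrow> (u, v) \<in> (adjacent G)\<^sup>*"

text \<open>Loops and pairs of parallel edges are cycles, of length one and two.\<close>

definition is_cycle :: "('v, 'e) mgraph \<Rightarrow> 'v list \<Rightarrow> 'e list \<Rightarrow> bool" where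
  "is_cycle G vs es \<longleftrightarrow>
     es \<noteq> [] \<and> length vs = length es \<and> distinct vs \<and> distinct es \<and>
     (\<forall>i<length es. joins G (es ! i) (vs ! i) (vs ! (Suc i mod length es)))"

definition is_tree :: "('v, 'e) mgraph \<Rightarrow> bool" where
  "is_tree G \<longleftrightarrow> metric_graph G \<and> (\<nexists>vs es. is_cycle G vs es)"

section \<open>The underlying topological space and its path metric\<close>

text \<open>The glued space is represented by normal forms: a point is a vertex, or an
  interior point of an edge with its coordinate. The gluing map on the edge \<open>e\<close> is
  \<open>edge_pt G e\<close>, of which only the values on the interval from \<open>0\<close> to \<open>len G e\<close> matter.\<close>

datatype ('v, 'e) point = Vertex 'v | Inner 'e real

definition points :: "('v, 'e) mgraph \<Rightarrow> ('v, 'e) point set" where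
  "points G = Vertex ` verts G \<union> {Inner e t | e t. e \<in> edges G \<and> 0 < t \<and> t < len G e}"

definition edge_pt :: "('v, 'e) mgraph \<Rightarrow> 'e \<Rightarrow> real \<Rightarrow> ('v, 'e) point" where
  "edge_pt G e t =
     (if t \<le> 0 then Vertex (src G e) else if len G e \<le> t then Vertex (tgt G e) else Inner e t)"

text \<open>The quotient (final) topology with respect to all gluing maps.\<close>

definition graph_top :: "('v, 'e) mgraph \<Rightarrow> ('v, 'e) point topology" where
  "graph_top G = topology (\<lambda>U. U \<subseteq> points G \<and>
     (\<forall>e\<in>edges G. openin (top_of_set {0..len G e}) {t \<in> {0..len G e}. edge_pt G e t \<in> U}))"

lemma openin_graph_top:
  "openin (graph_top G) U \<longleftrightarrow> U \<subseteq> points G \<and>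
     (\<forall>e\<in>edges G. openin (top_of_set {0..len G e}) {t \<in> {0..len G e}. edge_pt G e t \<in> U})"
proof -
  let ?P = "\<lambda>U. U \<subseteq> points G \<and>
     (\<forall>e\<in>edges G. openin (top_of_set {0..len G e}) {t \<in> {0..len G e}. edge_pt G e t \<in> U})"
  have "istopology ?P"
    unfolding istopology_def
  proof (intro conjI allI impI ballI)
    fix S T e assume S: "?P S" and T: "?P T" and e: "e \<in> edges G"
    have "{t \<in> {0..len G e}. edge_pt G e t \<in> S \<inter> T} =
        {t \<in> {0..len G e}. edge_pt G e t \<in> S} \<inter> {t \<in> {0..len G e}. edge_pt G e t \<in> T}"
      by auto
    with S T e show "openin (top_of_set {0..len G e}) {t \<in> {0..len G e}. edge_pt G e t \<in> S \<inter> T}"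
      by (simp only: openin_Int)
  next
    fix K e assume K: "\<forall>U\<in>K. ?P U" and e: "e \<in> edges G"
    have "{t \<in> {0..len G e}. edge_pt G e t \<in> \<Union>K} =
        (\<Union>U\<in>K. {t \<in> {0..len G e}. edge_pt G e t \<in> U})"
      by auto
    moreover have "openin (top_of_set {0..len G e}) \<dots>"
      by (rule openin_Union) (use K e in blast)
    ultimately show "openin (top_of_set {0..len G e}) {t \<in> {0..len G e}. edge_pt G e t \<in> \<Union>K}"
      by (simp only:)
  qed blast+
  then show ?thesis
    unfolding graph_top_def by (simp add: topology_inverse')
qed

lemma (in metric_graph) topspace_graph_top: "topspace (graph_top G) = points G"
proof -
  have "edge_pt G e t \<in> points G" if "e \<in> edges G" for e t
    using that src_in_verts tgt_in_verts by (auto simp: edge_pt_def points_def)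
  then have "{t \<in> {0..len G e}. edge_pt G e t \<in> points G} = {0..len G e}" if "e \<in> edges G" for e
    using that by auto
  then have "openin (graph_top G) (points G)"
    by (simp add: openin_graph_top)
  then show ?thesis
    by (metis openin_graph_top openin_subset openin_topspace subset_antisym)
qed

text \<open>\<open>path_length G x y L\<close>: some path from \<open>x\<close> to \<open>y\<close> in the space \<open>points G\<close>, i.e. a finite
  concatenation of segments of edges, has arc length \<open>L\<close>.\<close>

inductive path_length :: "('v, 'e) mgraph \<Rightarrow> ('v, 'e) point \<Rightarrow> ('v, 'e) point \<Rightarrow> real \<Rightarrow> bool"
  for G x where
  refl: "x \<in> points G \<Longrightarrow> path_length G x x 0"
| step: "path_length G x (edge_pt G e s) L \<Longrightarrow> e \<in> edges G \<Longrightarrow>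
    s \<in> {0..len G e} \<Longrightarrow> t \<in> {0..len G e} \<Longrightarrow> path_length G x (edge_pt G e t) (L + \<bar>t - s\<bar>)"

definition path_dist :: "('v, 'e) mgraph \<Rightarrow> ('v, 'e) point \<Rightarrow> ('v, 'e) point \<Rightarrow> real" where
  "path_dist G x y = (LEAST L. path_length G x y L)"

definition diam :: "('v, 'e) mgraph \<Rightarrow> (('v, 'e) point \<Rightarrow> ('v, 'e) point \<Rightarrow> real) \<Rightarrow> real" where
  "diam G d = (GREATEST D. \<exists>x\<in>points G. \<exists>y\<in>points G. D = d x y)"

section \<open>The Sobolev space and the energy form\<close>

definition L2 :: "'a measure \<Rightarrow> ('a \<Rightarrow> real) set" where
  "L2 M = {f \<in> borel_measurable M. integrable M (\<lambda>x. (f x)\<^sup>2)}"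

text \<open>\<open>f\<close> is continuously differentiable with derivative \<open>f'\<close>, and has compact support
  in the open interval from \<open>0\<close> to \<open>l\<close>.\<close>

definition test_function :: "real \<Rightarrow> (real \<Rightarrow> real) \<Rightarrow> (real \<Rightarrow> real) \<Rightarrow> bool" where
  "test_function l f f' \<longleftrightarrow>
     (\<forall>t. (f has_real_derivative f' t) (at t)) \<and> continuous_on UNIV f' \<and>
     (\<exists>K. compact K \<and> K \<subseteq> {0<..<l} \<and> (\<forall>t. t \<notin> K \<longrightarrow> f t = 0))"

definition has_weak_deriv :: "real \<Rightarrow> (real \<Rightarrow> real) \<Rightarrow> (real \<Rightarrow> real) \<Rightarrow> bool" where
  "has_weak_deriv l u v \<longleftrightarrow>
     u \<in> L2 (lebesgue_on {0<..<l}) \<and> v \<in> L2 (lebesgue_on {0<..<l}) \<and>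
     (\<forall>\<phi> \<phi>'. test_function l \<phi> \<phi>' \<longrightarrow>
        (LINT t|lebesgue_on {0<..<l}. u t * \<phi>' t) = - (LINT t|lebesgue_on {0<..<l}. v t * \<phi> t))"

text \<open>Membership in the Sobolev space of the interval; the weak derivative is unique up to
  null sets, and \<open>weak_deriv\<close> is an arbitrary version of it.\<close>

definition H1_interval :: "real \<Rightarrow> (real \<Rightarrow> real) set" where
  "H1_interval l = {u. \<exists>v. has_weak_deriv l u v}"

definition weak_deriv :: "real \<Rightarrow> (real \<Rightarrow> real) \<Rightarrow> real \<Rightarrow> real" where
  "weak_deriv l u = (SOME v. has_weak_deriv l u v)"

text \<open>Functions on the graph are total functions on the type of points; their values outside
  \<open>points G\<close> are irrelevant.\<close>

definition H1 :: "('v, 'e) mgraph \<Rightarrow> (('v, 'e) point \<Rightarrow> real) set" where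
  "H1 G = {f. continuous_map (graph_top G) euclideanreal f \<and>
              (\<forall>e\<in>edges G. f \<circ> edge_pt G e \<in> H1_interval (len G e))}"

definition q :: "('v, 'e) mgraph \<Rightarrow> (('v, 'e) point \<Rightarrow> real) \<Rightarrow> (('v, 'e) point \<Rightarrow> real) \<Rightarrow> real" where
  "q G f g = (\<Sum>e\<in>edges G. LINT t|lebesgue_on {0<..<len G e}.
       weak_deriv (len G e) (f \<circ> edge_pt G e) t * weak_deriv (len G e) (g \<circ> edge_pt G e) t)"

definition harmonic_on :: "('v, 'e) mgraph \<Rightarrow> ('v, 'e) point set \<Rightarrow> (('v, 'e) point \<Rightarrow> real) \<Rightarrow> bool" where
  "harmonic_on G U f \<longleftrightarrow> f \<in> H1 G \<and> (\<forall>g\<in>H1 G. (\<forall>x\<in>points G - U. g x = 0) \<longrightarrow> q G f g = 0)"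

text \<open>The potential \<open>f\<close> below is unique on \<open>points G\<close>, hence so is its value at \<open>x\<close>.\<close>

definition resistance :: "('v, 'e) mgraph \<Rightarrow> ('v, 'e) point \<Rightarrow> ('v, 'e) point \<Rightarrow> real" where
  "resistance G x y =
     (THE s. \<exists>f\<in>H1 G. f y = 0 \<and> (\<forall>g\<in>H1 G. q G f g = g x - g y) \<and> s = f x)"

section \<open>Borel probability measures and the associated operators\<close>

definition graph_borel :: "('v, 'e) mgraph \<Rightarrow> ('v, 'e) point measure" where
  "graph_borel G = sigma (points G) {U. openin (graph_top G) U}"

definition borel_prob :: "('v, 'e) mgraph \<Rightarrow> ('v, 'e) point measure \<Rightarrow> bool" where
  "borel_prob G \<mu> \<longleftrightarrow> prob_space \<mu> \<and> sets \<mu> = sets (graph_borel G)"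

definition supp :: "('v, 'e) mgraph \<Rightarrow> ('v, 'e) point measure \<Rightarrow> ('v, 'e) point set" where
  "supp G \<mu> = {x \<in> points G. \<forall>U. openin (graph_top G) U \<and> x \<in> U \<longrightarrow> 0 < emeasure \<mu> U}"

definition H1_mu :: "('v, 'e) mgraph \<Rightarrow> ('v, 'e) point measure \<Rightarrow> (('v, 'e) point \<Rightarrow> real) set" where
  "H1_mu G \<mu> = {f \<in> H1 G. harmonic_on G (points G - supp G \<mu>) f}"

text \<open>The graph of the operator \<open>H\<^sub>\<mu>\<close>. Elements of the Hilbert space are given by
  representatives: \<open>f\<close> is the harmonic representative of the argument, \<open>g\<close> any representative
  of the value.\<close>

definition H_op :: "('v, 'e) mgraph \<Rightarrow> ('v, 'e) point measure \<Rightarrow>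
    (('v, 'e) point \<Rightarrow> real) \<Rightarrow> (('v, 'e) point \<Rightarrow> real) \<Rightarrow> bool" where
  "H_op G \<mu> f g \<longleftrightarrow> f \<in> H1_mu G \<mu> \<and> g \<in> L2 \<mu> \<and>
     (\<forall>\<phi>\<in>H1_mu G \<mu>. q G f \<phi> = (LINT x|\<mu>. g x * \<phi> x))"

definition eigenspace :: "('v, 'e) mgraph \<Rightarrow> ('v, 'e) point measure \<Rightarrow> real \<Rightarrow>
    (('v, 'e) point \<Rightarrow> real) set" where
  "eigenspace G \<mu> c = {f. H_op G \<mu> f (\<lambda>x. c * f x)}"

text \<open>Dimension of the image of \<open>S\<close> in the Hilbert space, so linear independence is understood
  modulo null functions.\<close>

definition L2_dim :: "'a measure \<Rightarrow> ('a \<Rightarrow> real) set \<Rightarrow> enat" where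
  "L2_dim M S = Sup {enat n | n. \<exists>f. (\<forall>i<n. f i \<in> S) \<and>
     (\<forall>c :: nat \<Rightarrow> real. (AE x in M. (\<Sum>i<n. c i * f i x) = 0) \<longrightarrow> (\<forall>i<n. c i = 0))}"

text \<open>The entry with index \<open>k\<close> (counted from zero) of the nondecreasing list of eigenvalues,
  repeated according to multiplicity, is the least \<open>t\<close> such that the eigenvalues up to \<open>t\<close> have
  total multiplicity greater than \<open>k\<close>. Numbers that are not eigenvalues contribute
  multiplicity zero to the sum.\<close>

definition eigval :: "('v, 'e) mgraph \<Rightarrow> ('v, 'e) point measure \<Rightarrow> nat \<Rightarrow> ereal" where
  "eigval G \<mu> k =
     (if L2_dim \<mu> (L2 \<mu>) \<le> enat k then \<infinity>
      else Inf {ereal t | t. \<exists>\<Lambda>. finite \<Lambda> \<and> \<Lambda> \<subseteq> {..t} \<and>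
                  enat k < (\<Sum>c\<in>\<Lambda>. L2_dim \<mu> (eigenspace G \<mu> c))})"

definition eigval_min :: "('v, 'e) mgraph \<Rightarrow> nat \<Rightarrow> ereal" where
  "eigval_min G k = (LEAST v. \<exists>\<mu>. borel_prob G \<mu> \<and> v = eigval G \<mu> k)"

definition half_dirac :: "('v, 'e) mgraph \<Rightarrow> ('v, 'e) point \<Rightarrow> ('v, 'e) point \<Rightarrow>
    ('v, 'e) point measure" where
  "half_dirac G x y = measure_of (points G) (sets (graph_borel G))
     (\<lambda>A. ennreal (1/2) * emeasure (return (graph_borel G) x) A +
          ennreal (1/2) * emeasure (return (graph_borel G) y) A)"

end

theory Submission
  imports Defs "HOL-Real_Asymp.Real_Asymp"
begin

text \<open>Let \<open>D\<close> be the resistance diameter. If \<open>f\<close> is an eigenfunction of \<open>H\<^sub>\<mu>\<close> for the eigenvalue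
  \<open>c > 0\<close>, with maximum \<open>f x\<close> and minimum \<open>f y\<close>, then \<open>f\<close> has \<open>\<mu>\<close>-mean zero, so Popoviciu's inequality
  \<open>4 * \<integral>f\<^sup>2 d\<mu> \<le> (f x - f y)\<^sup>2\<close> and the resistance estimate \<open>(f x - f y)\<^sup>2 \<le> r(x,y) * q(f,f)\<close> together
  with \<open>q(f,f) = c * \<integral>f\<^sup>2 d\<mu>\<close> give \<open>4 \<le> D * c\<close>. Equality forces \<open>\<mu>\<close> to live on one maximum and one minimum
  point, and conversely the potential of a pair at distance \<open>D\<close>, shifted to mean zero, is an eigenfunction
  for \<open>4 / D\<close>. Potentials are found without Hilbert space theory: tent functions reduce the problem
  to weights on the vertices, where it is a discrete Poisson equation.\<close>

section \<open>Weak derivatives on an interval\<close>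

text \<open>The form \<open>q\<close> refers to an arbitrarily chosen weak derivative, so nothing
  can be computed with it before weak derivatives are known to be unique almost everywhere and to
  satisfy the fundamental theorem of calculus. After that, pairing a piecewise affine function with
  any \<open>g\<close> gives a finite combination of point values of \<open>g\<close>, and every
  explicit construction rests on this. The obstacle in describing the minimisers is that
  \<open>eigval\<close> is an infimum over thresholds: the value \<open>4 / D\<close> yields an
  eigenfunction only once eigenvalues are known not to accumulate, which is proved by a trace
  estimate. On a tree each edge is a bridge, so the function that rises with slope 1 along a segment
  and is constant elsewhere is the potential of the segment's end points. By symmetry of
  \<open>q\<close> it computes the increments of all other potentials, which makes resistance and
  path distance coincide.\<close>

lemma L2_mult_integrable:
  assumes "f \<in> L2 M" "g \<in> L2 M"
  shows "integrable M (\<lambda>x. f x * g x)"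
proof (rule Bochner_Integration.integrable_bound)
  show "integrable M (\<lambda>x. (f x)\<^sup>2 + (g x)\<^sup>2)"
    using assms by (auto simp: L2_def)
  show "(\<lambda>x. f x * g x) \<in> borel_measurable M"
    using assms by (auto simp: L2_def)
  have "\<bar>a * b\<bar> \<le> a\<^sup>2 + b\<^sup>2" for a b :: real
    using sum_squares_bound[of a b] sum_squares_bound[of a "-b"] zero_le_power2[of a] zero_le_power2[of b]
    by (auto simp: abs_if)
  then show "AE x in M. norm (f x * g x) \<le> norm ((f x)\<^sup>2 + (g x)\<^sup>2)"
    by auto
qed

lemma L2_add:
  assumes "f \<in> L2 M" "g \<in> L2 M"
  shows "(\<lambda>x. f x + g x) \<in> L2 M"
proof -
  have "integrable M (\<lambda>x. (f x)\<^sup>2 + (g x)\<^sup>2 + 2 * (f x * g x))"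
    using assms L2_mult_integrable[OF assms] by (auto simp: L2_def)
  then have "integrable M (\<lambda>x. (f x + g x)\<^sup>2)"
    by (simp add: power2_sum mult.assoc)
  with assms show ?thesis
    by (auto simp: L2_def)
qed

lemma L2_cmult: "f \<in> L2 M \<Longrightarrow> (\<lambda>x. c * f x) \<in> L2 M"
  by (auto simp: L2_def power_mult_distrib)

lemma bounded_in_L2:
  fixes f :: "'a \<Rightarrow> real"
  assumes "finite_measure M" "f \<in> borel_measurable M" "\<And>x. x \<in> space M \<Longrightarrow> \<bar>f x\<bar> \<le> B"
  shows "f \<in> L2 M"
proof -
  have "integrable M (\<lambda>x. (f x)\<^sup>2)"
  proof (rule finite_measure.integrable_const_bound[OF assms(1), of _ "B\<^sup>2"])
    show "AE x in M. norm ((f x)\<^sup>2) \<le> B\<^sup>2"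
      using assms(3) by (intro AE_I2) (auto simp: abs_le_square_iff intro!: power2_le_iff_abs_le[THEN iffD2] order_trans[OF abs_ge_zero])
  qed (use assms in auto)
  with assms show ?thesis by (auto simp: L2_def)
qed

lemma finite_measure_interval: "finite_measure (lebesgue_on {0<..<l::real})"
  by (rule finite_measure_lebesgue_on) simp

lemma continuous_on_in_L2:
  fixes u :: "real \<Rightarrow> real"
  assumes "continuous_on {0..l} u"
  shows "u \<in> L2 (lebesgue_on {0<..<l})"
proof -
  have "bounded (u ` {0..l})"
    using assms compact_continuous_image compact_imp_bounded by blast
  then obtain B where B: "\<And>x. x \<in> {0..l} \<Longrightarrow> \<bar>u x\<bar> \<le> B"
    by (metis bounded_iff imageI real_norm_def)
  have "continuous_on {0<..<l} u"
    by (rule continuous_on_subset[OF assms]) auto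
  then have "u \<in> borel_measurable (lebesgue_on {0<..<l})"
    by (intro continuous_imp_measurable_on_sets_lebesgue) auto
  then show ?thesis
    using B by (intro bounded_in_L2[where B=B] finite_measure_interval) auto
qed

lemma test_function_continuous:
  assumes "test_function l p p'"
  shows "continuous_on A p" "continuous_on A p'"
proof -
  have "\<forall>t. isCont p t"
    using assms by (auto simp: test_function_def intro: DERIV_isCont)
  then show "continuous_on A p"
    by (simp add: continuous_at_imp_continuous_on)
  show "continuous_on A p'"
    using assms continuous_on_subset by (auto simp: test_function_def)
qed

lemma has_weak_deriv_linear:
  assumes "has_weak_deriv l u v" "has_weak_deriv l u' v'"
  shows "has_weak_deriv l (\<lambda>t. a * u t + b * u' t) (\<lambda>t. a * v t + b * v' t)"
proof -
  let ?M = "lebesgue_on {0<..<l}"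
  have L2: "u \<in> L2 ?M" "u' \<in> L2 ?M" "v \<in> L2 ?M" "v' \<in> L2 ?M"
    using assms by (auto simp: has_weak_deriv_def)
  have "(LINT t|?M. (a * u t + b * u' t) * p' t) = - (LINT t|?M. (a * v t + b * v' t) * p t)"
    if p: "test_function l p p'" for p p'
  proof -
    have pL2: "p \<in> L2 ?M" "p' \<in> L2 ?M"
      using test_function_continuous[OF p] continuous_on_in_L2 by blast+
    have int: "integrable ?M (\<lambda>t. u t * p' t)" "integrable ?M (\<lambda>t. u' t * p' t)"
      "integrable ?M (\<lambda>t. v t * p t)" "integrable ?M (\<lambda>t. v' t * p t)"
      using L2 pL2 L2_mult_integrable by blast+
    have "(LINT t|?M. (a * u t + b * u' t) * p' t) =
        a * (LINT t|?M. u t * p' t) + b * (LINT t|?M. u' t * p' t)"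
      using int by (simp add: distrib_right mult.assoc)
    moreover have "(LINT t|?M. (a * v t + b * v' t) * p t) =
        a * (LINT t|?M. v t * p t) + b * (LINT t|?M. v' t * p t)"
      using int by (simp add: distrib_right mult.assoc)
    ultimately show ?thesis
      using assms p by (simp add: has_weak_deriv_def algebra_simps)
  qed
  then show ?thesis
    using L2 by (auto simp: has_weak_deriv_def intro!: L2_add L2_cmult)
qed

lemma has_weak_deriv_cong:
  assumes "has_weak_deriv l u v" "\<And>t. t \<in> {0<..<l} \<Longrightarrow> u' t = u t"
  shows "has_weak_deriv l u' v"
proof -
  let ?M = "lebesgue_on {0<..<l}"
  have "u' \<in> borel_measurable ?M \<longleftrightarrow> u \<in> borel_measurable ?M"
    by (rule measurable_cong) (use assms(2) in simp)
  moreover have "integrable ?M (\<lambda>x. (u' x)\<^sup>2) \<longleftrightarrow> integrable ?M (\<lambda>x. (u x)\<^sup>2)"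
    by (rule Bochner_Integration.integrable_cong) (use assms(2) in auto)
  moreover have "(LINT t|?M. u' t * p' t) = (LINT t|?M. u t * p' t)" for p'
    by (rule Bochner_Integration.integral_cong) (use assms(2) in auto)
  ultimately show ?thesis
    using assms(1) by (simp add: has_weak_deriv_def L2_def)
qed

lemma LINT_interval_eq_integral:
  fixes f :: "real \<Rightarrow> real"
  assumes "integrable (lebesgue_on {0<..<l}) f" "(f has_integral i) {0..l}"
  shows "(LINT t|lebesgue_on {0<..<l}. f t) = i"
proof -
  have "(LINT t|lebesgue_on {0<..<l}. f t) = integral {0<..<l} f"
    by (rule lebesgue_integral_eq_integral) (use assms in auto)
  also have "\<dots> = integral {0..l} f"
    by (simp add: integral_open_interval_real)
  finally show ?thesis using assms(2) by (simp add: integral_unique)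
qed

lemma step_in_L2:
  fixes s l :: real
  shows "(\<lambda>t. if t < s then 1 else 0 :: real) \<in> L2 (lebesgue_on {0<..<l})"
proof (rule bounded_in_L2[where B=1])
  have "(\<lambda>t. indicator {..<s} t :: real) \<in> borel_measurable (lebesgue_on {0<..<l})"
    using sets_completionI_sets[of "{..<s}" lborel]
    by (intro measurable_restrict_space1 borel_measurable_indicator) simp
  then show "(\<lambda>t. if t < s then 1 else 0 :: real) \<in> borel_measurable (lebesgue_on {0<..<l})"
    by (simp add: indicator_def of_bool_def)
qed (auto intro: finite_measure_interval)

text \<open>Truncations are the atoms of all explicit functions below. Since the weak derivative is
  the indicator of an initial segment, pairing with it will read off
  \<open>g s - g 0\<close>.\<close>

lemma has_weak_deriv_min:
  assumes "0 \<le> s" "0 \<le> l"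
  shows "has_weak_deriv l (\<lambda>t. min t s) (\<lambda>t. if t < s then 1 else 0)"
  unfolding has_weak_deriv_def
proof (intro conjI allI impI step_in_L2)
  let ?M = "lebesgue_on {0<..<l}"
  show L2min: "(\<lambda>t. min t s) \<in> L2 ?M"
    by (intro continuous_on_in_L2 continuous_intros)
  fix p p' assume p: "test_function l p p'"
  note cont = test_function_continuous[OF p]
  have pl: "p l = 0" using p by (auto simp: test_function_def)
  have int1: "integrable ?M (\<lambda>t. min t s * p' t)"
    by (intro L2_mult_integrable L2min continuous_on_in_L2 cont)
  have int2: "integrable ?M (\<lambda>t. (if t < s then 1 else 0) * p t)"
    by (intro L2_mult_integrable step_in_L2 continuous_on_in_L2 cont)
  have "((\<lambda>t. min t s * p' t + (if t < s then 1 else 0) * p t) has_integral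
      min l s * p l - min 0 s * p 0) {0..l}"
  \<comment> \<open>The kink at \<open>s\<close> is the only exceptional point. Both boundary terms
    vanish, because \<open>p l = 0\<close> and \<open>min 0 s = 0\<close>.\<close>
  proof (rule fundamental_theorem_of_calculus_interior_strong[where S="{s}"])
    show "continuous_on {0..l} (\<lambda>t. min t s * p t)"
      by (intro continuous_intros cont)
    fix t assume t: "t \<in> {0<..<l} - {s}"
    have dp: "(p has_real_derivative p' t) (at t)" using p by (auto simp: test_function_def)
    have "((\<lambda>t. min t s) has_real_derivative (if t < s then 1 else 0)) (at t)"
    proof (cases "t < s")
      case True
      have "\<forall>\<^sub>F x in nhds t. x < s" using True by (rule eventually_nhds_in_open[of "{..<s}", simplified])
      then have "\<forall>\<^sub>F x in nhds t. x = min x s" by eventually_elim auto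
      with DERIV_cong_ev[OF HOL.refl this, of 1 1] True show ?thesis by simp
    next
      case False
      then have "t > s" using t by auto
      then have "\<forall>\<^sub>F x in nhds t. x > s" by (rule eventually_nhds_in_open[of "{s<..}", simplified])
      then have "\<forall>\<^sub>F x in nhds t. s = min x s" by eventually_elim auto
      with DERIV_cong_ev[OF HOL.refl this, of 0 0] False show ?thesis by simp
    qed
    from DERIV_mult[OF this dp]
    have "((\<lambda>t. min t s * p t) has_real_derivative min t s * p' t + (if t < s then 1 else 0) * p t) (at t)"
      by (simp add: algebra_simps)
    then show "((\<lambda>t. min t s * p t) has_vector_derivative min t s * p' t + (if t < s then 1 else 0) * p t) (at t)"
      by (simp add: has_real_derivative_iff_has_vector_derivative)
  qed (use assms in auto)
  then have "((\<lambda>t. min t s * p' t + (if t < s then 1 else 0) * p t) has_integral 0) {0..l}"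
    using pl assms by simp
  then have "(LINT t|?M. min t s * p' t + (if t < s then 1 else 0) * p t) = 0"
    by (intro LINT_interval_eq_integral Bochner_Integration.integrable_add int1 int2)
  then show "(LINT t|?M. min t s * p' t) = - (LINT t|?M. (if t < s then 1 else 0) * p t)"
    using Bochner_Integration.integral_add[OF int1 int2] by linarith
qed

lemma has_weak_deriv_const:
  assumes "0 \<le> l"
  shows "has_weak_deriv l (\<lambda>t. c) (\<lambda>t. 0)"
  unfolding has_weak_deriv_def
proof (intro conjI allI impI continuous_on_in_L2 continuous_on_const)
  let ?M = "lebesgue_on {0<..<l}"
  fix p p' assume p: "test_function l p p'"
  note cont = test_function_continuous[OF p]
  have int: "integrable ?M (\<lambda>t. c * p' t)"
    by (intro L2_mult_integrable continuous_on_in_L2 cont continuous_on_const)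
  have "(p' has_integral p l - p 0) {0..l}"
    by (rule fundamental_theorem_of_calculus)
      (use assms p in \<open>auto simp: test_function_def has_real_derivative_iff_has_vector_derivative[symmetric] intro: has_field_derivative_at_within\<close>)
  then have "((\<lambda>t. c * p' t) has_integral c * (p l - p 0)) {0..l}"
    by (rule has_integral_mult_right)
  moreover have "p l = 0" "p 0 = 0" using p by (auto simp: test_function_def)
  ultimately show "(LINT t|?M. c * p' t) = - (LINT t|?M. 0 * p t)"
    using LINT_interval_eq_integral[OF int] by simp
qed


section \<open>A continuously differentiable step and the fundamental theorem for weak
  derivatives\<close>

lemma DERIV_max_0_square: "((\<lambda>x::real. (max 0 x)\<^sup>2) has_real_derivative 2 * max 0 x) (at x)"
proof (cases x "0::real" rule: linorder_cases)
  case less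
  then have "\<forall>\<^sub>F y in nhds x. y < 0" using eventually_nhds_in_open[of "{..<0}" x] by simp
  then have "\<forall>\<^sub>F y in nhds x. 0 = (max 0 y)\<^sup>2" by eventually_elim auto
  with DERIV_cong_ev[OF HOL.refl this, of 0 0] less show ?thesis by simp
next
  case greater
  then have "\<forall>\<^sub>F y in nhds x. y > 0" using eventually_nhds_in_open[of "{0<..}" x] by simp
  then have "\<forall>\<^sub>F y in nhds x. y\<^sup>2 = (max 0 y)\<^sup>2" by eventually_elim auto
  from DERIV_cong_ev[OF HOL.refl this, of "2 * x" "2 * x"]
  have "((\<lambda>y. (max 0 y)\<^sup>2) has_real_derivative 2 * x) (at x)"
    using DERIV_pow[of 2 x UNIV] by simp
  then show ?thesis using greater by simp
next
  case equal
  have "((\<lambda>h::real. (max 0 h)\<^sup>2 / h) \<longlongrightarrow> 0) (at 0)"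
  proof (rule tendsto_0_le[where K=1 and f="\<lambda>h. h"])
    show "\<forall>\<^sub>F h::real in at 0. norm ((max 0 h)\<^sup>2 / h) \<le> norm h * 1"
      by (rule always_eventually) (auto simp: max_def power2_eq_square)
  qed (rule tendsto_ident_at)
  then show ?thesis
    by (simp add: DERIV_def equal)
qed

text \<open>Test functions must be continuously differentiable, so the unit step is the
  antiderivative of the triangle \<open>hat\<close>, which has base from 0 to 2 and area 1. The
  coefficients 1, -2, 1 form a second difference, which makes \<open>hat\<close> vanish beyond
  2.\<close>

definition smooth_step :: "real \<Rightarrow> real" where
  "smooth_step x = ((max 0 x)\<^sup>2 - 2 * (max 0 (x - 1))\<^sup>2 + (max 0 (x - 2))\<^sup>2) / 2"

definition hat :: "real \<Rightarrow> real" where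
  "hat x = max 0 x - 2 * max 0 (x - 1) + max 0 (x - 2)"

lemma DERIV_smooth_step:
  assumes "h \<noteq> 0"
  shows "((\<lambda>x. smooth_step ((x - a) / h)) has_real_derivative hat ((x - a) / h) / h) (at x)"
proof -
  have d: "((\<lambda>y. (max 0 (y - c))\<^sup>2) has_real_derivative 2 * max 0 (z - c)) (at z)" for c z :: real
    using DERIV_chain2[OF DERIV_max_0_square DERIV_diff[OF DERIV_ident DERIV_const]] by simp
  have "(smooth_step has_real_derivative hat z) (at z)" for z
    unfolding smooth_step_def hat_def
    by (rule derivative_eq_intros d d[of 0, simplified] HOL.refl | simp)+
  moreover have "((\<lambda>x. (x - a) / h) has_real_derivative 1 / h) (at x)"
    using assms by (auto intro!: derivative_eq_intros)
  ultimately show ?thesis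
    using DERIV_chain2[of smooth_step] by fastforce
qed

lemma smooth_step_left: "x \<le> 0 \<Longrightarrow> smooth_step x = 0"
  and smooth_step_right: "2 \<le> x \<Longrightarrow> smooth_step x = 1"
  and hat_outside: "x \<le> 0 \<or> 2 \<le> x \<Longrightarrow> hat x = 0"
  and hat_nonneg: "0 \<le> hat x"
  by (auto simp: smooth_step_def hat_def max_def power2_eq_square algebra_simps)

lemma smooth_step_bounds: "smooth_step x \<in> {0..1}"
proof -
  consider "x \<le> 0" | "0 \<le> x" "x \<le> 1" | "1 \<le> x" "x \<le> 2" | "2 \<le> x" by linarith
  then show ?thesis
  proof cases
    case 2
    then have "smooth_step x = x\<^sup>2 / 2" by (simp add: smooth_step_def max_def)
    moreover have "x\<^sup>2 \<le> 1" "0 \<le> x\<^sup>2" using 2 by (simp_all add: power_le_one)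
    ultimately show ?thesis unfolding atLeastAtMost_iff by linarith
  next
    case 3
    then have "2 * smooth_step x = 2 - (2 - x)\<^sup>2"
      by (simp add: smooth_step_def max_def power2_eq_square field_simps)
    moreover have "(2 - x)\<^sup>2 \<le> 1" "0 \<le> (2 - x)\<^sup>2" using 3 by (simp_all add: power_le_one)
    ultimately show ?thesis unfolding atLeastAtMost_iff by linarith
  qed (auto simp: smooth_step_left smooth_step_right)
qed

lemma continuous_on_hat: "h \<noteq> 0 \<Longrightarrow> continuous_on A (\<lambda>x. hat ((x - a) / h) / h)"
  unfolding hat_def by (intro continuous_intros) auto

text \<open>The weight is nonnegative, has integral 1 and vanishes off
  \<open>{a..a + 2 * h}\<close>, so the integral is a weighted mean of values of \<open>u\<close>
  within \<epsilon> of \<open>c\<close>.\<close>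

lemma hat_average:
  assumes u: "continuous_on {0..l} u" and "0 \<le> a" "0 < h" "a + 2 * h \<le> l"
    and close: "\<And>x. x \<in> {a..a + 2 * h} \<Longrightarrow> \<bar>u x - c\<bar> \<le> \<epsilon>"
  shows "\<bar>(LINT x|lebesgue_on {0<..<l}. u x * (hat ((x - a) / h) / h)) - c\<bar> \<le> \<epsilon>"
proof -
  let ?M = "lebesgue_on {0<..<l}" and ?w = "\<lambda>x. hat ((x - a) / h) / h"
  have w: "continuous_on {0..l} ?w" using assms by (intro continuous_on_hat) auto
  have int: "integrable ?M (\<lambda>x. f x * ?w x)" if "continuous_on {0..l} f" for f
    using that w by (intro L2_mult_integrable continuous_on_in_L2)
  have int1: "integrable ?M ?w" using int[of "\<lambda>_. 1"] by simp
  have w0: "0 \<le> ?w x" for x using assms by (simp add: hat_nonneg)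
  have "(?w has_integral smooth_step ((l - a) / h) - smooth_step ((0 - a) / h)) {0..l}"
    by (rule fundamental_theorem_of_calculus)
      (use assms in \<open>auto intro!: has_field_derivative_at_within DERIV_smooth_step
         simp: has_real_derivative_iff_has_vector_derivative[symmetric]\<close>)
  moreover have "smooth_step ((l - a) / h) = 1" "smooth_step ((0 - a) / h) = 0"
    using assms by (auto intro!: smooth_step_left smooth_step_right simp: field_simps)
  ultimately have w1: "(LINT x|?M. ?w x) = 1"
    using LINT_interval_eq_integral[OF int1] by simp
  have "\<bar>(LINT x|?M. u x * ?w x) - c\<bar> = \<bar>LINT x|?M. (u x - c) * ?w x\<bar>"
  proof -
    have "(LINT x|?M. (u x - c) * ?w x) = (LINT x|?M. u x * ?w x - c * ?w x)"
      by (simp only: left_diff_distrib)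
    also have "\<dots> = (LINT x|?M. u x * ?w x) - (LINT x|?M. c * ?w x)"
      by (rule Bochner_Integration.integral_diff[OF int[OF u] integrable_mult_right[OF int1]])
    also have "(LINT x|?M. c * ?w x) = c"
      using w1 by (simp only: integral_mult_right_zero mult_1_right)
    finally show ?thesis by simp
  qed
  also have "\<dots> \<le> (LINT x|?M. \<bar>(u x - c) * ?w x\<bar>)"
    by (rule integral_abs_bound)
  also have "\<dots> \<le> (LINT x|?M. \<epsilon> * ?w x)"
  proof (rule integral_mono)
    show "integrable ?M (\<lambda>x. \<bar>(u x - c) * ?w x\<bar>)"
      by (intro integrable_abs int continuous_intros u)
    show "\<bar>(u x - c) * ?w x\<bar> \<le> \<epsilon> * ?w x" for x
    proof (cases "x \<in> {a..a + 2 * h}")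
      case True
      then show ?thesis using close[OF True] w0[of x] by (simp only: abs_mult abs_of_nonneg mult_right_mono)
    next
      case False
      then have "?w x = 0" using assms by (auto simp: field_simps intro!: hat_outside)
      then show ?thesis by (simp only: mult_zero_right abs_zero order_refl)
    qed
  qed (rule integrable_mult_right[OF int1])
  also have "\<dots> = \<epsilon>" using w1 by simp
  finally show ?thesis .
qed

text \<open>Test functions that rise from \<open>0\<close> to \<open>1\<close> just after \<open>0\<close> and fall back just before \<open>s\<close> turn the
  definition of the weak derivative into the fundamental theorem of calculus in the limit.\<close>

lemma weak_FTC:
  assumes v: "has_weak_deriv l u v" and u: "continuous_on {0..l} u" and s: "0 \<le> s" "s \<le> l"
  shows "(LINT t|lebesgue_on {0<..<l}. (if t < s then 1 else 0) * v t) = u s - u 0"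
proof (cases "s = 0")
  case True
  have "(LINT t|lebesgue_on {0<..<l}. (if t < s then 1 else 0) * v t) = (LINT t|lebesgue_on {0<..<l}. 0)"
    by (rule Bochner_Integration.integral_cong) (use True in auto)
  with True show ?thesis by simp
next
  case False
  let ?M = "lebesgue_on {0<..<l}"
  \<comment> \<open>The summand 10 gives \<open>10 * h n \<le> s\<close>, so the ramps on
    \<open>{h n..3 * h n}\<close> and \<open>{s - 3 * h n..s - h n}\<close> are disjoint and stay
    inside the open interval.\<close>
  define h where "h n = s / (real n + 10)" for n
  have h: "0 < h n" "10 * h n \<le> s" for n
    using False s by (auto simp: h_def field_simps)
  have h0: "h \<longlonglongrightarrow> 0"
    unfolding h_def by real_asymp
  define p where "p n x = smooth_step ((x - h n) / h n) - smooth_step ((x - (s - 3 * h n)) / h n)" for n x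
  define p' where "p' n x = hat ((x - h n) / h n) / h n - hat ((x - (s - 3 * h n)) / h n) / h n" for n x
  have test: "test_function l (p n) (p' n)" for n
    unfolding test_function_def
  proof (intro conjI allI exI)
    show "(p n has_real_derivative p' n t) (at t)" for t
      unfolding p_def p'_def using h(1)[of n] by (intro DERIV_diff DERIV_smooth_step) auto
    show "continuous_on UNIV (p' n)"
      unfolding p'_def using h(1)[of n] by (intro continuous_intros continuous_on_hat) auto
    show "compact {h n..s - h n}" by simp
    show "{h n..s - h n} \<subseteq> {0<..<l}" using h[of n] s by auto
    fix t show "t \<notin> {h n..s - h n} \<longrightarrow> p n t = 0"
    proof
      assume "t \<notin> {h n..s - h n}"
      then consider "t \<le> h n" | "s - h n \<le> t" by force
      then show "p n t = 0"
      proof cases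
        case 1
        then have "(t - h n) / h n \<le> 0" "(t - (s - 3 * h n)) / h n \<le> 0"
          using h[of n] by (auto intro!: divide_nonpos_pos)
        then show ?thesis by (simp add: p_def smooth_step_left)
      next
        case 2
        then have "(t - h n) / h n \<ge> 2" "(t - (s - 3 * h n)) / h n \<ge> 2"
          using h[of n] by (auto simp: pos_le_divide_eq)
        then show ?thesis by (simp add: p_def smooth_step_right)
      qed
    qed
  qed
  have weak: "(LINT t|?M. u t * p' n t) = - (LINT t|?M. v t * p n t)" for n
    using v test by (auto simp: has_weak_deriv_def)
  have near: "\<forall>\<^sub>F n in sequentially. \<bar>(LINT t|?M. u t * (hat ((t - a n) / h n) / h n)) - u c\<bar> \<le> \<epsilon>"
    if asm: "\<epsilon> > 0" "c \<in> {0..l}" "\<And>n. 0 \<le> a n" "\<And>n. a n + 2 * h n \<le> l" "\<And>n. \<bar>a n - c\<bar> \<le> 3 * h n" for \<epsilon> c a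
  proof -
    obtain d where d: "d > 0" "\<And>x. x \<in> {0..l} \<Longrightarrow> \<bar>x - c\<bar> < d \<Longrightarrow> \<bar>u x - u c\<bar> < \<epsilon>"
      using u asm(1,2) unfolding continuous_on_iff by (metis dist_real_def)
    have "\<forall>\<^sub>F n in sequentially. h n < d / 5"
      using d(1) h0 by (intro order_tendstoD) auto
    then show ?thesis
    proof eventually_elim
      case (elim n)
      show ?case
      proof (rule hat_average[OF u asm(3) h(1) asm(4)])
        fix x assume x: "x \<in> {a n..a n + 2 * h n}"
        then have "x \<in> {0..l}" "\<bar>x - c\<bar> < d"
          using elim asm(3,4,5)[of n] h[of n] by (auto simp: abs_le_iff abs_less_iff)
        then show "\<bar>u x - u c\<bar> \<le> \<epsilon>" using d(2) by fastforce
      qed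
    qed
  qed
  have lim: "(\<lambda>n. LINT t|?M. u t * (hat ((t - a n) / h n) / h n)) \<longlonglongrightarrow> u c"
    if "c \<in> {0..l}" "\<And>n. 0 \<le> a n" "\<And>n. a n + 2 * h n \<le> l" "\<And>n. \<bar>a n - c\<bar> \<le> 3 * h n" for c a
  proof (rule tendstoI)
    fix e :: real assume "e > 0"
    then have "e / 2 > 0" by simp
    from near[OF this that] show "\<forall>\<^sub>F n in sequentially. dist (LINT t|?M. u t * (hat ((t - a n) / h n) / h n)) (u c) < e"
      by eventually_elim (use \<open>e > 0\<close> in \<open>auto simp: dist_real_def\<close>)
  qed
  have "(\<lambda>n. (LINT t|?M. u t * (hat ((t - h n) / h n) / h n))
      - (LINT t|?M. u t * (hat ((t - (s - 3 * h n)) / h n) / h n))) \<longlonglongrightarrow> u 0 - u s"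
  proof (intro tendsto_diff lim)
    fix n show "0 \<le> h n" "h n + 2 * h n \<le> l" "0 \<le> s - 3 * h n" "s - 3 * h n + 2 * h n \<le> l"
      "\<bar>h n - 0\<bar> \<le> 3 * h n" "\<bar>s - 3 * h n - s\<bar> \<le> 3 * h n"
      using h[of n] s by auto
  qed (use s in auto)
  moreover have "(LINT t|?M. u t * (hat ((t - h n) / h n) / h n))
      - (LINT t|?M. u t * (hat ((t - (s - 3 * h n)) / h n) / h n)) = (LINT t|?M. u t * p' n t)" for n
  proof -
    have "integrable ?M (\<lambda>t. u t * (hat ((t - a) / h n) / h n))" for a
      using h(1)[of n] by (intro L2_mult_integrable continuous_on_in_L2 u continuous_on_hat) auto
    then show ?thesis by (simp add: p'_def right_diff_distrib)
  qed
  ultimately have "(\<lambda>n. LINT t|?M. v t * p n t) \<longlonglongrightarrow> u s - u 0"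
    using tendsto_minus by (fastforce simp: weak)
  moreover have "(\<lambda>n. LINT t|?M. v t * p n t) \<longlonglongrightarrow> (LINT t|?M. (if t < s then 1 else 0) * v t)"
  proof (rule integral_dominated_convergence)
    have vL2: "v \<in> L2 ?M" using v by (simp add: has_weak_deriv_def)
    have int: "integrable ?M (\<lambda>t. v t * f t)" if "f \<in> L2 ?M" for f
      using L2_mult_integrable[OF vL2 that] .
    show "integrable ?M (\<lambda>t. \<bar>v t\<bar>)"
      using int[OF continuous_on_in_L2, of "\<lambda>_. 1"] by simp
    show "(\<lambda>t. v t * p n t) \<in> borel_measurable ?M" for n
      by (intro borel_measurable_integrable int continuous_on_in_L2 test_function_continuous(1)[OF test])
    show "(\<lambda>t. (if t < s then 1 else 0) * v t) \<in> borel_measurable ?M"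
      using borel_measurable_integrable[OF int[OF step_in_L2]] by (simp add: mult.commute)
    have "\<bar>p n t\<bar> \<le> 1" for n t
      using smooth_step_bounds[of "(t - h n) / h n"] smooth_step_bounds[of "(t - (s - 3 * h n)) / h n"]
      by (auto simp: p_def abs_le_iff)
    then show "AE t in ?M. norm (v t * p n t) \<le> \<bar>v t\<bar>" for n
      by (auto simp: abs_mult intro!: mult_left_le)
    show "AE t in ?M. (\<lambda>n. v t * p n t) \<longlonglongrightarrow> (if t < s then 1 else 0) * v t"
    proof (rule AE_I2)
      fix t assume "t \<in> space ?M"
      then have t: "0 < t" "t < l" by auto
      have "\<forall>\<^sub>F n in sequentially. p n t = (if t < s then 1 else 0)"
      proof (cases "t < s")
        case True
        have "\<forall>\<^sub>F n in sequentially. h n < min (t / 3) ((s - t) / 3)"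
          using t True h0 by (intro order_tendstoD) auto
        then show ?thesis
        proof eventually_elim
          case (elim n)
          then have "(t - h n) / h n \<ge> 2" "(t - (s - 3 * h n)) / h n \<le> 0"
            using h[of n] by (auto simp: pos_le_divide_eq pos_divide_le_eq)
          then show ?case using True by (simp add: p_def smooth_step_left smooth_step_right)
        qed
      next
        case False
        have "p n t = 0" for n
        proof -
          have "(t - h n) / h n \<ge> 2" "(t - (s - 3 * h n)) / h n \<ge> 2"
            using False h[of n] by (auto simp: pos_le_divide_eq)
          then show ?thesis by (simp add: p_def smooth_step_right)
        qed
        then show ?thesis using False by simp
      qed
      then have "\<forall>\<^sub>F n in sequentially. v t * p n t = (if t < s then 1 else 0) * v t"
        by eventually_elim auto
      then show "(\<lambda>n. v t * p n t) \<longlonglongrightarrow> (if t < s then 1 else 0) * v t"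
        by (rule tendsto_eventually)
    qed
  qed
  ultimately show ?thesis
    using LIMSEQ_unique by blast
qed


section \<open>Almost everywhere uniqueness of weak derivatives and exact pairings\<close>

lemma AE_zero_of_initial_integrals:
  fixes w :: "real \<Rightarrow> real"
  assumes w: "integrable (lebesgue_on {0<..<l}) w" and "0 \<le> l"
    and zero: "\<And>s. s \<in> {0..l} \<Longrightarrow> (LINT t|lebesgue_on {0<..<l}. (if t < s then 1 else 0) * w t) = 0"
  shows "AE t in lebesgue_on {0<..<l}. w t = 0"
proof -
  let ?M = "lebesgue_on {0<..<l}"
  have borel_sets: "A \<inter> {0<..<l} \<in> sets ?M" if "A \<in> sets borel" for A
    using that sets_completionI_sets[of A lborel] by (auto simp: sets_restrict_space)
  have ind: "(indicator A :: real \<Rightarrow> real) \<in> borel_measurable ?M" if "A \<in> sets borel" for A :: "real set"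
    using that sets_completionI_sets[of A lborel]
    by (intro measurable_restrict_space1 borel_measurable_indicator) simp
  have int: "integrable ?M (\<lambda>t. indicator A t * w t)" if "A \<in> sets borel" for A
    by (rule Bochner_Integration.integrable_bound[OF w])
      (use ind[OF that] w in \<open>auto split: split_indicator\<close>)
  have all: "(LINT t|?M. w t) = 0"
  proof -
    have "(LINT t|?M. w t) = (LINT t|?M. (if t < l then 1 else 0) * w t)"
      by (rule Bochner_Integration.integral_cong) auto
    then show ?thesis using zero[of l] \<open>0 \<le> l\<close> by simp
  qed
  have borel0: "(LINT t|?M. indicator A t * w t) = 0" if "A \<in> sets borel" for A
  proof -
    have "{..<a} \<inter> {..<b} = {..<min a b}" for a b :: real
      by auto
    then have "Int_stable (range (lessThan :: real \<Rightarrow> _))" "range (lessThan :: real \<Rightarrow> _) \<subseteq> Pow UNIV"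
      by (auto simp: Int_stable_def)
    moreover have "A \<in> sigma_sets UNIV (range lessThan)"
      using that by (simp add: borel_Iio)
    ultimately show ?thesis
    \<comment> \<open>The hypothesis covers a generator of the Borel sets that is closed under
      intersection; the sets with vanishing integral are closed under complements, by
      \<open>all\<close>, and under countable disjoint unions.\<close>
    proof (induction rule: sigma_sets_induct_disjoint)
      case (basic A)
      then obtain s where A: "A = {..<s}" by auto
      have "(LINT t|?M. indicator A t * w t) = (LINT t|?M. (if t < max 0 (min s l) then 1 else 0) * w t)"
        by (rule Bochner_Integration.integral_cong) (auto simp: A split: split_indicator)
      also have "\<dots> = 0" using \<open>0 \<le> l\<close> by (intro zero) auto
      finally show ?case .
    next
      case empty
      show ?case by simp
    next
      case (compl A)
      then have A: "A \<in> sets borel" by (simp add: borel_Iio)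
      have "(LINT t|?M. indicator (UNIV - A) t * w t) = (LINT t|?M. w t - indicator A t * w t)"
        by (rule Bochner_Integration.integral_cong) (auto split: split_indicator)
      then show ?case using all w int[OF A] compl by simp
    next
      case (union A)
      then have A: "A i \<in> sets borel" for i by (auto simp: borel_Iio)
      let ?B = "\<lambda>i. A i \<inter> {0<..<l}"
      have eq: "indicator (X \<inter> {0<..<l}) t * w t = indicator X t * w t" if "t \<in> space ?M" for X t
        using that by (auto split: split_indicator)
      have B: "(LINT t:X \<inter> {0<..<l}|?M. w t) = (LINT t|?M. indicator X t * w t)" for X
        unfolding set_lebesgue_integral_def
        by (rule Bochner_Integration.integral_cong) (use eq in auto)
      have setint: "set_integrable ?M X w" if "X \<in> sets ?M" for X
        unfolding set_integrable_def by (rule integrable_mult_indicator[OF that w])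
      have "(LINT t:(\<Union>i. ?B i)|?M. w t) = (\<Sum>i. LINT t:?B i|?M. w t)"
      proof (rule lebesgue_integral_countable_add)
        show "?B i \<in> sets ?M" for i by (rule borel_sets[OF A])
        then show "set_integrable ?M (\<Union>i. ?B i) w"
          by (intro setint sets.countable_UN) auto
        show "?B i \<inter> ?B j = {}" if "i \<noteq> j" for i j
          using union(1) that by (auto simp: disjoint_family_on_def)
      qed
      then have "(LINT t:(\<Union>i. A i) \<inter> {0<..<l}|?M. w t) = (\<Sum>i. LINT t:?B i|?M. w t)"
        by simp
      then show ?case by (simp add: B union)
    qed
  qed
  \<comment> \<open>The set where \<open>w\<close> is positive is only Lebesgue measurable, while
    \<open>borel0\<close> speaks of Borel sets; a Borel version \<open>g\<close> of \<open>w\<close>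
    supplies an admissible set.\<close>
  have "(\<lambda>t. indicator {0<..<l} t * w t) \<in> borel_measurable lebesgue"
    using w borel_measurable_restrict_space_iff[of "{0<..<l}" lebesgue w] by (auto simp: mult.commute)
  then obtain g where g: "g \<in> borel_measurable lborel" "AE t in lborel. indicator {0<..<l} t * w t = g t"
    by (metis completion_ex_borel_measurable_real)
  then have "AE t in lebesgue. indicator {0<..<l} t * w t = g t"
    by (metis AE_completion)
  then have wg: "AE t in ?M. w t = g t"
    by (auto simp: AE_restrict_space_iff elim!: eventually_mono)
  have pos: "AE t in ?M. \<not> 0 < \<sigma> * w t" for \<sigma> :: real
  proof -
    let ?P = "{t. 0 < \<sigma> * g t}"
    have P: "?P \<in> sets borel"
      using g(1) by measurable
    have "(LINT t|?M. \<sigma> * (indicator ?P t * w t)) = 0"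
      using borel0[OF P] by simp
    moreover have "AE t in ?M. 0 \<le> \<sigma> * (indicator ?P t * w t)"
      using wg by eventually_elim (auto split: split_indicator)
    ultimately have "AE t in ?M. \<sigma> * (indicator ?P t * w t) = 0"
      using integral_nonneg_eq_0_iff_AE[OF integrable_mult_right[OF int[OF P]]] by blast
    with wg show ?thesis
      by eventually_elim (auto split: split_indicator_asm)
  qed
  from pos[of 1] pos[of "-1"] show ?thesis
    by eventually_elim auto
qed

text \<open>The difference of two weak derivatives is a weak derivative of 0, so
  \<open>weak_FTC\<close> makes all its initial integrals vanish.\<close>

lemma has_weak_deriv_unique:
  assumes "has_weak_deriv l u v" "has_weak_deriv l u v'" "0 \<le> l"
  shows "AE t in lebesgue_on {0<..<l}. v t = v' t"
proof -
  have w: "has_weak_deriv l (\<lambda>t. 0) (\<lambda>t. v t - v' t)"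
    using has_weak_deriv_linear[OF assms(1,2), of 1 "-1"] by simp
  have "(\<lambda>t. v t - v' t) \<in> L2 (lebesgue_on {0<..<l})"
    using w by (simp add: has_weak_deriv_def)
  then have "integrable (lebesgue_on {0<..<l}) (\<lambda>t. (v t - v' t) * 1)"
    by (rule L2_mult_integrable) (intro continuous_on_in_L2 continuous_on_const)
  then have "AE t in lebesgue_on {0<..<l}. v t - v' t = 0"
    using weak_FTC[OF w] assms(3) by (intro AE_zero_of_initial_integrals) auto
  then show ?thesis by simp
qed

text \<open>Replaces the arbitrary choice hidden in \<open>weak_deriv\<close> by any known weak
  derivatives; all explicit evaluations of \<open>q\<close> pass through this.\<close>

lemma LINT_weak_deriv_mult:
  assumes "has_weak_deriv l u v" "has_weak_deriv l w z" "0 \<le> l"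
  shows "(LINT t|lebesgue_on {0<..<l}. weak_deriv l u t * weak_deriv l w t) =
    (LINT t|lebesgue_on {0<..<l}. v t * z t)"
proof -
  have chosen: "has_weak_deriv l u (weak_deriv l u)" "has_weak_deriv l w (weak_deriv l w)"
    unfolding weak_deriv_def using someI[of "has_weak_deriv l _"] assms by metis+
  have "AE t in lebesgue_on {0<..<l}. weak_deriv l u t * weak_deriv l w t = v t * z t"
    using has_weak_deriv_unique[OF chosen(1) assms(1,3)] has_weak_deriv_unique[OF chosen(2) assms(2,3)]
    by eventually_elim simp
  moreover have "(\<lambda>t. weak_deriv l u t * weak_deriv l w t) \<in> borel_measurable (lebesgue_on {0<..<l})"
    "(\<lambda>t. v t * z t) \<in> borel_measurable (lebesgue_on {0<..<l})"
    using chosen assms by (auto simp: has_weak_deriv_def L2_def)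
  ultimately show ?thesis
    by (intro integral_cong_AE)
qed

text \<open>Here an integral against an unknown weak derivative becomes a combination of increments:
  the derivative of \<open>u\<close> is a combination of initial-segment indicators, to which
  \<open>weak_FTC\<close> applies. Two kinks suffice for tents and for ramps between two
  points.\<close>

lemma weak_deriv_piecewise_affine:
  assumes u: "\<And>t. t \<in> {0<..<l} \<Longrightarrow> u t = a + c * min t s + d * min t s'"
    and s: "s \<in> {0..l}" "s' \<in> {0..l}"
  shows "u \<in> H1_interval l"
    and "g \<in> H1_interval l \<Longrightarrow> continuous_on {0..l} g \<Longrightarrow>
      (LINT t|lebesgue_on {0<..<l}. weak_deriv l u t * weak_deriv l g t) =
        c * (g s - g 0) + d * (g s' - g 0)"
proof -
  let ?M = "lebesgue_on {0<..<l}"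
  have l: "0 \<le> l" using s by auto
  let ?i = "\<lambda>s t. if t < s then 1 else 0 :: real"
  let ?v = "\<lambda>t. c * ?i s t + d * ?i s' t"
  have "has_weak_deriv l (\<lambda>t. c * min t s + d * min t s') ?v"
    using s l by (intro has_weak_deriv_linear has_weak_deriv_min) auto
  from has_weak_deriv_linear[OF has_weak_deriv_const[OF l, of 1] this, of a 1]
  have "has_weak_deriv l (\<lambda>t. a + (c * min t s + d * min t s')) ?v"
    by simp
  then have uv: "has_weak_deriv l u ?v"
    by (rule has_weak_deriv_cong) (use u in auto)
  then show "u \<in> H1_interval l" by (auto simp: H1_interval_def)
  assume "g \<in> H1_interval l" and g: "continuous_on {0..l} g"
  then obtain z where z: "has_weak_deriv l g z" by (auto simp: H1_interval_def)
  have int: "integrable ?M (\<lambda>t. ?i s t * z t)" for s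
    using z by (intro L2_mult_integrable step_in_L2) (auto simp: has_weak_deriv_def)
  have "(LINT t|?M. ?v t * z t) = (LINT t|?M. c * (?i s t * z t) + d * (?i s' t * z t))"
    by (rule Bochner_Integration.integral_cong) (auto simp: algebra_simps)
  also have "\<dots> = (LINT t|?M. c * (?i s t * z t)) + (LINT t|?M. d * (?i s' t * z t))"
    by (intro Bochner_Integration.integral_add integrable_mult_right int)
  also have "\<dots> = c * (LINT t|?M. ?i s t * z t) + d * (LINT t|?M. ?i s' t * z t)"
    by (simp only: integral_mult_right_zero)
  also have "\<dots> = c * (g s - g 0) + d * (g s' - g 0)"
    using weak_FTC[OF z g, of s] weak_FTC[OF z g, of s'] s by simp
  finally show "(LINT t|?M. weak_deriv l u t * weak_deriv l g t) = c * (g s - g 0) + d * (g s' - g 0)"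
    using LINT_weak_deriv_mult[OF uv z l] by simp
qed

lemma weak_deriv_mult_linear:
  assumes "u \<in> H1_interval l" "u' \<in> H1_interval l" "w \<in> H1_interval l" "0 \<le> l"
  shows "(\<lambda>t. a * u t + b * u' t) \<in> H1_interval l"
    and "(LINT t|lebesgue_on {0<..<l}. weak_deriv l (\<lambda>t. a * u t + b * u' t) t * weak_deriv l w t) =
      a * (LINT t|lebesgue_on {0<..<l}. weak_deriv l u t * weak_deriv l w t) +
      b * (LINT t|lebesgue_on {0<..<l}. weak_deriv l u' t * weak_deriv l w t)"
proof -
  let ?M = "lebesgue_on {0<..<l}"
  obtain v v' z where d: "has_weak_deriv l u v" "has_weak_deriv l u' v'" "has_weak_deriv l w z"
    using assms by (auto simp: H1_interval_def)
  note lin = has_weak_deriv_linear[OF d(1,2), of a b]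
  then show "(\<lambda>t. a * u t + b * u' t) \<in> H1_interval l"
    by (auto simp: H1_interval_def)
  have int: "integrable ?M (\<lambda>t. v t * z t)" "integrable ?M (\<lambda>t. v' t * z t)"
    using d by (auto simp: has_weak_deriv_def intro!: L2_mult_integrable)
  have "(LINT t|?M. (a * v t + b * v' t) * z t) = a * (LINT t|?M. v t * z t) + b * (LINT t|?M. v' t * z t)"
    using int by (simp add: distrib_right mult.assoc)
  then show "(LINT t|lebesgue_on {0<..<l}. weak_deriv l (\<lambda>t. a * u t + b * u' t) t * weak_deriv l w t) =
      a * (LINT t|lebesgue_on {0<..<l}. weak_deriv l u t * weak_deriv l w t) +
      b * (LINT t|lebesgue_on {0<..<l}. weak_deriv l u' t * weak_deriv l w t)"
    by (simp add: LINT_weak_deriv_mult[OF lin d(3) assms(4)] LINT_weak_deriv_mult[OF d(1,3) assms(4)]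
        LINT_weak_deriv_mult[OF d(2,3) assms(4)])
qed

section \<open>The energy form\<close>

lemma quadratic_nonneg_discriminant:
  fixes a b c :: real
  assumes "\<And>x. 0 \<le> a + 2 * x * b + x\<^sup>2 * c" "0 \<le> c"
  shows "b\<^sup>2 \<le> a * c"
proof (cases "c = 0")
  case True
  have "b = 0"
  proof (rule ccontr)
    assume "b \<noteq> 0"
    \<comment> \<open>At this argument the expression takes the value -1.\<close>
    with assms(1)[of "- (a + 1) / (2 * b)"] True show False by (simp add: field_simps)
  qed
  with True show ?thesis by simp
next
  case False
  with assms(2) have c: "c > 0" by simp
  have "0 \<le> a + 2 * (- b / c) * b + (- b / c)\<^sup>2 * c" by (rule assms(1))
  also have "\<dots> = (a * c - b\<^sup>2) / c" using c by (simp add: field_simps power2_eq_square)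
  finally show ?thesis using c by (simp add: zero_le_divide_iff)
qed

context metric_graph
begin

lemma edge_pt_in_points: "e \<in> edges G \<Longrightarrow> edge_pt G e t \<in> points G"
  using src_in_verts tgt_in_verts by (auto simp: edge_pt_def points_def)

lemma edge_pt_0 [simp]: "edge_pt G e 0 = Vertex (src G e)"
  by (simp add: edge_pt_def)

lemma edge_pt_len [simp]: "e \<in> edges G \<Longrightarrow> edge_pt G e (len G e) = Vertex (tgt G e)"
  using len_pos[of e] by (simp add: edge_pt_def)

lemma edge_pt_inner [simp]: "0 < t \<Longrightarrow> t < len G e \<Longrightarrow> edge_pt G e t = Inner e t"
  by (simp add: edge_pt_def)

lemma len_nonneg: "e \<in> edges G \<Longrightarrow> 0 \<le> len G e"
  using len_pos[of e] by simp

text \<open>A nonempty edge set and connectedness exclude isolated vertices. Thus the gluing maps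
  cover the whole space.\<close>

lemma vertex_on_edge:
  assumes "v \<in> verts G"
  obtains e where "e \<in> edges G" "v = src G e \<or> v = tgt G e"
proof -
  obtain e where e: "e \<in> edges G" using edges_nonempty by auto
  have "(v, src G e) \<in> (adjacent G)\<^sup>*"
    by (rule connected_graph[OF assms src_in_verts[OF e]])
  then show thesis
  proof (cases rule: converse_rtranclE)
    case base
    with e that show thesis by blast
  next
    case (step w)
    then obtain e' where "e' \<in> edges G" "{src G e', tgt G e'} = {v, w}"
      by (auto simp: adjacent_def joins_def)
    with that show thesis by blast
  qed
qed

lemma pointE:
  assumes "x \<in> points G"
  obtains e t where "e \<in> edges G" "t \<in> {0..len G e}" "x = edge_pt G e t"
proof (cases x)
  case (Vertex v)
  with assms have "v \<in> verts G" by (auto simp: points_def)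
  then obtain e where "e \<in> edges G" "v = src G e \<or> v = tgt G e" by (rule vertex_on_edge)
  with that[of e 0] that[of e "len G e"] Vertex len_nonneg show ?thesis by auto
next
  case (Inner e t)
  with assms have "e \<in> edges G" "0 < t" "t < len G e" by (auto simp: points_def)
  with that[of e t] Inner show ?thesis by auto
qed

text \<open>The universal property of the final topology: preimages are tested along the gluing
  maps.\<close>

lemma continuous_map_graph_top_iff:
  fixes f :: "('v, 'e) point \<Rightarrow> real"
  shows "continuous_map (graph_top G) euclideanreal f \<longleftrightarrow>
    (\<forall>e\<in>edges G. continuous_on {0..len G e} (\<lambda>t. f (edge_pt G e t)))"
proof -
  have pre: "{t \<in> {0..len G e}. edge_pt G e t \<in> {x \<in> points G. f x \<in> U}} =
      {t \<in> {0..len G e}. f (edge_pt G e t) \<in> U}" if "e \<in> edges G" for e U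
    using that edge_pt_in_points by auto
  have "continuous_map (graph_top G) euclideanreal f \<longleftrightarrow>
    (\<forall>U. open U \<longrightarrow> openin (graph_top G) {x \<in> points G. f x \<in> U})"
    by (simp add: continuous_map_def topspace_graph_top)
  also have "\<dots> \<longleftrightarrow> (\<forall>U. open U \<longrightarrow> (\<forall>e\<in>edges G.
      openin (top_of_set {0..len G e}) {t \<in> {0..len G e}. f (edge_pt G e t) \<in> U}))"
  proof -
    have "(\<forall>e\<in>edges G. openin (top_of_set {0..len G e})
          {t \<in> {0..len G e}. edge_pt G e t \<in> {x \<in> points G. f x \<in> U}}) \<longleftrightarrow>
        (\<forall>e\<in>edges G. openin (top_of_set {0..len G e}) {t \<in> {0..len G e}. f (edge_pt G e t) \<in> U})" for U
      by (rule ball_cong[OF HOL.refl]) (simp only: pre)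
    then show ?thesis unfolding openin_graph_top by blast
  qed
  also have "\<dots> \<longleftrightarrow> (\<forall>e\<in>edges G. continuous_on {0..len G e} (\<lambda>t. f (edge_pt G e t)))"
    by (auto simp: continuous_on_open_gen[of _ _ UNIV] vimage_def Int_def)
  finally show ?thesis .
qed

lemma H1_iff:
  "f \<in> H1 G \<longleftrightarrow> (\<forall>e\<in>edges G. continuous_on {0..len G e} (\<lambda>t. f (edge_pt G e t)) \<and>
     (\<lambda>t. f (edge_pt G e t)) \<in> H1_interval (len G e))"
  by (auto simp: H1_def continuous_map_graph_top_iff comp_def)

lemma q_alt: "q G f g = (\<Sum>e\<in>edges G. LINT t|lebesgue_on {0<..<len G e}.
    weak_deriv (len G e) (\<lambda>t. f (edge_pt G e t)) t * weak_deriv (len G e) (\<lambda>t. g (edge_pt G e t)) t)"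
  by (simp add: q_def comp_def)

lemma H1_linear:
  assumes "f \<in> H1 G" "g \<in> H1 G"
  shows "(\<lambda>x. a * f x + b * g x) \<in> H1 G"
  using assms len_nonneg
  by (auto simp: H1_iff intro!: continuous_intros weak_deriv_mult_linear(1))

lemma q_linear:
  assumes "f \<in> H1 G" "g \<in> H1 G" "h \<in> H1 G"
  shows "q G (\<lambda>x. a * f x + b * g x) h = a * q G f h + b * q G g h"
  using assms len_nonneg
  by (auto simp: q_alt H1_iff weak_deriv_mult_linear(2) sum.distrib sum_distrib_left)

lemma q_sym: "q G f g = q G g f"
  by (simp add: q_def mult.commute)

lemma q_nonneg: "0 \<le> q G f f"
  by (auto simp: q_def intro!: sum_nonneg)

text \<open>Since \<open>min t (len G e) = t\<close> on the edge \<open>e\<close>, this covers affine functions, tents and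
  truncations.\<close>

lemma piecewise_affine_in_H1:
  assumes u: "\<And>e t. e \<in> edges G \<Longrightarrow> t \<in> {0..len G e} \<Longrightarrow>
      u (edge_pt G e t) = a e + c e * min t (s e) + d e * min t (s' e)"
    and s: "\<And>e. e \<in> edges G \<Longrightarrow> s e \<in> {0..len G e}" "\<And>e. e \<in> edges G \<Longrightarrow> s' e \<in> {0..len G e}"
  shows "u \<in> H1 G"
    and "g \<in> H1 G \<Longrightarrow> q G u g =
      (\<Sum>e\<in>edges G. c e * (g (edge_pt G e (s e)) - g (Vertex (src G e))) +
                    d e * (g (edge_pt G e (s' e)) - g (Vertex (src G e))))"
proof -
  have "continuous_on {0..len G e} (\<lambda>t. u (edge_pt G e t))" if e: "e \<in> edges G" for e
  proof (subst continuous_on_cong[OF HOL.refl u[OF e]])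
    show "continuous_on {0..len G e} (\<lambda>t. a e + c e * min t (s e) + d e * min t (s' e))"
      by (intro continuous_intros)
  qed auto
  then show "u \<in> H1 G"
    using s by (auto simp: H1_iff intro!: weak_deriv_piecewise_affine(1) u)
  assume g: "g \<in> H1 G"
  show "q G u g = (\<Sum>e\<in>edges G. c e * (g (edge_pt G e (s e)) - g (Vertex (src G e))) +
                    d e * (g (edge_pt G e (s' e)) - g (Vertex (src G e))))"
    unfolding q_alt
  proof (rule sum.cong[OF HOL.refl])
    fix e assume e: "e \<in> edges G"
    have "(LINT t|lebesgue_on {0<..<len G e}.
        weak_deriv (len G e) (\<lambda>t. u (edge_pt G e t)) t * weak_deriv (len G e) (\<lambda>t. g (edge_pt G e t)) t) =
      c e * (g (edge_pt G e (s e)) - g (edge_pt G e 0)) + d e * (g (edge_pt G e (s' e)) - g (edge_pt G e 0))"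
      using g e s by (intro weak_deriv_piecewise_affine(2)[where a="a e"] u) (auto simp: H1_iff)
    then show "(LINT t|lebesgue_on {0<..<len G e}.
        weak_deriv (len G e) (\<lambda>t. u (edge_pt G e t)) t * weak_deriv (len G e) (\<lambda>t. g (edge_pt G e t)) t) =
      c e * (g (edge_pt G e (s e)) - g (Vertex (src G e))) + d e * (g (edge_pt G e (s' e)) - g (Vertex (src G e)))"
      by simp
  qed
qed

lemma const_in_H1: "(\<lambda>x. k) \<in> H1 G"
  and q_const: "g \<in> H1 G \<Longrightarrow> q G (\<lambda>x. k) g = 0"
  using piecewise_affine_in_H1(1)[of "\<lambda>x. k" "\<lambda>e. k" "\<lambda>e. 0" "\<lambda>e. 0" "\<lambda>e. 0" "\<lambda>e. 0"]
    piecewise_affine_in_H1(2)[of "\<lambda>x. k" "\<lambda>e. k" "\<lambda>e. 0" "\<lambda>e. 0" "\<lambda>e. 0" "\<lambda>e. 0" g] len_nonneg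
  by auto

lemma H1_add: "f \<in> H1 G \<Longrightarrow> g \<in> H1 G \<Longrightarrow> (\<lambda>x. f x + g x) \<in> H1 G"
  using H1_linear[of f g 1 1] by simp

lemma H1_diff: "f \<in> H1 G \<Longrightarrow> g \<in> H1 G \<Longrightarrow> (\<lambda>x. f x - g x) \<in> H1 G"
  using H1_linear[of f g 1 "-1"] by simp

lemma H1_cmult: "f \<in> H1 G \<Longrightarrow> (\<lambda>x. k * f x) \<in> H1 G"
  using H1_linear[of f f k 0] by simp

lemma q_add: "f \<in> H1 G \<Longrightarrow> g \<in> H1 G \<Longrightarrow> h \<in> H1 G \<Longrightarrow> q G (\<lambda>x. f x + g x) h = q G f h + q G g h"
  using q_linear[of f g h 1 1] by simp

lemma q_diff: "f \<in> H1 G \<Longrightarrow> g \<in> H1 G \<Longrightarrow> h \<in> H1 G \<Longrightarrow> q G (\<lambda>x. f x - g x) h = q G f h - q G g h"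
  using q_linear[of f g h 1 "-1"] by simp

lemma q_cmult: "f \<in> H1 G \<Longrightarrow> h \<in> H1 G \<Longrightarrow> q G (\<lambda>x. k * f x) h = k * q G f h"
  using q_linear[of f f h k 0] by simp

lemma q_linear_square:
  assumes "f \<in> H1 G" "g \<in> H1 G"
  shows "q G (\<lambda>x. a * f x + b * g x) (\<lambda>x. a * f x + b * g x) =
    a\<^sup>2 * q G f f + 2 * a * b * q G f g + b\<^sup>2 * q G g g"
  using assms
  by (simp add: q_linear H1_linear q_sym[of f "\<lambda>x. a * f x + b * g x"] q_sym[of g "\<lambda>x. a * f x + b * g x"]
      q_sym[of g f] power2_eq_square algebra_simps)

lemma q_Cauchy_Schwarz:
  assumes "f \<in> H1 G" "g \<in> H1 G"
  shows "(q G f g)\<^sup>2 \<le> q G f f * q G g g"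
proof (rule quadratic_nonneg_discriminant)
  show "0 \<le> q G f f + 2 * x * q G f g + x\<^sup>2 * q G g g" for x
    using q_nonneg[of "\<lambda>y. 1 * f y + x * g y"] q_linear_square[OF assms, of 1 x] by simp
qed (rule q_nonneg)

lemma q_eq_0_of_null:
  assumes "f \<in> H1 G" "g \<in> H1 G" "q G f f = 0"
  shows "q G f g = 0"
  using q_Cauchy_Schwarz[OF assms(1,2)] assms(3) by simp

section \<open>Potentials\<close>

subsection \<open>The discrete Laplacian\<close>

text \<open>The energy of functions that are affine on edges, i.e. the form of the graph Laplacian
  with conductances \<open>1 / len G e\<close>; paired with the indicator of a vertex it gives the
  Laplacian there.\<close>

definition dirichlet :: "('v \<Rightarrow> real) \<Rightarrow> ('v \<Rightarrow> real) \<Rightarrow> real" where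
  "dirichlet a b = (\<Sum>e\<in>edges G. (a (tgt G e) - a (src G e)) * (b (tgt G e) - b (src G e)) / len G e)"

lemma dirichlet_linear: "dirichlet (\<lambda>v. x * a v + y * b v) c = x * dirichlet a c + y * dirichlet b c"
proof -
  have "dirichlet (\<lambda>v. x * a v + y * b v) c = (\<Sum>e\<in>edges G.
      x * ((a (tgt G e) - a (src G e)) * (c (tgt G e) - c (src G e)) / len G e) +
      y * ((b (tgt G e) - b (src G e)) * (c (tgt G e) - c (src G e)) / len G e))"
    unfolding dirichlet_def
    by (rule sum.cong) (auto simp: diff_divide_distrib add_divide_distrib algebra_simps)
  then show ?thesis by (simp add: dirichlet_def sum.distrib sum_distrib_left)
qed

lemma dirichlet_expand:
  assumes "finite W" "\<And>v. v \<in> verts G \<Longrightarrow> v \<notin> W \<Longrightarrow> b v = 0"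
  shows "dirichlet a b = (\<Sum>v\<in>W. b v * dirichlet a (\<lambda>u. if u = v then 1 else 0))"
proof -
  let ?d = "\<lambda>v u. if u = v then 1 else 0 :: real"
  have b: "b u = (\<Sum>v\<in>W. b v * ?d v u)" if "u \<in> verts G" for u
    using assms that by (auto simp: if_distrib cong: if_cong)
  have "dirichlet a b = (\<Sum>e\<in>edges G. \<Sum>v\<in>W. b v *
      ((a (tgt G e) - a (src G e)) * (?d v (tgt G e) - ?d v (src G e)) / len G e))"
    unfolding dirichlet_def
  proof (rule sum.cong[OF HOL.refl])
    fix e assume e: "e \<in> edges G"
    have "b (tgt G e) - b (src G e) = (\<Sum>v\<in>W. b v * (?d v (tgt G e) - ?d v (src G e)))"
      using b[OF src_in_verts[OF e]] b[OF tgt_in_verts[OF e]]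
      by (simp add: sum_subtractf right_diff_distrib)
    then show "(a (tgt G e) - a (src G e)) * (b (tgt G e) - b (src G e)) / len G e =
        (\<Sum>v\<in>W. b v * ((a (tgt G e) - a (src G e)) * (?d v (tgt G e) - ?d v (src G e)) / len G e))"
      by (simp add: sum_distrib_left sum_divide_distrib mult.left_commute mult.assoc)
  qed
  also have "\<dots> = (\<Sum>v\<in>W. b v * dirichlet a (?d v))"
    unfolding dirichlet_def sum_distrib_left by (rule sum.swap)
  finally show ?thesis .
qed

lemma dirichlet_null_imp_const:
  assumes "dirichlet a a = 0" "u \<in> verts G" "v \<in> verts G"
  shows "a u = a v"
proof -
  have "(a (tgt G e) - a (src G e)) * (a (tgt G e) - a (src G e)) / len G e = 0" if "e \<in> edges G" for e
    using assms(1) that finite_edges len_nonneg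
    by (subst (asm) dirichlet_def, subst (asm) sum_nonneg_eq_0_iff) auto
  then have edge: "a (tgt G e) = a (src G e)" if "e \<in> edges G" for e
    using that len_pos[OF that] by fastforce
  have "(u, v) \<in> (adjacent G)\<^sup>*" by (rule connected_graph[OF assms(2,3)])
  then show ?thesis
  proof (induction rule: rtrancl_induct)
    case (step y z)
    then obtain e where "e \<in> edges G" "{src G e, tgt G e} = {y, z}"
      by (auto simp: adjacent_def joins_def)
    with edge[of e] step.IH show ?case by (auto simp: doubleton_eq_iff)
  qed simp
qed

text \<open>Grounding the vertex \<open>v0\<close> makes the Dirichlet form definite, so the vertices can be added one
  by one as in Gram-Schmidt orthogonalisation.\<close>

lemma grounded_poisson:
  assumes "finite W" "W \<subseteq> verts G - {v0}" "v0 \<in> verts G"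
  shows "\<exists>a. (\<forall>v. v \<notin> W \<longrightarrow> a v = 0) \<and>
    (\<forall>v\<in>W. dirichlet a (\<lambda>u. if u = v then 1 else 0) = w v)"
  using assms(1,2)
proof (induction W arbitrary: w)
  case empty
  show ?case by (rule exI[of _ "\<lambda>v. 0"]) simp
next
  case (insert z W)
  let ?d = "\<lambda>v u. if u = v then 1 else 0 :: real"
  \<comment> \<open>Subtracting this \<open>p\<close> from the new indicator makes \<psi> orthogonal
    to the indicators of all earlier vertices.\<close>
  obtain p where p: "\<And>v. v \<notin> W \<Longrightarrow> p v = 0" "\<And>v. v \<in> W \<Longrightarrow> dirichlet p (?d v) = dirichlet (?d z) (?d v)"
    using insert.IH[of "\<lambda>v. dirichlet (?d z) (?d v)"] insert.prems by blast
  obtain a where a: "\<And>v. v \<notin> W \<Longrightarrow> a v = 0" "\<And>v. v \<in> W \<Longrightarrow> dirichlet a (?d v) = w v"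
    using insert.IH[of w] insert.prems by blast
  define \<psi> where "\<psi> u = 1 * ?d z u + (- 1) * p u" for u
  have \<psi>d: "dirichlet \<psi> b = dirichlet (?d z) b - dirichlet p b" for b
    unfolding \<psi>_def dirichlet_linear by simp
  have \<psi>W: "dirichlet \<psi> (?d v) = 0" if "v \<in> W" for v
    using p(2)[OF that] by (simp add: \<psi>d)
  have \<psi>out: "\<psi> v = 0" if "v \<notin> insert z W" for v
    using p(1) that by (simp add: \<psi>_def)
  have \<psi>z: "\<psi> z = 1"
    using p(1) insert.hyps by (simp add: \<psi>_def)
  have "dirichlet \<psi> \<psi> = (\<Sum>v\<in>insert z W. \<psi> v * dirichlet \<psi> (?d v))"
    using \<psi>out insert.hyps by (intro dirichlet_expand) auto
  also have "\<dots> = dirichlet \<psi> (?d z)"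
    using insert.hyps \<psi>W \<psi>z by simp
  finally have *: "dirichlet \<psi> \<psi> = dirichlet \<psi> (?d z)" .
  \<comment> \<open>The pivot is nonzero: a null \<psi> would be constant by connectedness, but it
    is 1 at \<open>z\<close> and 0 at the grounded vertex.\<close>
  have c: "dirichlet \<psi> (?d z) \<noteq> 0"
  proof
    assume "dirichlet \<psi> (?d z) = 0"
    with * have "\<psi> z = \<psi> v0"
      using dirichlet_null_imp_const[of \<psi> z v0] insert.prems assms(3) by auto
    moreover have "\<psi> v0 = 0" using insert.prems by (intro \<psi>out) auto
    ultimately show False using \<psi>z by simp
  qed
  define k where "k = (w z - dirichlet a (?d z)) / dirichlet \<psi> (?d z)"
  let ?a = "\<lambda>u. 1 * a u + k * \<psi> u"
  show ?case
  proof (intro exI[of _ ?a] conjI allI impI ballI)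
    show "?a v = 0" if "v \<notin> insert z W" for v
      using a(1) \<psi>out[OF that] that by simp
    show "dirichlet ?a (?d v) = w v" if "v \<in> insert z W" for v
      unfolding dirichlet_linear using that a(2) \<psi>W c by (auto simp: k_def)
  qed
qed

text \<open>Grounding one vertex loses only the equation there, and that one follows from the
  others: the Laplacian of \<open>a\<close> and the weights \<open>w\<close> both sum to
  zero.\<close>

lemma discrete_poisson:
  assumes "(\<Sum>v\<in>verts G. w v) = 0"
  shows "\<exists>a. \<forall>b. dirichlet a b = (\<Sum>v\<in>verts G. w v * b v)"
proof -
  obtain v0 where v0: "v0 \<in> verts G" using edges_nonempty src_in_verts by blast
  let ?d = "\<lambda>v u. if u = v then 1 else 0 :: real" and ?W = "verts G - {v0}"
  obtain a where a: "\<And>v. v \<in> ?W \<Longrightarrow> dirichlet a (?d v) = w v"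
    using grounded_poisson[of ?W v0 w] finite_verts v0 by auto
  have "dirichlet a (\<lambda>u. 1) = (\<Sum>v\<in>verts G. 1 * dirichlet a (?d v))"
    by (rule dirichlet_expand) (use finite_verts in auto)
  moreover have "dirichlet a (\<lambda>u. 1) = 0" by (simp add: dirichlet_def)
  ultimately have "dirichlet a (?d v0) = - (\<Sum>v\<in>?W. w v)"
    using sum.remove[OF finite_verts v0, of "\<lambda>v. dirichlet a (?d v)"] a by simp
  also have "\<dots> = w v0"
    using sum.remove[OF finite_verts v0, of w] assms by simp
  finally have "dirichlet a (?d v) = w v" if "v \<in> verts G" for v
    using a that by blast
  then have "dirichlet a b = (\<Sum>v\<in>verts G. w v * b v)" for b
    by (subst dirichlet_expand[of "verts G"]) (use finite_verts in \<open>auto simp: mult.commute\<close>)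
  then show ?thesis by blast
qed

subsection \<open>Existence of potentials\<close>

fun affine_ext :: "('v \<Rightarrow> real) \<Rightarrow> ('v, 'e) point \<Rightarrow> real" where
  "affine_ext a (Vertex v) = a v"
| "affine_ext a (Inner e t) = a (src G e) + (a (tgt G e) - a (src G e)) / len G e * t"

lemma affine_ext_edge_pt:
  assumes "e \<in> edges G" "t \<in> {0..len G e}"
  shows "affine_ext a (edge_pt G e t) = a (src G e) + (a (tgt G e) - a (src G e)) / len G e * t"
  using assms len_pos[of e] by (auto simp: edge_pt_def)

lemma affine_ext_in_H1: "affine_ext a \<in> H1 G"
  and q_affine_ext: "g \<in> H1 G \<Longrightarrow> q G (affine_ext a) g = dirichlet a (\<lambda>v. g (Vertex v))"
proof -
  have eq: "affine_ext a (edge_pt G e t) =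
      a (src G e) + (a (tgt G e) - a (src G e)) / len G e * min t (len G e) + 0 * min t 0"
    if "e \<in> edges G" "t \<in> {0..len G e}" for e t
    using affine_ext_edge_pt[OF that] that by simp
  show "affine_ext a \<in> H1 G"
    by (rule piecewise_affine_in_H1(1)[OF eq]) (use len_nonneg in auto)
  show "q G (affine_ext a) g = dirichlet a (\<lambda>v. g (Vertex v))" if "g \<in> H1 G"
    by (subst piecewise_affine_in_H1(2)[OF eq _ _ that])
      (use len_nonneg in \<open>auto simp: dirichlet_def intro!: sum.cong\<close>)
qed

text \<open>The Green function of the edge with zero boundary values and pole \<open>s\<close>: its
  slope drops by 1 at \<open>s\<close>. Pairing with it therefore gives the value of
  \<open>g\<close> at the pole minus the linear interpolation of \<open>g\<close> from the ends of
  the edge.\<close>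

definition tent :: "'e \<Rightarrow> real \<Rightarrow> ('v, 'e) point \<Rightarrow> real" where
  "tent e s x = (case x of Vertex v \<Rightarrow> 0
     | Inner e' t \<Rightarrow> if e' = e then min t s - s / len G e * t else 0)"

lemma tent_in_H1: "e \<in> edges G \<Longrightarrow> s \<in> {0..len G e} \<Longrightarrow> tent e s \<in> H1 G"
  and q_tent: "e \<in> edges G \<Longrightarrow> s \<in> {0..len G e} \<Longrightarrow> g \<in> H1 G \<Longrightarrow> q G (tent e s) g = g (edge_pt G e s) -
    ((1 - s / len G e) * g (Vertex (src G e)) + s / len G e * g (Vertex (tgt G e)))"
proof -
  assume e: "e \<in> edges G" and s: "s \<in> {0..len G e}"
  have eq: "tent e s (edge_pt G e' t) = 0 + (if e' = e then 1 else 0) * min t (if e' = e then s else 0) +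
      (if e' = e then - s / len G e else 0) * min t (len G e')"
    if "e' \<in> edges G" "t \<in> {0..len G e'}" for e' t
    using that s len_pos[OF e] by (auto simp: tent_def edge_pt_def)
  show "tent e s \<in> H1 G"
    by (rule piecewise_affine_in_H1(1)[OF eq]) (use s len_nonneg in auto)
  show "q G (tent e s) g = g (edge_pt G e s) -
    ((1 - s / len G e) * g (Vertex (src G e)) + s / len G e * g (Vertex (tgt G e)))" if g: "g \<in> H1 G"
  proof -
    have "q G (tent e s) g = (\<Sum>e'\<in>edges G. if e' = e then g (edge_pt G e s) - g (Vertex (src G e)) -
        s / len G e * (g (Vertex (tgt G e)) - g (Vertex (src G e))) else 0)"
      by (subst piecewise_affine_in_H1(2)[OF eq _ _ g]) (use s len_nonneg in \<open>auto intro!: sum.cong\<close>)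
    then show ?thesis using e finite_edges by (simp add: algebra_simps)
  qed
qed

lemma reduce_to_vertices:
  assumes "x \<in> points G"
  shows "\<exists>k\<in>H1 G. \<exists>w. (\<Sum>v\<in>verts G. w v) = 1 \<and>
    (\<forall>g\<in>H1 G. q G k g = g x - (\<Sum>v\<in>verts G. w v * g (Vertex v)))"
proof -
  obtain e s where x: "e \<in> edges G" "s \<in> {0..len G e}" "x = edge_pt G e s"
    using pointE[OF assms] .
  \<comment> \<open>Barycentric weights of the point on its edge; the two separate conditionals add
    up correctly when the edge is a loop.\<close>
  let ?w = "\<lambda>v. (if v = src G e then 1 - s / len G e else 0) + (if v = tgt G e then s / len G e else 0)"
  have w: "(\<Sum>v\<in>verts G. ?w v * b v) = (1 - s / len G e) * b (src G e) + s / len G e * b (tgt G e)" for b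
    using finite_verts src_in_verts[OF x(1)] tgt_in_verts[OF x(1)]
    by (simp add: distrib_right sum.distrib if_distrib[of "\<lambda>y. y * _"] cong: if_cong)
  from w[of "\<lambda>_. 1"] w x tent_in_H1[OF x(1,2)] q_tent[OF x(1,2)] show ?thesis
    by (intro bexI[of _ "tent e s"] exI[of _ ?w]) auto
qed

text \<open>No value is normalised, unlike in \<open>resistance\<close>: shifts and negatives of
  potentials and sums along consecutive pairs are potentials again, and the resistance becomes
  \<open>h x - h y\<close>.\<close>

definition potential :: "('v, 'e) point \<Rightarrow> ('v, 'e) point \<Rightarrow> (('v, 'e) point \<Rightarrow> real) \<Rightarrow> bool" where
  "potential x y h \<longleftrightarrow> h \<in> H1 G \<and> (\<forall>g\<in>H1 G. q G h g = g x - g y)"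

lemma potential_exists:
  assumes "x \<in> points G" "y \<in> points G"
  obtains h where "potential x y h"
proof -
  obtain k w where k: "k \<in> H1 G" "(\<Sum>v\<in>verts G. w v) = 1"
    "\<And>g. g \<in> H1 G \<Longrightarrow> q G k g = g x - (\<Sum>v\<in>verts G. w v * g (Vertex v))"
    using reduce_to_vertices[OF assms(1)] by blast
  obtain k' w' where k': "k' \<in> H1 G" "(\<Sum>v\<in>verts G. w' v) = 1"
    "\<And>g. g \<in> H1 G \<Longrightarrow> q G k' g = g y - (\<Sum>v\<in>verts G. w' v * g (Vertex v))"
    using reduce_to_vertices[OF assms(2)] by blast
  \<comment> \<open>Both weights have total 1, so their difference satisfies the solvability
    condition.\<close>
  obtain a where a: "\<And>b. dirichlet a b = (\<Sum>v\<in>verts G. (w v - w' v) * b v)"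
    using discrete_poisson[of "\<lambda>v. w v - w' v"] k(2) k'(2) by (auto simp: sum_subtractf)
  let ?h = "\<lambda>z. (k z - k' z) + affine_ext a z"
  have "q G ?h g = g x - g y" if g: "g \<in> H1 G" for g
    using g k k' by (simp add: q_add q_diff H1_diff affine_ext_in_H1 q_affine_ext a
        sum_subtractf left_diff_distrib)
  then have "potential x y ?h"
    using k k' by (auto simp: potential_def intro!: H1_add H1_diff affine_ext_in_H1)
  with that show thesis .
qed

lemma potential_add: "potential x y h \<Longrightarrow> potential y z k \<Longrightarrow> potential x z (\<lambda>p. h p + k p)"
  by (auto simp: potential_def H1_add q_add)

lemma potential_minus: "potential x y h \<Longrightarrow> potential y x (\<lambda>p. - h p)"
  using H1_cmult[of h "-1"] q_cmult[of h _ "-1"] by (auto simp: potential_def)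

lemma potential_shift: "potential x y h \<Longrightarrow> potential x y (\<lambda>p. h p - k)"
  by (auto simp: potential_def H1_diff const_in_H1 q_diff q_const)

text \<open>An increment of \<open>f\<close> is its pairing with a potential, and a function of zero
  energy pairs to zero with everything.\<close>

lemma null_imp_const:
  assumes "f \<in> H1 G" "q G f f = 0" "x \<in> points G" "y \<in> points G"
  shows "f x = f y"
proof -
  obtain h where h: "potential x y h" using potential_exists[OF assms(3,4)] .
  then have "f x - f y = q G f h"
    using assms(1) by (auto simp: potential_def q_sym[of f])
  with h q_eq_0_of_null[OF assms(1) _ assms(2)] show ?thesis
    by (auto simp: potential_def)
qed

text \<open>A tent takes its peak value only at its pole, which isolates interior points, and
  distinct vertices are told apart by the affine extension of an indicator. This later identifies
  the extremal points of an optimal eigenfunction.\<close>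

lemma H1_separates:
  assumes "x \<in> points G" "y \<in> points G" "\<And>g. g \<in> H1 G \<Longrightarrow> g x = g y"
  shows "x = y"
proof (cases x)
  case inner: (Inner e s)
  then have e: "e \<in> edges G" "0 < s" "s < len G e" using assms(1) by (auto simp: points_def)
  have x: "tent e s x = s * (1 - s / len G e)"
    using inner by (simp add: tent_def algebra_simps)
  moreover have "s * (1 - s / len G e) > 0" using e by (simp add: field_simps)
  moreover have "tent e s x = tent e s y" using e by (intro assms(3) tent_in_H1) auto
  ultimately obtain t where y: "y = Inner e t"
    by (auto simp: tent_def split: point.splits if_splits)
  then have "0 < t" "t < len G e" using assms(2) by (auto simp: points_def)
  have "s - s / len G e * s = min t s - s / len G e * t"
    using \<open>tent e s x = tent e s y\<close> inner y by (simp add: tent_def)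
  have "t = s"
  proof (rule ccontr)
    assume "t \<noteq> s"
    then consider "t < s" | "s < t" by linarith
    then show False
    proof cases
      case 1
      define c where "c = s / len G e"
      have "s - c * s = t - c * t"
        using \<open>s - s / len G e * s = _\<close> 1 by (simp add: c_def)
      then have "(s - t) * (1 - c) = 0" by (simp add: algebra_simps)
      moreover have "c < 1" using e by (simp add: c_def)
      ultimately show False using 1 by simp
    next
      case 2
      then have "s / len G e * (t - s) = 0"
        using \<open>s - s / len G e * s = _\<close> 2 by (auto simp: algebra_simps)
      then show False using 2 e by auto
    qed
  qed
  then show ?thesis using inner y by simp
next
  case vx: (Vertex v)
  show ?thesis
  proof (cases y)
    case (Vertex u)
    have "affine_ext (\<lambda>z. if z = v then 1 else 0) x = affine_ext (\<lambda>z. if z = v then 1 else 0) y"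
      by (intro assms(3) affine_ext_in_H1)
    then show ?thesis using vx Vertex by (auto split: if_splits)
  next
    case (Inner e s)
    then have e: "e \<in> edges G" "0 < s" "s < len G e" using assms(2) by (auto simp: points_def)
    have "tent e s x = tent e s y" using e by (intro assms(3) tent_in_H1) auto
    moreover have "tent e s x = 0" using vx by (simp add: tent_def)
    moreover have "tent e s y > 0" using Inner e by (simp add: tent_def field_simps)
    ultimately show ?thesis by simp
  qed
qed

end

section \<open>The resistance metric\<close>

text \<open>Cauchy-Schwarz against the ramp \<open>m\<close> from \<open>s\<close> to
  \<open>t\<close>: its energy is \<open>t - s\<close>, and pairing with it gives the increment of
  \<open>u\<close>.\<close>

lemma weak_deriv_increment_bound:
  assumes u: "u \<in> H1_interval l" "continuous_on {0..l} u" and st: "0 \<le> s" "s \<le> t" "t \<le> l"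
  shows "(u t - u s)\<^sup>2 \<le>
    (LINT x|lebesgue_on {0<..<l}. weak_deriv l u x * weak_deriv l u x) * (t - s)"
proof -
  have l: "0 \<le> l" using st by simp
  define B where "B f g = (LINT x|lebesgue_on {0<..<l}. weak_deriv l f x * weak_deriv l g x)" for f g
  have B_sym: "B f g = B g f" for f g by (simp add: B_def mult.commute)
  define m where "m x = 0 + 1 * min x t + (- 1) * min x s" for x
  have cont_m: "continuous_on {0..l} m" unfolding m_def by (intro continuous_intros)
  have m: "m \<in> H1_interval l"
    by (rule weak_deriv_piecewise_affine(1)[of l m 0 1 t "-1" s]) (use st in \<open>auto simp: m_def\<close>)
  have pair: "B m g = g t - g s" if "g \<in> H1_interval l" "continuous_on {0..l} g" for g
  proof -
    have "B m g = 1 * (g t - g 0) + (- 1) * (g s - g 0)"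
      unfolding B_def
      by (rule weak_deriv_piecewise_affine(2)[of l m 0]) (use st that in \<open>auto simp: m_def\<close>)
    then show ?thesis by simp
  qed
  have lin: "B (\<lambda>x. 1 * u x + y * m x) g = B u g + y * B m g" if "g \<in> H1_interval l" for g y
    using weak_deriv_mult_linear(2)[OF u(1) m that l, of 1 y] by (simp add: B_def)
  have "(B u m)\<^sup>2 \<le> B u u * B m m"
  proof (rule quadratic_nonneg_discriminant)
    fix y
    let ?g = "\<lambda>x. 1 * u x + y * m x"
    have g: "?g \<in> H1_interval l" by (rule weak_deriv_mult_linear(1)[OF u(1) m u(1) l])
    have "0 \<le> B ?g ?g" by (simp add: B_def)
    also have "\<dots> = B u ?g + y * B m ?g" by (rule lin[OF g])
    also have "\<dots> = B u u + 2 * y * B u m + y\<^sup>2 * B m m"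
      using lin[OF u(1), of y] lin[OF m, of y] B_sym[of u ?g] B_sym[of m ?g] B_sym[of m u]
      by (simp add: power2_eq_square algebra_simps)
    finally show "0 \<le> B u u + 2 * y * B u m + y\<^sup>2 * B m m" .
  qed (simp add: B_def)
  moreover have "B m m = t - s" using pair[OF m cont_m] st by (simp add: m_def)
  moreover have "B u m = u t - u s" using pair[OF u] B_sym by simp
  ultimately show ?thesis by (simp add: B_def)
qed

context metric_graph
begin

text \<open>Reciprocity: for two solutions \<open>f\<close> and \<open>h\<close>, the pairings
  \<open>q G f h\<close> and \<open>q G h f\<close> are the increments of \<open>h\<close> and of
  \<open>f\<close>, so these agree by symmetry.\<close>

lemma resistance_eq:
  assumes h: "potential x y h"
  shows "resistance G x y = h x - h y"
  unfolding resistance_def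
proof (rule the_equality)
  show "\<exists>f\<in>H1 G. f y = 0 \<and> (\<forall>g\<in>H1 G. q G f g = g x - g y) \<and> h x - h y = f x"
    using potential_shift[OF h, of "h y"] by (intro bexI[of _ "\<lambda>p. h p - h y"]) (auto simp: potential_def)
  fix s assume "\<exists>f\<in>H1 G. f y = 0 \<and> (\<forall>g\<in>H1 G. q G f g = g x - g y) \<and> s = f x"
  then obtain f where f: "f \<in> H1 G" "f y = 0" "\<And>g. g \<in> H1 G \<Longrightarrow> q G f g = g x - g y" "s = f x"
    by blast
  then show "s = h x - h y"
    using h f(3)[of h] by (auto simp: potential_def q_sym[of h])
qed

lemma resistance_eq_energy: "potential x y h \<Longrightarrow> resistance G x y = q G h h"
  using resistance_eq by (auto simp: potential_def)

lemma resistance_nonneg: "x \<in> points G \<Longrightarrow> y \<in> points G \<Longrightarrow> 0 \<le> resistance G x y"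
  using potential_exists resistance_eq_energy q_nonneg by metis

text \<open>Cauchy-Schwarz for \<open>f\<close> and the potential of the pair, whose energy is the
  resistance.\<close>

lemma resistance_bound:
  assumes "f \<in> H1 G" "x \<in> points G" "y \<in> points G"
  shows "(f x - f y)\<^sup>2 \<le> resistance G x y * q G f f"
proof -
  obtain h where h: "potential x y h" using potential_exists[OF assms(2,3)] .
  then have "q G h f = f x - f y" using assms(1) by (simp add: potential_def)
  with h q_Cauchy_Schwarz[of h f] assms(1) resistance_eq_energy[OF h] show ?thesis
    by (simp add: potential_def)
qed

lemma resistance_pos:
  assumes "x \<in> points G" "y \<in> points G" "x \<noteq> y"
  shows "0 < resistance G x y"
proof (rule ccontr)
  assume "\<not> 0 < resistance G x y"
  with resistance_nonneg[OF assms(1,2)] have "resistance G x y = 0" by simp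
  then have "g x = g y" if "g \<in> H1 G" for g
    using resistance_bound[OF that assms(1,2)] by simp
  with H1_separates[OF assms(1,2)] assms(3) show False by blast
qed

lemma resistance_sym:
  assumes "x \<in> points G" "y \<in> points G"
  shows "resistance G y x = resistance G x y"
proof -
  obtain h where h: "potential x y h" using potential_exists[OF assms] .
  then show ?thesis
    using resistance_eq[OF h] resistance_eq[OF potential_minus[OF h]] by simp
qed

text \<open>Potentials add and their energy is the resistance, so this is Minkowski's inequality for
  \<open>q\<close>. It is the source of the continuity of the resistance.\<close>

lemma sqrt_resistance_triangle:
  assumes "x \<in> points G" "y \<in> points G" "z \<in> points G"
  shows "sqrt (resistance G x z) \<le> sqrt (resistance G x y) + sqrt (resistance G y z)"
proof -
  obtain h where h: "potential x y h" using potential_exists[OF assms(1,2)] .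
  obtain k where k: "potential y z k" using potential_exists[OF assms(2,3)] .
  have H1: "h \<in> H1 G" "k \<in> H1 G" using h k by (auto simp: potential_def)
  have "resistance G x z = q G h h + 2 * q G h k + q G k k"
    using resistance_eq_energy[OF potential_add[OF h k]] q_linear_square[OF H1, of 1 1] by simp
  also have "\<dots> \<le> (sqrt (q G h h) + sqrt (q G k k))\<^sup>2"
  proof -
    have "q G h k \<le> sqrt ((q G h k)\<^sup>2)" by simp
    also have "\<dots> \<le> sqrt (q G h h * q G k k)"
      by (rule real_sqrt_le_mono[OF q_Cauchy_Schwarz[OF H1]])
    finally show ?thesis using q_nonneg by (simp add: power2_sum real_sqrt_mult)
  qed
  finally have "sqrt (resistance G x z) \<le> \<bar>sqrt (q G h h) + sqrt (q G k k)\<bar>"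
    using real_sqrt_le_mono by fastforce
  then show ?thesis
    using resistance_eq_energy[OF h] resistance_eq_energy[OF k] q_nonneg by simp
qed

section \<open>Continuity of the resistance and existence of extremal points\<close>

lemma H1_edge_increment_bound:
  assumes f: "f \<in> H1 G" and e: "e \<in> edges G" and st: "s \<in> {0..len G e}" "t \<in> {0..len G e}"
  shows "(f (edge_pt G e t) - f (edge_pt G e s))\<^sup>2 \<le> q G f f * \<bar>t - s\<bar>"
proof -
  let ?u = "\<lambda>t. f (edge_pt G e t)"
  let ?E = "\<lambda>e. LINT x|lebesgue_on {0<..<len G e}. weak_deriv (len G e) (\<lambda>t. f (edge_pt G e t)) x *
      weak_deriv (len G e) (\<lambda>t. f (edge_pt G e t)) x"
  have ordered: "(?u t - ?u s)\<^sup>2 \<le> ?E e * (t - s)"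
    if "0 \<le> s" "s \<le> t" "t \<le> len G e" for s t
    by (rule weak_deriv_increment_bound) (use f e that in \<open>auto simp: H1_iff\<close>)
  have "(?u t - ?u s)\<^sup>2 \<le> ?E e * \<bar>t - s\<bar>"
    using ordered[of s t] ordered[of t s] st by (cases "s \<le> t") (auto simp: power2_commute)
  also have "?E e \<le> q G f f"
    unfolding q_alt by (rule member_le_sum) (use e finite_edges in auto)
  finally show ?thesis by (simp add: mult_right_mono)
qed

text \<open>The increment bound is applied to the potential of the pair: both its increment and its
  energy are the resistance, so one factor cancels.\<close>

lemma resistance_edge_le:
  assumes e: "e \<in> edges G" and st: "s \<in> {0..len G e}" "t \<in> {0..len G e}"
  shows "resistance G (edge_pt G e s) (edge_pt G e t) \<le> \<bar>t - s\<bar>"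
proof -
  obtain h where h: "potential (edge_pt G e s) (edge_pt G e t) h"
    using potential_exists edge_pt_in_points[OF e] by metis
  let ?r = "resistance G (edge_pt G e s) (edge_pt G e t)"
  have "(h (edge_pt G e t) - h (edge_pt G e s))\<^sup>2 \<le> q G h h * \<bar>t - s\<bar>"
    by (rule H1_edge_increment_bound) (use h e st in \<open>auto simp: potential_def\<close>)
  moreover have "(h (edge_pt G e t) - h (edge_pt G e s))\<^sup>2 = ?r * ?r"
    using power2_commute[of "h (edge_pt G e t)"] by (simp add: resistance_eq[OF h] power2_eq_square)
  ultimately have "?r * ?r \<le> ?r * \<bar>t - s\<bar>"
    using resistance_eq_energy[OF h] by simp
  then show ?thesis
    using resistance_nonneg[OF edge_pt_in_points[OF e] edge_pt_in_points[OF e], of s t]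
    by (cases "?r = 0") auto
qed

lemma sqrt_resistance_diff_le:
  assumes "x \<in> points G" "y \<in> points G" "x' \<in> points G" "y' \<in> points G"
  shows "\<bar>sqrt (resistance G x y) - sqrt (resistance G x' y')\<bar> \<le>
    sqrt (resistance G x x') + sqrt (resistance G y y')"
  using sqrt_resistance_triangle[of x x' y] sqrt_resistance_triangle[of x' y' y]
    sqrt_resistance_triangle[of x' x y'] sqrt_resistance_triangle[of x y y']
    resistance_sym[of x x'] resistance_sym[of y y'] assms
  by (auto simp: abs_le_iff)

lemma continuous_on_resistance:
  assumes e: "e \<in> edges G" "e' \<in> edges G"
  shows "continuous_on ({0..len G e} \<times> {0..len G e'})
    (\<lambda>p. resistance G (edge_pt G e (fst p)) (edge_pt G e' (snd p)))" (is "continuous_on ?S ?r")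
proof -
  have "((\<lambda>p. sqrt (?r p)) \<longlongrightarrow> sqrt (?r p0)) (at p0 within ?S)" if p0: "p0 \<in> ?S" for p0
  proof (rule LIM_zero_cancel)
    show "((\<lambda>p. sqrt (?r p) - sqrt (?r p0)) \<longlongrightarrow> 0) (at p0 within ?S)"
    proof (rule Lim_null_comparison)
      let ?b = "\<lambda>p. sqrt \<bar>fst p0 - fst p\<bar> + sqrt \<bar>snd p0 - snd p\<bar>"
      have "?b \<midarrow>p0 \<rightarrow> ?b p0"
        by (intro tendsto_intros)
      then show "(?b \<longlongrightarrow> 0) (at p0 within ?S)"
        by (intro tendsto_within_subset[where S=UNIV and T="?S"]) auto
      show "\<forall>\<^sub>F p in at p0 within ?S. norm (sqrt (?r p) - sqrt (?r p0)) \<le> ?b p"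
        unfolding eventually_at_topological
      proof (intro exI[of _ UNIV] conjI ballI impI open_UNIV UNIV_I)
        fix p assume p: "p \<in> ?S"
        have "\<bar>sqrt (?r p) - sqrt (?r p0)\<bar> \<le>
            sqrt (resistance G (edge_pt G e (fst p)) (edge_pt G e (fst p0))) +
            sqrt (resistance G (edge_pt G e' (snd p)) (edge_pt G e' (snd p0)))"
          using e by (intro sqrt_resistance_diff_le edge_pt_in_points)
        also have "\<dots> \<le> ?b p"
          using p p0 e by (intro add_mono real_sqrt_le_mono resistance_edge_le) auto
        finally show "norm (sqrt (?r p) - sqrt (?r p0)) \<le> ?b p" by simp
      qed
    qed
  qed
  then have "continuous_on ?S (\<lambda>p. sqrt (?r p))" by (simp add: continuous_on_def)
  then have cont: "continuous_on ?S (\<lambda>p. (sqrt (?r p))\<^sup>2)" by (rule continuous_on_power)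
  have "(sqrt (?r p))\<^sup>2 = ?r p" for p
    using e by (simp add: resistance_nonneg edge_pt_in_points)
  with cont show ?thesis by (simp only:)
qed

text \<open>The space of pairs is covered by finitely many compact rectangles, so compactness is
  used only in the plane. Stated for a function of two points, it serves both the diameter and,
  through \<open>f x - f y\<close>, the extrema of a single function.\<close>

lemma attains_max_on_pairs:
  fixes F :: "('v, 'e) point \<Rightarrow> ('v, 'e) point \<Rightarrow> real"
  assumes cont: "\<And>e e'. e \<in> edges G \<Longrightarrow> e' \<in> edges G \<Longrightarrow>
    continuous_on ({0..len G e} \<times> {0..len G e'}) (\<lambda>p. F (edge_pt G e (fst p)) (edge_pt G e' (snd p)))"
  obtains x y where "x \<in> points G" "y \<in> points G"
    "\<And>x' y'. x' \<in> points G \<Longrightarrow> y' \<in> points G \<Longrightarrow> F x' y' \<le> F x y"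
proof -
  let ?F = "\<lambda>d p. F (edge_pt G (fst d) (fst p)) (edge_pt G (snd d) (snd p))"
  let ?S = "\<lambda>d. {0..len G (fst d)} \<times> {0..len G (snd d)}"
  let ?E = "edges G \<times> edges G"
  have "\<exists>p\<in>?S d. \<forall>p'\<in>?S d. ?F d p' \<le> ?F d p" if "d \<in> ?E" for d
    using cont[of "fst d" "snd d"] that len_nonneg
    by (intro continuous_attains_sup) (auto intro: compact_Times)
  then obtain P where P: "\<And>d. d \<in> ?E \<Longrightarrow> P d \<in> ?S d"
    "\<And>d p'. d \<in> ?E \<Longrightarrow> p' \<in> ?S d \<Longrightarrow> ?F d p' \<le> ?F d (P d)"
    by metis
  have fin: "finite ?E" "?E \<noteq> {}" using finite_edges edges_nonempty by auto
  then have "Max ((\<lambda>d. ?F d (P d)) ` ?E) \<in> (\<lambda>d. ?F d (P d)) ` ?E"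
    by (intro Max_in finite_imageI) (simp_all only: image_is_empty not_False_eq_True)
  then obtain d where d: "d \<in> ?E" "Max ((\<lambda>d. ?F d (P d)) ` ?E) = ?F d (P d)"
    by (rule imageE)
  have dmax: "?F d' (P d') \<le> ?F d (P d)" if "d' \<in> ?E" for d'
    using fin that unfolding d(2)[symmetric] by (intro Max_ge) auto
  show thesis
  proof (rule that)
    show "edge_pt G (fst d) (fst (P d)) \<in> points G" "edge_pt G (snd d) (snd (P d)) \<in> points G"
      using d(1) by (auto intro: edge_pt_in_points)
    fix x' y' assume "x' \<in> points G" "y' \<in> points G"
    obtain e s where e: "e \<in> edges G" "s \<in> {0..len G e}" "x' = edge_pt G e s"
      using pointE[OF \<open>x' \<in> points G\<close>] .
    obtain e' t where e': "e' \<in> edges G" "t \<in> {0..len G e'}" "y' = edge_pt G e' t"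
      using pointE[OF \<open>y' \<in> points G\<close>] .
    from e e' have "F x' y' \<le> ?F (e, e') (P (e, e'))"
      using P(2)[of "(e, e')" "(s, t)"] by simp
    also have "\<dots> \<le> ?F d (P d)" using e e' by (intro dmax) auto
    finally show "F x' y' \<le> ?F d (P d)" .
  qed
qed

lemma diam_eqI:
  assumes "x \<in> points G" "y \<in> points G"
    and "\<And>x' y'. x' \<in> points G \<Longrightarrow> y' \<in> points G \<Longrightarrow> d x' y' \<le> d x y"
  shows "diam G d = d x y"
  unfolding diam_def by (rule Greatest_equality) (use assms in auto)

lemma resistance_diam:
  obtains x y where "x \<in> points G" "y \<in> points G" "resistance G x y = diam G (resistance G)"
    and "\<And>x' y'. x' \<in> points G \<Longrightarrow> y' \<in> points G \<Longrightarrow> resistance G x' y' \<le> diam G (resistance G)"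
    and "0 < diam G (resistance G)"
proof -
  obtain x y where xy: "x \<in> points G" "y \<in> points G"
    "\<And>x' y'. x' \<in> points G \<Longrightarrow> y' \<in> points G \<Longrightarrow> resistance G x' y' \<le> resistance G x y"
    using attains_max_on_pairs[OF continuous_on_resistance] by blast
  have D: "diam G (resistance G) = resistance G x y" by (rule diam_eqI[where d="resistance G", OF xy])
  obtain e where e: "e \<in> edges G" using edges_nonempty by auto
  then have len: "0 < len G e" by (rule len_pos)
  \<comment> \<open>Interior points are taken because the two ends of the edge coincide if it is a
    loop.\<close>
  then have "edge_pt G e (len G e / 3) \<noteq> edge_pt G e (len G e / 2)" by simp
  then have "0 < resistance G (edge_pt G e (len G e / 3)) (edge_pt G e (len G e / 2))"
    by (intro resistance_pos edge_pt_in_points e)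
  also have "\<dots> \<le> resistance G x y" by (intro xy(3) edge_pt_in_points e)
  finally show thesis using that[OF xy(1,2)] xy(3) D by simp
qed

lemma H1_attains_extrema:
  assumes "f \<in> H1 G"
  obtains x y where "x \<in> points G" "y \<in> points G"
    "\<And>z. z \<in> points G \<Longrightarrow> f z \<le> f x" "\<And>z. z \<in> points G \<Longrightarrow> f y \<le> f z"
proof -
  have "continuous_on ({0..len G e} \<times> {0..len G e'}) (\<lambda>p. f (edge_pt G e (fst p)) - f (edge_pt G e' (snd p)))"
    if "e \<in> edges G" "e' \<in> edges G" for e e'
  proof (intro continuous_on_diff)
    have c: "continuous_on {0..len G e} (\<lambda>t. f (edge_pt G e t))" "continuous_on {0..len G e'} (\<lambda>t. f (edge_pt G e' t))"
      using assms that by (auto simp: H1_iff)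
    show "continuous_on ({0..len G e} \<times> {0..len G e'}) (\<lambda>p. f (edge_pt G e (fst p)))"
      by (rule continuous_on_compose2[OF c(1) continuous_on_fst[OF continuous_on_id]]) auto
    show "continuous_on ({0..len G e} \<times> {0..len G e'}) (\<lambda>p. f (edge_pt G e' (snd p)))"
      by (rule continuous_on_compose2[OF c(2) continuous_on_snd[OF continuous_on_id]]) auto
  qed
  then obtain x y where xy: "x \<in> points G" "y \<in> points G"
    "\<And>x' y'. x' \<in> points G \<Longrightarrow> y' \<in> points G \<Longrightarrow> f x' - f y' \<le> f x - f y"
    using attains_max_on_pairs[of "\<lambda>x y. f x - f y"] by blast
  show thesis
    using that[OF xy(1,2)] xy(3)[OF _ xy(2)] xy(3)[OF xy(1)] by fastforce
qed

end

section \<open>Borel probability measures and eigenfunctions\<close>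

lemma one_le_L2_dim:
  assumes "f \<in> S" "\<not> (AE x in M. f x = 0)"
  shows "1 \<le> L2_dim M S"
  unfolding L2_dim_def
proof (rule Sup_upper, rule CollectI, intro exI conjI)
  show "1 = enat 1" by (simp add: one_enat_def)
  show "\<forall>i<1. (\<lambda>i. f) i \<in> S" using assms(1) by simp
  show "\<forall>c :: nat \<Rightarrow> real. (AE x in M. (\<Sum>i<1. c i * (\<lambda>i. f) i x) = 0) \<longrightarrow> (\<forall>i<1. c i = 0)"
  proof (intro allI impI)
    fix c :: "nat \<Rightarrow> real" and i :: nat
    assume "AE x in M. (\<Sum>i<1. c i * f x) = 0" "i < 1"
    with assms(2) show "c i = 0" by (cases "c 0 = 0") auto
  qed
qed

lemma two_le_L2_dim:
  assumes "f \<in> S" "g \<in> S"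
    and indep: "\<And>a b. (AE x in M. a * f x + b * g x = 0) \<Longrightarrow> a = 0 \<and> b = 0"
  shows "enat 2 \<le> L2_dim M S"
  unfolding L2_dim_def
proof (rule Sup_upper, rule CollectI, intro exI conjI)
  let ?f = "\<lambda>i::nat. if i = 0 then f else g"
  show "enat 2 = enat 2" by simp
  show "\<forall>i<2. ?f i \<in> S" using assms by simp
  show "\<forall>c :: nat \<Rightarrow> real. (AE x in M. (\<Sum>i<2. c i * ?f i x) = 0) \<longrightarrow> (\<forall>i<2. c i = 0)"
  proof (intro allI impI)
    fix c :: "nat \<Rightarrow> real" and i :: nat
    assume "AE x in M. (\<Sum>i<2. c i * ?f i x) = 0" "i < 2"
    then show "c i = 0" using indep[of "c 0" "c 1"] by (auto simp: numeral_2_eq_2 less_Suc_eq)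
  qed
qed

lemma L2_dim_nonzero:
  assumes "0 < L2_dim M S"
  obtains f where "f \<in> S" "\<not> (AE x in M. f x = 0)"
proof -
  obtain n f where n: "0 < enat n" "\<And>i. i < n \<Longrightarrow> f i \<in> S"
    "\<And>c :: nat \<Rightarrow> real. (AE x in M. (\<Sum>i<n. c i * f i x) = 0) \<Longrightarrow> \<forall>i<n. c i = 0"
    using assms unfolding L2_dim_def less_Sup_iff by auto
  have n0: "0 < n" using n(1) by (simp add: zero_enat_def)
  have "\<not> (AE x in M. f 0 x = 0)"
  proof
    assume "AE x in M. f 0 x = 0"
    then have "AE x in M. (\<Sum>i<n. (if i = 0 then 1 else 0) * f i x) = 0"
      using n0 by (simp add: if_distrib[of "\<lambda>y. y * _"] cong: if_cong)
    from n(3)[OF this] n0 show False by auto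
  qed
  with that n(2)[OF n0] show thesis by blast
qed

lemma L2_dim_consts_le_1:
  fixes S :: "('a \<Rightarrow> real) set"
  assumes "\<And>f. f \<in> S \<Longrightarrow> \<exists>k. \<forall>x\<in>space M. f x = k"
  shows "L2_dim M S \<le> 1"
  unfolding L2_dim_def
proof (rule Sup_least, clarify)
  fix n and f :: "nat \<Rightarrow> 'a \<Rightarrow> real"
  assume f: "\<forall>i<n. f i \<in> S"
    and indep: "\<forall>c :: nat \<Rightarrow> real. (AE x in M. (\<Sum>i<n. c i * f i x) = 0) \<longrightarrow> (\<forall>i<n. c i = 0)"
  show "enat n \<le> 1"
  proof (rule ccontr)
    assume "\<not> enat n \<le> 1"
    then have n: "1 < n" by (simp add: one_enat_def)
    obtain k0 k1 where k: "\<And>x. x \<in> space M \<Longrightarrow> f 0 x = k0" "\<And>x. x \<in> space M \<Longrightarrow> f 1 x = k1"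
    proof -
      have "f 0 \<in> S" "f 1 \<in> S" using f n by auto
      from assms[OF this(1)] assms[OF this(2)] that show thesis by blast
    qed
    have relation: "a = 0 \<and> b = 0" if "a * k0 + b * k1 = 0" for a b
    proof -
      let ?c = "\<lambda>i::nat. if i = 0 then a else if i = 1 then b else 0"
      have "(\<Sum>i<n. ?c i * f i x) = a * k0 + b * k1" if "x \<in> space M" for x
      proof -
        have "(\<Sum>i<n. ?c i * f i x) = (\<Sum>i\<in>{0,1}. ?c i * f i x)"
          by (rule sum.mono_neutral_right) (use n in auto)
        then show ?thesis using k that by simp
      qed
      with that have "AE x in M. (\<Sum>i<n. ?c i * f i x) = 0"
        by (intro AE_I2) simp
      with spec[OF indep, of ?c] have "\<forall>i<n. ?c i = 0" by (rule mp)
      then have "?c 0 = 0" "?c 1 = 0" using n by (simp_all only: spec[of _ 0] order.strict_trans[OF zero_less_one])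
      then show ?thesis by simp
    qed
    \<comment> \<open>Any two constants satisfy this relation, so independence forces both to
      vanish; then the coefficients 1 and 0 give a relation as well, which is absurd.\<close>
    have "k1 * k0 + (- k0) * k1 = 0" by simp
    with relation[of k1 "- k0"] relation[of 1 0] show False by simp
  qed
qed

context metric_graph
begin

lemma openin_subset_points: "openin (graph_top G) U \<Longrightarrow> U \<subseteq> points G"
  by (simp add: openin_graph_top)

lemma space_graph_borel: "space (graph_borel G) = points G"
  unfolding graph_borel_def using openin_subset_points by (intro space_measure_of) auto

lemma open_in_graph_borel: "openin (graph_top G) U \<Longrightarrow> U \<in> sets (graph_borel G)"
  unfolding graph_borel_def using openin_subset_points by (subst sets_measure_of) auto

lemma closed_singleton: "openin (graph_top G) (points G - {x})"
  unfolding openin_graph_top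
proof (intro conjI ballI)
  fix e assume e: "e \<in> edges G"
  let ?K = "{t \<in> {0..len G e}. edge_pt G e t = x}"
  have sub: "?K \<subseteq> {0, len G e} \<union> {t. x = Inner e t}"
    by (auto simp: edge_pt_def)
  have "finite {t. x = Inner e t}" by (cases x) auto
  then have "finite ?K" by (intro finite_subset[OF sub]) simp
  then have "open (- ?K)" by (intro open_Compl finite_imp_closed)
  moreover have "{t \<in> {0..len G e}. edge_pt G e t \<in> points G - {x}} = {0..len G e} \<inter> - ?K"
    using edge_pt_in_points[OF e] by auto
  ultimately show "openin (top_of_set {0..len G e}) {t \<in> {0..len G e}. edge_pt G e t \<in> points G - {x}}"
    by (simp only: openin_open_Int)
qed auto

lemma singleton_in_graph_borel:
  assumes "x \<in> points G"
  shows "{x} \<in> sets (graph_borel G)"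
proof -
  have "space (graph_borel G) - (points G - {x}) \<in> sets (graph_borel G)"
    by (intro sets.compl_sets open_in_graph_borel closed_singleton)
  moreover have "space (graph_borel G) - (points G - {x}) = {x}"
    using assms by (auto simp: space_graph_borel)
  ultimately show ?thesis by simp
qed

lemma H1_bounded:
  assumes "f \<in> H1 G"
  obtains B where "\<And>x. x \<in> points G \<Longrightarrow> \<bar>f x\<bar> \<le> B"
proof -
  obtain x y where "\<And>z. z \<in> points G \<Longrightarrow> f z \<le> f x" "\<And>z. z \<in> points G \<Longrightarrow> f y \<le> f z"
    using H1_attains_extrema[OF assms] by metis
  then have "\<bar>f z\<bar> \<le> \<bar>f x\<bar> + \<bar>f y\<bar>" if "z \<in> points G" for z
    using that by (smt (verit))
  with that show thesis .
qed

end

locale graph_measure = metric_graph +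
  fixes \<mu> :: "('a, 'b) point measure"
  assumes borel_prob: "borel_prob G \<mu>"

sublocale graph_measure \<subseteq> prob_space \<mu>
  using borel_prob by (simp add: borel_prob_def)

context graph_measure
begin

lemma sets_eq: "sets \<mu> = sets (graph_borel G)"
  using borel_prob by (simp add: borel_prob_def)

lemma space_eq: "space \<mu> = points G"
  using sets_eq_imp_space_eq[OF sets_eq] by (simp add: space_graph_borel)

lemma singleton_sets: "x \<in> points G \<Longrightarrow> {x} \<in> sets \<mu>"
  by (simp add: sets_eq singleton_in_graph_borel)

lemma H1_measurable:
  assumes "f \<in> H1 G"
  shows "f \<in> borel_measurable \<mu>"
proof (rule borel_measurableI)
  fix S :: "real set" assume "open S"
  with assms have "openin (graph_top G) {x \<in> points G. f x \<in> S}"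
    by (auto simp: H1_def continuous_map_def topspace_graph_top)
  moreover have "f -` S \<inter> space \<mu> = {x \<in> points G. f x \<in> S}"
    by (auto simp: space_eq)
  ultimately show "f -` S \<inter> space \<mu> \<in> sets \<mu>"
    using open_in_graph_borel by (simp add: sets_eq)
qed

lemma H1_in_L2:
  assumes "f \<in> H1 G"
  shows "f \<in> L2 \<mu>"
proof -
  obtain B where "\<And>x. x \<in> points G \<Longrightarrow> \<bar>f x\<bar> \<le> B" using H1_bounded[OF assms] by metis
  then show ?thesis
    using finite_measure_axioms H1_measurable[OF assms] by (intro bounded_in_L2[where B=B]) (auto simp: space_eq)
qed

lemma H1_mult_integrable: "f \<in> H1 G \<Longrightarrow> g \<in> H1 G \<Longrightarrow> integrable \<mu> (\<lambda>x. f x * g x)"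
  by (intro L2_mult_integrable H1_in_L2)

lemma H1_square_integrable: "f \<in> H1 G \<Longrightarrow> integrable \<mu> (\<lambda>x. (f x)\<^sup>2)"
  using H1_mult_integrable[of f f] by (simp add: power2_eq_square)

lemma H1_integrable: "f \<in> H1 G \<Longrightarrow> integrable \<mu> f"
  using H1_mult_integrable[OF _ const_in_H1[of 1]] by simp

lemma const_in_H1_mu: "(\<lambda>x. k) \<in> H1_mu G \<mu>"
  by (simp add: H1_mu_def harmonic_on_def const_in_H1 q_const)

section \<open>Eigenfunctions and the first positive eigenvalue\<close>

lemma eigenspace_H1: "f \<in> eigenspace G \<mu> c \<Longrightarrow> f \<in> H1 G"
  by (simp add: eigenspace_def H_op_def H1_mu_def)

lemma eigenspace_q:
  "f \<in> eigenspace G \<mu> c \<Longrightarrow> g \<in> eigenspace G \<mu> d \<Longrightarrow> q G f g = c * (LINT x|\<mu>. f x * g x)"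
  by (simp add: eigenspace_def H_op_def mult.assoc)

lemma eigenspace_energy:
  assumes "f \<in> eigenspace G \<mu> c"
  shows "q G f f = c * (LINT x|\<mu>. (f x)\<^sup>2)"
  using eigenspace_q[OF assms assms] by (simp add: power2_eq_square)

text \<open>The constant 1 belongs to the form domain and pairs to zero with \<open>f\<close>, so
  testing the eigenvalue equation with it leaves \<open>c\<close> times the mean.\<close>

lemma eigenspace_mean_zero:
  assumes "f \<in> eigenspace G \<mu> c" "c \<noteq> 0"
  shows "(LINT x|\<mu>. f x) = 0"
proof -
  have "q G f (\<lambda>x. 1) = c * (LINT x|\<mu>. f x)"
    using assms(1) const_in_H1_mu[of 1] by (simp add: eigenspace_def H_op_def)
  then show ?thesis
    using assms q_const[OF eigenspace_H1[OF assms(1)]] by (simp add: q_sym[of f])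
qed

lemma eigenspace_orthogonal:
  assumes "f \<in> eigenspace G \<mu> c" "g \<in> eigenspace G \<mu> d" "c \<noteq> d"
  shows "(LINT x|\<mu>. f x * g x) = 0" "q G f g = 0"
proof -
  have "q G g f = d * (LINT x|\<mu>. f x * g x)"
    using eigenspace_q[OF assms(2,1)] by (simp add: mult.commute[of "g _"])
  then have "c * (LINT x|\<mu>. f x * g x) = d * (LINT x|\<mu>. f x * g x)"
    using eigenspace_q[OF assms(1,2)] by (simp only: q_sym[of f g])
  then show "(LINT x|\<mu>. f x * g x) = 0" using assms(3) by auto
  then show "q G f g = 0" using eigenspace_q[OF assms(1,2)] by simp
qed

lemma norm_pos:
  assumes "f \<in> H1 G" "\<not> (AE x in \<mu>. f x = 0)"
  shows "0 < (LINT x|\<mu>. (f x)\<^sup>2)"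
proof -
  have "(LINT x|\<mu>. (f x)\<^sup>2) \<noteq> 0"
    using assms integral_nonneg_eq_0_iff_AE[OF H1_square_integrable[OF assms(1)]] by auto
  moreover have "0 \<le> (LINT x|\<mu>. (f x)\<^sup>2)" by simp
  ultimately show ?thesis by linarith
qed

lemma eigenvalue_pos:
  assumes "f \<in> eigenspace G \<mu> c" "\<not> (AE x in \<mu>. f x = 0)" "c \<noteq> 0"
  shows "0 < c"
proof -
  have "0 \<le> c * (LINT x|\<mu>. (f x)\<^sup>2)"
    using eigenspace_energy[OF assms(1)] q_nonneg[of f] by simp
  then show ?thesis
    using norm_pos[OF eigenspace_H1[OF assms(1)] assms(2)] assms(3)
    by (auto simp: zero_le_mult_iff)
qed

lemma eigenspace_0_const:
  assumes "f \<in> eigenspace G \<mu> 0" "x \<in> points G" "y \<in> points G"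
  shows "f x = f y"
  using null_imp_const[OF eigenspace_H1[OF assms(1)] _ assms(2,3)] eigenspace_energy[OF assms(1)] by simp

lemma L2_dim_eigenspace_0: "L2_dim \<mu> (eigenspace G \<mu> 0) \<le> 1"
proof (rule L2_dim_consts_le_1)
  fix f assume f: "f \<in> eigenspace G \<mu> 0"
  obtain p where "p \<in> points G" using not_empty by (auto simp: space_eq)
  then have "\<forall>x\<in>space \<mu>. f x = f p"
    unfolding space_eq by (intro ballI eigenspace_0_const[OF f])
  then show "\<exists>k. \<forall>x\<in>space \<mu>. f x = k" by blast
qed

text \<open>The eigenspace of 0 consists of constants and contributes at most 1, so a count above 1
  needs another eigenvalue.\<close>

lemma second_eigenvalue:
  assumes "finite \<Lambda>" "enat 1 < (\<Sum>c\<in>\<Lambda>. L2_dim \<mu> (eigenspace G \<mu> c))"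
  obtains c f where "c \<in> \<Lambda>" "c > 0" "f \<in> eigenspace G \<mu> c" "\<not> (AE x in \<mu>. f x = 0)"
proof -
  have "\<exists>c\<in>\<Lambda>. c \<noteq> 0 \<and> 0 < L2_dim \<mu> (eigenspace G \<mu> c)"
  proof (rule ccontr)
    assume "\<not> ?thesis"
    then have "(\<Sum>c\<in>\<Lambda>. L2_dim \<mu> (eigenspace G \<mu> c)) = (\<Sum>c\<in>\<Lambda> \<inter> {0}. L2_dim \<mu> (eigenspace G \<mu> c))"
      using assms(1) by (intro sum.mono_neutral_right) auto
    also have "\<dots> \<le> 1"
      using L2_dim_eigenspace_0 by (cases "0 \<in> \<Lambda>") auto
    finally show False using assms(2) by (simp add: one_enat_def)
  qed
  then obtain c where c: "c \<in> \<Lambda>" "c \<noteq> 0" "0 < L2_dim \<mu> (eigenspace G \<mu> c)" by blast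
  obtain f where f: "f \<in> eigenspace G \<mu> c" "\<not> (AE x in \<mu>. f x = 0)"
    using L2_dim_nonzero[OF c(3)] .
  with that c eigenvalue_pos[OF f c(2)] show thesis by blast
qed

text \<open>The nonnegative function \<open>(a - f z) * (f z - b)\<close> is integrated: its linear
  term drops out since the mean is zero, and equality makes it vanish almost everywhere. The product
  form is kept because its gap to \<open>(a - b)\<^sup>2 / 4\<close> is
  \<open>(a + b)\<^sup>2 / 4\<close>, which in the extremal case forces
  \<open>a = - b\<close>.\<close>

lemma Popoviciu:
  assumes "f \<in> H1 G" "(LINT z|\<mu>. f z) = 0"
    and "\<And>z. z \<in> points G \<Longrightarrow> f z \<le> a" "\<And>z. z \<in> points G \<Longrightarrow> b \<le> f z"
  shows "(LINT z|\<mu>. (f z)\<^sup>2) \<le> - (a * b)"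
    and "(LINT z|\<mu>. (f z)\<^sup>2) = - (a * b) \<Longrightarrow> AE z in \<mu>. f z = a \<or> f z = b"
proof -
  let ?p = "\<lambda>z. (a - f z) * (f z - b)"
  have p: "?p z = (a + b) * f z - (f z)\<^sup>2 - a * b" for z
    by (simp add: power2_eq_square algebra_simps)
  have int: "integrable \<mu> ?p"
    unfolding p using H1_integrable[OF assms(1)] H1_square_integrable[OF assms(1)] by simp
  have eq: "(LINT z|\<mu>. ?p z) = - (LINT z|\<mu>. (f z)\<^sup>2) - a * b"
    unfolding p using H1_integrable[OF assms(1)] H1_square_integrable[OF assms(1)] assms(2) by (simp add: prob_space)
  have nonneg: "AE z in \<mu>. 0 \<le> ?p z"
    using assms(3,4) by (intro AE_I2) (simp add: space_eq)
  from integral_nonneg_AE[OF nonneg] eq show "(LINT z|\<mu>. (f z)\<^sup>2) \<le> - (a * b)" by simp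
  assume "(LINT z|\<mu>. (f z)\<^sup>2) = - (a * b)"
  then have "AE z in \<mu>. ?p z = 0"
    using integral_nonneg_eq_0_iff_AE[OF int nonneg] eq by simp
  then show "AE z in \<mu>. f z = a \<or> f z = b" by eventually_elim auto
qed

lemma eigenvalue_lower_bound:
  assumes f: "f \<in> eigenspace G \<mu> c" "\<not> (AE x in \<mu>. f x = 0)" "0 < c"
  shows "4 / diam G (resistance G) \<le> c"
proof -
  obtain D where D: "D = diam G (resistance G)" "0 < D"
    "\<And>x y. x \<in> points G \<Longrightarrow> y \<in> points G \<Longrightarrow> resistance G x y \<le> D"
    using resistance_diam by metis
  note H1 = eigenspace_H1[OF f(1)]
  obtain x y where xy: "x \<in> points G" "y \<in> points G"
    "\<And>z. z \<in> points G \<Longrightarrow> f z \<le> f x" "\<And>z. z \<in> points G \<Longrightarrow> f y \<le> f z"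
    using H1_attains_extrema[OF H1] by metis
  let ?I = "LINT z|\<mu>. (f z)\<^sup>2"
  have "?I \<le> - (f x * f y)"
    using f(3) by (intro Popoviciu(1)[OF H1 eigenspace_mean_zero[OF f(1)] xy(3,4)]) auto
  \<comment> \<open>Passes from the product bound to the oscillation, since
    \<open>(f x - f y)\<^sup>2 = (f x + f y)\<^sup>2 - 4 * f x * f y\<close>; here the constant 4
    arises.\<close>
  moreover have "0 \<le> (f x + f y)\<^sup>2" by simp
  ultimately have "4 * ?I \<le> (f x - f y)\<^sup>2"
    by (simp add: power2_eq_square algebra_simps)
  also have "\<dots> \<le> resistance G x y * q G f f" by (rule resistance_bound[OF H1 xy(1,2)])
  also have "\<dots> \<le> D * q G f f" by (intro mult_right_mono D(3) xy q_nonneg)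
  also have "\<dots> = (D * c) * ?I" using eigenspace_energy[OF f(1)] by simp
  finally have "4 \<le> D * c" using norm_pos[OF H1 f(2)] by simp
  then show ?thesis using D by (simp add: field_simps)
qed

text \<open>In the case of equality every inequality of the preceding proof is sharp. Hence \<open>f\<close> is, up to
  scaling and an additive constant, the potential of every pair consisting of a maximum and a minimum
  point, and since \<^const>\<open>H1\<close> separates points there is only one such pair.\<close>

lemma extremal_eigenfunction:
  assumes f: "f \<in> eigenspace G \<mu> (4 / diam G (resistance G))" "\<not> (AE x in \<mu>. f x = 0)"
  obtains x y where "x \<in> points G" "y \<in> points G" "resistance G x y = diam G (resistance G)"
    "measure \<mu> {x} = 1 / 2" "measure \<mu> {y} = 1 / 2"
proof -
  obtain D where D: "D = diam G (resistance G)" "0 < D"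
    "\<And>x y. x \<in> points G \<Longrightarrow> y \<in> points G \<Longrightarrow> resistance G x y \<le> D"
    using resistance_diam by metis
  note H1 = eigenspace_H1[OF f(1)]
  have mean: "(LINT z|\<mu>. f z) = 0"
    using D by (intro eigenspace_mean_zero[OF f(1)]) simp
  let ?I = "LINT z|\<mu>. (f z)\<^sup>2"
  have I: "0 < ?I" by (rule norm_pos[OF H1 f(2)])
  have energy: "q G f f = 4 / D * ?I"
    using eigenspace_energy[OF f(1)] D by simp
  obtain x y where xy: "x \<in> points G" "y \<in> points G"
    "\<And>z. z \<in> points G \<Longrightarrow> f z \<le> f x" "\<And>z. z \<in> points G \<Longrightarrow> f y \<le> f z"
    using H1_attains_extrema[OF H1] by metis
  have pop: "?I \<le> - (f x * f y)" by (rule Popoviciu(1)[OF H1 mean xy(3,4)])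
  have osc: "(f p - f p')\<^sup>2 \<le> resistance G p p' * (4 / D * ?I)" if "p \<in> points G" "p' \<in> points G" for p p'
    using resistance_bound[OF H1 that] by (simp add: energy)
  have "(f x - f y)\<^sup>2 \<le> D * (4 / D * ?I)"
    using osc[OF xy(1,2)] D(3)[OF xy(1,2)] I D(2)
    by (meson divide_nonneg_pos less_imp_le mult_nonneg_nonneg mult_right_mono order_trans zero_le_numeral)
  then have up: "(f x - f y)\<^sup>2 \<le> 4 * ?I" using D(2) by simp
  \<comment> \<open>The squared oscillation is at most \<open>4 * ?I\<close> and at least
    \<open>4 * ?I + (f x + f y)\<^sup>2\<close>, so maximum and minimum are opposite.\<close>
  have id: "(f x - f y)\<^sup>2 = (f x + f y)\<^sup>2 + 4 * - (f x * f y)"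
    by (simp add: power2_eq_square algebra_simps)
  from up pop id have "(f x + f y)\<^sup>2 \<le> 0" by linarith
  then have fy: "f y = - f x" by simp
  define M where "M = f x"
  have IM: "?I = M\<^sup>2"
    using up pop by (simp add: fy M_def power2_eq_square)
  have M: "0 < M"
    using I IM xy(3)[OF xy(2)] fy by (cases "M = 0") (auto simp: M_def)
  have AE: "AE z in \<mu>. f z = M \<or> f z = - M"
    using Popoviciu(2)[OF H1 mean xy(3,4)] IM by (simp add: fy M_def power2_eq_square)
  have pairing: "resistance G p p' = D \<and> (\<forall>g\<in>H1 G. q G f g = 2 * M / D * (g p - g p'))"
    if p: "p \<in> points G" "p' \<in> points G" "f p = M" "f p' = - M" for p p'
  proof -
    have "4 * M\<^sup>2 \<le> resistance G p p' * (4 / D * M\<^sup>2)"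
      using osc[OF p(1,2)] p(3,4) IM by (simp add: power2_eq_square)
    then have "D \<le> resistance G p p'" using M D(2) by (simp add: field_simps)
    with D(3)[OF p(1,2)] have r: "resistance G p p' = D" by simp
    obtain h where h: "potential p p' h" using potential_exists[OF p(1,2)] .
    then have hH1: "h \<in> H1 G" by (simp add: potential_def)
    have fh: "q G f h = 2 * M"
      using h H1 p(3,4) by (simp add: potential_def q_sym[of f])
    \<comment> \<open>Between the two points \<open>f\<close> changes by \<open>2 * M\<close> and
      \<open>h\<close> by \<open>D\<close>, hence the factor; the difference will have zero
      energy.\<close>
    let ?d = "\<lambda>z. 1 * f z + (- (2 * M / D)) * h z"
    have dH1: "?d \<in> H1 G" by (rule H1_linear[OF H1 hH1])
    have "q G ?d ?d = 4 / D * M\<^sup>2 - 2 * (2 * M / D) * (2 * M) + (2 * M / D)\<^sup>2 * D"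
      unfolding q_linear_square[OF H1 hH1] fh resistance_eq_energy[OF h, symmetric] r energy IM by simp
    also have "\<dots> = 0" using D(2) by (simp add: field_simps power2_eq_square)
    finally have "q G ?d g = 0" if "g \<in> H1 G" for g
      using q_eq_0_of_null[OF dH1 that] by blast
    then have "q G f g = 2 * M / D * q G h g" if "g \<in> H1 G" for g
      using q_linear[OF H1 hH1 that, of 1 "- (2 * M / D)"] that by simp
    with h r show ?thesis by (auto simp: potential_def)
  qed
  have x: "f x = M" and y: "f y = - M" by (auto simp: M_def fy)
  \<comment> \<open>Two maxima paired with the same minimum \<open>y\<close> give the same
    functional, so every function in \<open>H1 G\<close> agrees on them.\<close>
  have max_unique: "z = x" if z: "z \<in> points G" "f z = M" for z
  proof (rule H1_separates[OF z(1) xy(1)])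
    fix g assume "g \<in> H1 G"
    with pairing[OF z(1) xy(2) z(2) y] pairing[OF xy(1,2) x y]
    have "2 * M / D * (g z - g y) = 2 * M / D * (g x - g y)" by metis
    then show "g z = g x" using M D(2) by simp
  qed
  have min_unique: "z = y" if z: "z \<in> points G" "f z = - M" for z
  proof (rule H1_separates[OF z(1) xy(2)])
    fix g assume "g \<in> H1 G"
    with pairing[OF xy(1) z(1) x z(2)] pairing[OF xy(1,2) x y]
    have "2 * M / D * (g x - g z) = 2 * M / D * (g x - g y)" by metis
    then show "g z = g y" using M D(2) by simp
  qed
  have ne: "x \<noteq> y" using x y M by auto
  have AE_xy: "AE z in \<mu>. z = x \<or> z = y"
    using AE AE_space by eventually_elim (auto simp: space_eq dest: max_unique min_unique)
  have meas: "{x} \<in> sets \<mu>" "{y} \<in> sets \<mu>" using singleton_sets xy by auto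
  have ind: "integrable \<mu> (\<lambda>z. k * indicator {p} z :: real)" if "{p} \<in> sets \<mu>" for k p
    using that by (intro integrable_mult_right integrable_real_indicator) (auto simp: emeasure_eq_measure)
  \<comment> \<open>As \<open>f\<close> is \<open>M\<close> at one atom and \<open>- M\<close> at
    the other, its zero mean makes the atoms equally heavy.\<close>
  have "(LINT z|\<mu>. f z) = (LINT z|\<mu>. M * indicator {x} z + (- M) * indicator {y} z)"
    by (rule integral_cong_AE)
      (use H1_measurable[OF H1] meas AE_xy x y ne in \<open>auto elim!: eventually_mono split: split_indicator\<close>)
  also have "\<dots> = M * measure \<mu> {x} - M * measure \<mu> {y}"
    using ind[OF meas(1)] ind[OF meas(2), of "-M"] meas by (subst Bochner_Integration.integral_add) (auto simp: xy space_eq)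
  finally have "measure \<mu> {x} = measure \<mu> {y}" using mean M by simp
  moreover have "measure \<mu> {x} + measure \<mu> {y} = 1"
  proof -
    have "prob ({x} \<union> {y}) = 1"
      using AE_xy by (subst prob_eq_1[OF sets.Un[OF meas]]) auto
    then show ?thesis using finite_measure_Union[OF meas] ne by simp
  qed
  ultimately show thesis
    using that[OF xy(1,2)] pairing[OF xy(1,2) x y] D(1) by simp
qed

end

section \<open>The second eigenvalue\<close>

context metric_graph
begin

lemma H1_sum: "finite S \<Longrightarrow> (\<And>i. i \<in> S \<Longrightarrow> f i \<in> H1 G) \<Longrightarrow> (\<lambda>x. \<Sum>i\<in>S. k i * f i x) \<in> H1 G"
proof (induction S rule: finite_induct)
  case empty
  show ?case using const_in_H1[of 0] by simp
next
  case (insert i S)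
  then show ?case using H1_linear[of "f i" "\<lambda>x. \<Sum>i\<in>S. k i * f i x" "k i" 1] by simp
qed

lemma q_sum:
  assumes "finite S" "\<And>i. i \<in> S \<Longrightarrow> f i \<in> H1 G" "g \<in> H1 G"
  shows "q G (\<lambda>x. \<Sum>i\<in>S. k i * f i x) g = (\<Sum>i\<in>S. k i * q G (f i) g)"
  using assms(1,2)
proof (induction S rule: finite_induct)
  case empty
  show ?case using q_const[OF assms(3), of 0] by simp
next
  case (insert i S)
  then have "q G (\<lambda>x. k i * f i x + 1 * (\<Sum>i\<in>S. k i * f i x)) g =
      k i * q G (f i) g + 1 * q G (\<lambda>x. \<Sum>i\<in>S. k i * f i x) g"
    by (intro q_linear H1_sum assms(3)) auto
  with insert show ?case by simp
qed

end

context graph_measure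
begin

text \<open>A trace estimate: for orthonormal eigenfunctions \<open>f c\<close> with eigenvalues \<open>c \<le> K\<close> the function
  \<open>\<Sum>c. f c z * f c\<close> has mean zero and energy at most \<open>K * (\<Sum>c. (f c z)\<^sup>2)\<close>, which bounds its value
  \<open>\<Sum>c. (f c z)\<^sup>2\<close> at \<open>z\<close>. It shows that the infimum in \<^const>\<open>eigval\<close> is attained.\<close>

lemma card_eigenvalues_le:
  assumes S: "finite S" "S \<subseteq> {0<..K}" "0 \<le> K"
    and f: "\<And>c. c \<in> S \<Longrightarrow> f c \<in> eigenspace G \<mu> c" "\<And>c. c \<in> S \<Longrightarrow> \<not> (AE x in \<mu>. f c x = 0)"
  shows "real (card S) \<le> diam G (resistance G) * K"
proof -
  obtain D where D: "D = diam G (resistance G)" "0 < D"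
    "\<And>x y. x \<in> points G \<Longrightarrow> y \<in> points G \<Longrightarrow> resistance G x y \<le> D"
    using resistance_diam by metis
  have H1: "f c \<in> H1 G" if "c \<in> S" for c using eigenspace_H1 f(1) that by blast
  define a where "a c = (LINT x|\<mu>. (f c x)\<^sup>2)" for c
  have a: "0 < a c" if "c \<in> S" for c unfolding a_def by (rule norm_pos[OF H1 f(2)]) (use that in auto)
  define \<kappa> where "\<kappa> z = (\<Sum>c\<in>S. (f c z)\<^sup>2 / a c)" for z
  have \<kappa>0: "0 \<le> \<kappa> z" for z unfolding \<kappa>_def using a by (intro sum_nonneg) (simp add: less_imp_le)
  have bound: "\<kappa> z \<le> D * K" if z: "z \<in> points G" for z
  proof -
    \<comment> \<open>\<open>g\<close> is the reproducing kernel at \<open>z\<close> of the span of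
      the normalised eigenfunctions in \<open>L2 \<mu>\<close>, and \<kappa> is its
      diagonal.\<close>
    define g where "g p = (\<Sum>c\<in>S. f c z / a c * f c p)" for p
    have g: "g \<in> H1 G" unfolding g_def using S(1) H1 by (rule H1_sum)
    have gz: "g z = \<kappa> z" by (simp add: g_def \<kappa>_def power2_eq_square)
    have qfg: "q G (f c) g = c * f c z" if c: "c \<in> S" for c
    proof -
      have "q G (f c) g = (\<Sum>d\<in>S. f d z / a d * q G (f d) (f c))"
        unfolding q_sym[of "f c"] unfolding g_def using S(1) H1 H1[OF c] by (rule q_sum)
      also have "\<dots> = (\<Sum>d\<in>S. if d = c then f c z / a c * q G (f c) (f c) else 0)"
        using eigenspace_orthogonal(2)[OF f(1) f(1)[OF c]] by (intro sum.cong) auto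
      also have "\<dots> = f c z / a c * (c * a c)"
        using c S(1) eigenspace_energy[OF f(1)[OF c]] by (simp add: a_def)
      finally show ?thesis using a[OF c] by simp
    qed
    have g_eq: "g = (\<lambda>p. \<Sum>c\<in>S. f c z / a c * f c p)" by (simp add: g_def fun_eq_iff)
    have "q G (\<lambda>p. \<Sum>c\<in>S. f c z / a c * f c p) g = (\<Sum>c\<in>S. f c z / a c * q G (f c) g)"
      using S(1) H1 g by (rule q_sum)
    then have "q G g g = (\<Sum>c\<in>S. f c z / a c * q G (f c) g)"
      by (simp only: g_eq[symmetric])
    also have "\<dots> = (\<Sum>c\<in>S. c * ((f c z)\<^sup>2 / a c))"
      by (rule sum.cong) (simp_all add: qfg power2_eq_square)
    also have "\<dots> \<le> (\<Sum>c\<in>S. K * ((f c z)\<^sup>2 / a c))"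
      using S(2) a by (intro sum_mono mult_right_mono) (auto simp: less_imp_le)
    finally have energy: "q G g g \<le> K * \<kappa> z" by (simp add: \<kappa>_def sum_distrib_left)
    have "(LINT p|\<mu>. g p) = (\<Sum>c\<in>S. f c z / a c * (LINT p|\<mu>. f c p))"
      unfolding g_def using H1_integrable[OF H1] by (subst Bochner_Integration.integral_sum) auto
    also have "\<dots> = 0"
      using eigenspace_mean_zero[OF f(1)] S(2) by (intro sum.neutral) auto
    finally have mean: "(LINT p|\<mu>. g p) = 0" .
    obtain y where y: "y \<in> points G" "\<And>p. p \<in> points G \<Longrightarrow> g y \<le> g p"
      using H1_attains_extrema[OF g] by metis
    \<comment> \<open>A function of mean zero has a nonpositive minimum, so the oscillation of
      \<open>g\<close> bounds \<open>g z\<close>.\<close>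
    have "g y \<le> (LINT p|\<mu>. g p)"
      by (rule integral_ge_const[OF H1_integrable[OF g]]) (use y in \<open>auto simp: space_eq\<close>)
    then have "\<kappa> z \<le> g z - g y" using mean gz by simp
    then have "(\<kappa> z)\<^sup>2 \<le> (g z - g y)\<^sup>2" using \<kappa>0 by (intro power_mono)
    also have "\<dots> \<le> resistance G z y * q G g g" by (rule resistance_bound[OF g z y(1)])
    also have "\<dots> \<le> D * (K * \<kappa> z)" using D energy z y(1) q_nonneg by (intro mult_mono) auto
    finally have "\<kappa> z * \<kappa> z \<le> D * K * \<kappa> z" by (simp add: power2_eq_square)
    then show ?thesis using \<kappa>0[of z] D(2) S(3) by (cases "\<kappa> z = 0") auto
  qed
  have int: "integrable \<mu> (\<lambda>z. (f c z)\<^sup>2 / a c)" if "c \<in> S" for c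
    using H1_square_integrable[OF H1[OF that]] by simp
  have "(LINT z|\<mu>. \<kappa> z) = (\<Sum>c\<in>S. LINT z|\<mu>. (f c z)\<^sup>2 / a c)"
    unfolding \<kappa>_def using int by (rule Bochner_Integration.integral_sum)
  also have "\<dots> = (\<Sum>c\<in>S. 1)"
  proof (rule sum.cong[OF HOL.refl])
    fix c assume "c \<in> S"
    then show "(LINT z|\<mu>. (f c z)\<^sup>2 / a c) = 1" using a[of c] by (simp add: a_def)
  qed
  finally have "real (card S) = (LINT z|\<mu>. \<kappa> z)" by simp
  also have "\<dots> \<le> D * K"
  proof (rule integral_le_const)
    show "integrable \<mu> \<kappa>" unfolding \<kappa>_def using int by (rule Bochner_Integration.integrable_sum)
    show "AE z in \<mu>. \<kappa> z \<le> D * K" using bound by (intro AE_I2) (simp add: space_eq)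
  qed
  finally show ?thesis by (simp add: D(1))
qed

text \<open>With one eigenfunction for each eigenvalue, the trace estimate bounds the size of all
  finite subsets uniformly.\<close>

lemma finite_eigenvalues:
  assumes "0 \<le> K"
  shows "finite {c \<in> {0<..K}. \<exists>f\<in>eigenspace G \<mu> c. \<not> (AE x in \<mu>. f x = 0)}" (is "finite ?E")
proof -
  have "\<forall>c\<in>?E. \<exists>f. f \<in> eigenspace G \<mu> c \<and> \<not> (AE x in \<mu>. f x = 0)" by blast
  then obtain f where f: "\<forall>c\<in>?E. f c \<in> eigenspace G \<mu> c \<and> \<not> (AE x in \<mu>. f c x = 0)"
    by (rule bchoice[THEN exE])
  have "finite ?E \<and> card ?E \<le> nat \<lfloor>diam G (resistance G) * K\<rfloor>"
  proof (rule finite_if_finite_subsets_card_bdd)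
    fix S assume S: "S \<subseteq> ?E" "finite S"
    have "real (card S) \<le> diam G (resistance G) * K"
      using S f by (intro card_eigenvalues_le[where f=f] assms) blast+
    then show "card S \<le> nat \<lfloor>diam G (resistance G) * K\<rfloor>" by linarith
  qed
  then show ?thesis by blast
qed

lemma eigval_lower_bound: "ereal (4 / diam G (resistance G)) \<le> eigval G \<mu> 1"
proof -
  have "4 / diam G (resistance G) \<le> t"
    if asm: "finite \<Lambda>" "\<Lambda> \<subseteq> {..t}" "enat 1 < (\<Sum>c\<in>\<Lambda>. L2_dim \<mu> (eigenspace G \<mu> c))" for t \<Lambda>
  proof -
    obtain c f where "c \<in> \<Lambda>" "c > 0" "f \<in> eigenspace G \<mu> c" "\<not> (AE x in \<mu>. f x = 0)"
      using second_eigenvalue[OF asm(1,3)] .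
    then have "4 / diam G (resistance G) \<le> c" "c \<le> t"
      using eigenvalue_lower_bound asm(2) by auto
    then show ?thesis by simp
  qed
  then show ?thesis
    by (auto simp: eigval_def simp del: One_nat_def intro!: Inf_greatest)
qed

text \<open>The infimum of thresholds is turned into an eigenvalue: among the finitely many positive
  eigenvalues up to a cut-off, the least one, \<open>m\<close>, bounds every threshold from below.
  So \<open>m\<close> is at most the infimum \<open>4 / ?D\<close>, and
  \<open>eigenvalue_lower_bound\<close> gives equality.\<close>

lemma eigval_attained:
  assumes "eigval G \<mu> 1 = ereal (4 / diam G (resistance G))"
  obtains f where "f \<in> eigenspace G \<mu> (4 / diam G (resistance G))" "\<not> (AE x in \<mu>. f x = 0)"
proof -
  let ?D = "diam G (resistance G)"
  have D: "0 < ?D" using resistance_diam by metis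
  let ?A = "{ereal t | t. \<exists>\<Lambda>. finite \<Lambda> \<and> \<Lambda> \<subseteq> {..t} \<and>
      enat 1 < (\<Sum>c\<in>\<Lambda>. L2_dim \<mu> (eigenspace G \<mu> c))}"
  \<comment> \<open>Any cut-off strictly above the infimum would do; twice the infimum guarantees a
    threshold below the cut-off.\<close>
  let ?E = "{c \<in> {0<..8 / ?D}. \<exists>f\<in>eigenspace G \<mu> c. \<not> (AE x in \<mu>. f x = 0)}"
  have Inf: "Inf ?A = ereal (4 / ?D)"
    using assms by (simp add: eigval_def split: if_splits del: One_nat_def)
  have E: "finite ?E" using D by (intro finite_eigenvalues) simp
  have below: "\<exists>c\<in>?E. c \<le> t" if asm: "ereal t \<in> ?A" "t \<le> 8 / ?D" for t
  proof -
    obtain \<Lambda> where \<Lambda>: "finite \<Lambda>" "\<Lambda> \<subseteq> {..t}" "enat 1 < (\<Sum>c\<in>\<Lambda>. L2_dim \<mu> (eigenspace G \<mu> c))"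
      using asm(1) by (auto simp del: One_nat_def)
    obtain c f where "c \<in> \<Lambda>" "c > 0" "f \<in> eigenspace G \<mu> c" "\<not> (AE x in \<mu>. f x = 0)"
      using second_eigenvalue[OF \<Lambda>(1,3)] .
    with \<Lambda>(2) asm(2) show ?thesis by (intro bexI[of _ c]) auto
  qed
  have "Inf ?A < ereal (8 / ?D)" unfolding Inf using D by (simp add: divide_strict_right_mono)
  then obtain z where z: "z \<in> ?A" "z < ereal (8 / ?D)" unfolding Inf_less_iff by blast
  then obtain t where "z = ereal t" by blast
  with z have "ereal t \<in> ?A" "t < 8 / ?D" by (auto simp del: One_nat_def)
  then have ne: "?E \<noteq> {}" using below[of t] by auto
  define m where "m = Min ?E"
  have m_in: "m \<in> ?E" and m_le: "\<And>c. c \<in> ?E \<Longrightarrow> m \<le> c"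
    unfolding m_def using Min_in[OF E ne] Min_le[OF E] by blast+
  have m: "0 < m" "m \<le> 8 / ?D" using m_in by simp_all
  have m_lower: "m \<le> t" if t: "ereal t \<in> ?A" for t
  proof (cases "t \<le> 8 / ?D")
    case True
    then obtain c where "c \<in> ?E" "c \<le> t" using below[OF t] by blast
    then show ?thesis using m_le order_trans by blast
  qed (use m in simp)
  have "ereal m \<le> Inf ?A"
  proof (rule Inf_greatest)
    fix z assume z: "z \<in> ?A"
    then obtain t where t: "z = ereal t" by blast
    from m_lower[OF z[unfolded t]] show "ereal m \<le> z" by (simp add: t)
  qed
  then have "m \<le> 4 / ?D" unfolding Inf by simp
  obtain f where f: "f \<in> eigenspace G \<mu> m" "\<not> (AE x in \<mu>. f x = 0)"
    using m_in by blast
  from eigenvalue_lower_bound[OF f m(1)] \<open>m \<le> 4 / ?D\<close> have "m = 4 / ?D" by simp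
  with that f show thesis by simp
qed

end

section \<open>Two-point measures\<close>

context metric_graph
begin

text \<open>\<open>measure_of\<close> returns the given set function only if it is countably
  additive, which is what has to be verified.\<close>

lemma emeasure_half_dirac:
  assumes "x \<in> points G" "y \<in> points G" "A \<in> sets (graph_borel G)"
  shows "emeasure (half_dirac G x y) A = ennreal (1/2) * indicator A x + ennreal (1/2) * indicator A y"
proof -
  let ?B = "graph_borel G"
  let ?m = "\<lambda>A. ennreal (1/2) * emeasure (return ?B x) A + ennreal (1/2) * emeasure (return ?B y) A"
  have "emeasure (half_dirac G x y) A = ?m A"
  proof (rule emeasure_measure_of[OF half_dirac_def])
    show "sets ?B \<subseteq> Pow (points G)"
      using sets.space_closed[of ?B] by (simp add: space_graph_borel)
    have [simp]: "sets (half_dirac G x y) = sets ?B"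
      unfolding half_dirac_def space_graph_borel[symmetric] by (rule sets.sets_measure_of_eq)
    show "A \<in> sets (half_dirac G x y)" using assms(3) by simp
    show "positive (sets (half_dirac G x y)) ?m" by (simp add: positive_def)
    show "countably_additive (sets (half_dirac G x y)) ?m"
    proof (rule countably_additiveI)
      fix F :: "nat \<Rightarrow> ('v, 'e) point set"
      assume F: "range F \<subseteq> sets (half_dirac G x y)" "disjoint_family F"
      have sum: "(\<Sum>i. emeasure (return ?B z) (F i)) = emeasure (return ?B z) (\<Union>i. F i)" for z
        using F by (intro suminf_emeasure) auto
      have "(\<Sum>i. ?m (F i)) = (\<Sum>i. ennreal (1/2) * emeasure (return ?B x) (F i)) +
          (\<Sum>i. ennreal (1/2) * emeasure (return ?B y) (F i))"
        by (rule suminf_add[symmetric]) auto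
      then show "(\<Sum>i. ?m (F i)) = ?m (\<Union>i. F i)"
        by (simp only: ennreal_suminf_cmult sum)
    qed
  qed
  then show ?thesis using assms(3) by simp
qed

lemma sets_half_dirac: "sets (half_dirac G x y) = sets (graph_borel G)"
  unfolding half_dirac_def space_graph_borel[symmetric] by (rule sets.sets_measure_of_eq)

lemma borel_prob_half_dirac:
  assumes "x \<in> points G" "y \<in> points G"
  shows "borel_prob G (half_dirac G x y)"
proof -
  have "space (half_dirac G x y) = points G"
    using sets_eq_imp_space_eq[OF sets_half_dirac] by (simp add: space_graph_borel)
  then have "emeasure (half_dirac G x y) (space (half_dirac G x y)) = ennreal (1/2) + ennreal (1/2)"
    using emeasure_half_dirac[OF assms, of "points G"] sets.top[of "graph_borel G"] assms
    by (simp add: space_graph_borel)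
  also have "\<dots> = ennreal (1/2 + 1/2)" by (rule ennreal_plus[symmetric]) auto
  also have "\<dots> = 1" by simp
  finally show ?thesis
    by (simp add: borel_prob_def sets_half_dirac prob_spaceI)
qed

text \<open>Two atoms of mass \<open>1/2\<close> exhaust a probability measure, so the measure of a
  set depends only on which of the two points it contains.\<close>

lemma eq_half_dirac_iff:
  assumes "borel_prob G \<mu>" "x \<in> points G" "y \<in> points G" "x \<noteq> y"
  shows "\<mu> = half_dirac G x y \<longleftrightarrow> measure \<mu> {x} = 1/2 \<and> measure \<mu> {y} = 1/2"
proof
  assume "\<mu> = half_dirac G x y"
  then have "emeasure \<mu> {x} = ennreal (1/2)" "emeasure \<mu> {y} = ennreal (1/2)"
    using emeasure_half_dirac[OF assms(2,3) singleton_in_graph_borel] assms by simp_all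
  then show "measure \<mu> {x} = 1/2 \<and> measure \<mu> {y} = 1/2"
    by (intro conjI measure_eq_emeasure_eq_ennreal) simp_all
next
  assume m: "measure \<mu> {x} = 1/2 \<and> measure \<mu> {y} = 1/2"
  interpret graph_measure G \<mu> by unfold_locales (rule assms(1))
  have xy: "{x} \<in> sets \<mu>" "{y} \<in> sets \<mu>" using singleton_sets assms by auto
  have "prob ({x} \<union> {y}) = 1" using finite_measure_Union[OF xy] m assms(4) by simp
  then have AE: "AE z in \<mu>. z \<in> {x} \<union> {y}" by (subst (asm) prob_eq_1[OF sets.Un[OF xy]])
  show "\<mu> = half_dirac G x y"
  proof (rule measure_eqI)
    show "sets \<mu> = sets (half_dirac G x y)" by (simp add: sets_eq sets_half_dirac)
    fix A assume A: "A \<in> sets \<mu>"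
    have "prob A = prob ((A \<inter> {x}) \<union> (A \<inter> {y}))"
      using AE A xy by (intro finite_measure_eq_AE) auto
    also have "\<dots> = prob (A \<inter> {x}) + prob (A \<inter> {y})"
      using A xy assms(4) by (intro finite_measure_Union) auto
    also have "\<dots> = 1/2 * indicator A x + 1/2 * indicator A y"
      using m by (auto split: split_indicator)
    finally have "emeasure \<mu> A = ennreal (1/2 * indicator A x + 1/2 * indicator A y)"
      by (simp add: emeasure_eq_measure)
    also have "\<dots> = ennreal (1/2) * indicator A x + ennreal (1/2) * indicator A y"
      by (subst ennreal_plus) (auto split: split_indicator)
    finally show "emeasure \<mu> A = emeasure (half_dirac G x y) A"
      using emeasure_half_dirac[OF assms(2,3)] A by (simp add: sets_eq)
  qed
qed

lemma eigval_half_dirac: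
  assumes xy: "x \<in> points G" "y \<in> points G" "resistance G x y = diam G (resistance G)"
  shows "eigval G (half_dirac G x y) 1 = ereal (4 / diam G (resistance G))"
proof -
  let ?\<mu> = "half_dirac G x y"
  define D where "D = diam G (resistance G)"
  have D: "0 < D" using resistance_diam D_def by metis
  obtain h where h: "potential x y h" using potential_exists[OF xy(1,2)] .
  have ne: "x \<noteq> y"
    using resistance_eq[OF h] D xy(3) by (auto simp: D_def)
  interpret graph_measure G ?\<mu> by unfold_locales (rule borel_prob_half_dirac[OF xy(1,2)])
  have m: "measure ?\<mu> {x} = 1/2" "measure ?\<mu> {y} = 1/2"
    using eq_half_dirac_iff[OF borel_prob_half_dirac[OF xy(1,2)] xy(1,2) ne] by auto
  have meas: "{x} \<in> sets ?\<mu>" "{y} \<in> sets ?\<mu>" using singleton_sets xy by auto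
  \<comment> \<open>Both atoms have positive mass, so no null set contains either of them.\<close>
  have AE: "P x \<and> P y" if P: "AE z in ?\<mu>. P z" for P
  proof -
    obtain N where N: "\<And>z. z \<in> space ?\<mu> - N \<Longrightarrow> P z" "N \<in> null_sets ?\<mu>" using AE_E3[OF P] by metis
    then have "emeasure ?\<mu> N = 0" "N \<in> sets (graph_borel G)" by (auto simp: sets_eq)
    then have "x \<notin> N" "y \<notin> N"
      using emeasure_half_dirac[OF xy(1,2), of N] by (auto split: split_indicator_asm)
    with N(1) xy show ?thesis by (auto simp: space_eq)
  qed
  have "prob ({x} \<union> {y}) = 1" using finite_measure_Union[OF meas] m ne by simp
  then have AE_xy: "AE z in ?\<mu>. z \<in> {x} \<union> {y}" by (subst (asm) prob_eq_1[OF sets.Un[OF meas]])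
  have LINT: "(LINT z|?\<mu>. F z) = (F x + F y) / 2" if F: "F \<in> borel_measurable ?\<mu>" for F :: "_ \<Rightarrow> real"
  proof -
    have int: "integrable ?\<mu> (\<lambda>z. k * indicator {p} z :: real)" if "{p} \<in> sets ?\<mu>" for k p
      using that by (intro integrable_mult_right integrable_real_indicator) (auto simp: emeasure_eq_measure)
    have "(LINT z|?\<mu>. F z) = (LINT z|?\<mu>. F x * indicator {x} z + F y * indicator {y} z)"
      by (rule integral_cong_AE)
        (use F meas AE_xy ne in \<open>auto elim!: eventually_mono split: split_indicator\<close>)
    also have "\<dots> = F x * measure ?\<mu> {x} + F y * measure ?\<mu> {y}"
      using int[OF meas(1)] int[OF meas(2)] by (subst Bochner_Integration.integral_add) (auto simp: xy space_eq)
    finally show ?thesis using m by simp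
  qed
  \<comment> \<open>The shift gives the values \<open>D / 2\<close> and \<open>- D / 2\<close> at
    the atoms; then the integral of \<open>4 / D * f z * g z\<close> is exactly
    \<open>g x - g y\<close>.\<close>
  define f where "f z = h z - (h y + D / 2)" for z
  have pot: "potential x y f" unfolding f_def by (rule potential_shift[OF h])
  have fx: "f x = D / 2" "f y = - D / 2"
    using resistance_eq[OF h] xy(3) by (auto simp: f_def D_def field_simps)
  have f: "f \<in> H1 G" using pot by (simp add: potential_def)
  have supp: "x \<in> supp G ?\<mu>" "y \<in> supp G ?\<mu>"
    unfolding supp_def using xy open_in_graph_borel emeasure_half_dirac[OF xy(1,2)]
    by (auto simp: zero_less_iff_neq_zero)
  \<comment> \<open>Test functions that vanish on the support vanish at \<open>x\<close> and
    \<open>y\<close>, so they pair to zero with the potential.\<close>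
  have f_mu: "f \<in> H1_mu G ?\<mu>"
    using f pot supp xy by (auto simp: H1_mu_def harmonic_on_def potential_def)
  have q: "q G f g = (LINT z|?\<mu>. 4 / D * f z * g z)" if "g \<in> H1 G" for g
  proof -
    have "(LINT z|?\<mu>. 4 / D * f z * g z) = g x - g y"
      using H1_measurable[OF f] H1_measurable[OF that] D by (subst LINT) (auto simp: fx field_simps)
    then show ?thesis using pot that by (simp add: potential_def)
  qed
  have ef: "f \<in> eigenspace G ?\<mu> (4 / D)"
    unfolding eigenspace_def H_op_def mem_Collect_eq
    by (intro conjI ballI L2_cmult H1_in_L2 f f_mu q) (simp add: H1_mu_def)
  have e0: "(\<lambda>z. 1) \<in> eigenspace G ?\<mu> 0"
    using const_in_H1_mu[of 1] H1_in_L2[OF const_in_H1[of 0]]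
    by (auto simp: eigenspace_def H_op_def H1_mu_def q_const)
  have "enat 2 \<le> L2_dim ?\<mu> (L2 ?\<mu>)"
  proof (rule two_le_L2_dim)
    show "(\<lambda>z. 1) \<in> L2 ?\<mu>" "f \<in> L2 ?\<mu>" using H1_in_L2 const_in_H1 f by auto
    fix a b assume "AE z in ?\<mu>. a * 1 + b * f z = 0"
    from AE[OF this] have "a + b * (D / 2) = 0" "a - b * (D / 2) = 0" by (auto simp: fx)
    then have "a = 0" "b * (D / 2) = 0" by linarith+
    then show "a = 0 \<and> b = 0" using D by simp
  qed
  then have dim: "\<not> L2_dim ?\<mu> (L2 ?\<mu>) \<le> enat 1"
    using order_trans[of "enat 2" _ "enat 1"] by auto
  have nf: "\<not> (AE z in ?\<mu>. f z = 0)"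
  proof
    assume "AE z in ?\<mu>. f z = 0"
    from AE[OF this] D show False by (simp add: fx)
  qed
  \<comment> \<open>The eigenvalues 0 and \<open>4 / D\<close> already account for multiplicity 2,
    so \<open>4 / D\<close> is an admissible threshold.\<close>
  have "1 + 1 \<le> L2_dim ?\<mu> (eigenspace G ?\<mu> 0) + L2_dim ?\<mu> (eigenspace G ?\<mu> (4 / D))"
    by (intro add_mono one_le_L2_dim[OF e0] one_le_L2_dim[OF ef nf]) simp
  also have "\<dots> = (\<Sum>c\<in>{0, 4 / D}. L2_dim ?\<mu> (eigenspace G ?\<mu> c))"
    using D by simp
  finally have "enat 1 < (\<Sum>c\<in>{0, 4 / D}. L2_dim ?\<mu> (eigenspace G ?\<mu> c))"
    by (rule order.strict_trans2[rotated]) (simp add: one_enat_def)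
  then have "\<exists>\<Lambda>. finite \<Lambda> \<and> \<Lambda> \<subseteq> {..4 / D} \<and> enat 1 < (\<Sum>c\<in>\<Lambda>. L2_dim ?\<mu> (eigenspace G ?\<mu> c))"
    using D by (intro exI[of _ "{0, 4 / D}"]) simp
  then have "eigval G ?\<mu> 1 \<le> ereal (4 / D)"
    using dim by (auto simp: eigval_def simp del: One_nat_def intro!: Inf_lower)
  then show ?thesis using eigval_lower_bound by (simp add: D_def antisym)
qed

lemma eigval_min_1: "eigval_min G 1 = ereal (4 / diam G (resistance G))"
  unfolding eigval_min_def
proof (rule Least_equality)
  obtain x y where "x \<in> points G" "y \<in> points G" "resistance G x y = diam G (resistance G)"
    using resistance_diam by metis
  then show "\<exists>\<mu>. borel_prob G \<mu> \<and> ereal (4 / diam G (resistance G)) = eigval G \<mu> 1"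
    by (intro exI[of _ "half_dirac G x y"]) (simp add: borel_prob_half_dirac eigval_half_dirac del: One_nat_def)
  fix v assume "\<exists>\<mu>. borel_prob G \<mu> \<and> v = eigval G \<mu> 1"
  then obtain \<mu> where \<mu>: "borel_prob G \<mu>" "v = eigval G \<mu> 1" by blast
  interpret graph_measure G \<mu> by unfold_locales (rule \<mu>(1))
  show "ereal (4 / diam G (resistance G)) \<le> v" using eigval_lower_bound \<mu>(2) by simp
qed

lemma minimizer_iff:
  "borel_prob G \<mu> \<and> eigval G \<mu> 1 = eigval_min G 1 \<longleftrightarrow>
    (\<exists>x\<in>points G. \<exists>y\<in>points G. resistance G x y = diam G (resistance G) \<and> \<mu> = half_dirac G x y)"
proof
  assume \<mu>: "borel_prob G \<mu> \<and> eigval G \<mu> 1 = eigval_min G 1"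
  interpret graph_measure G \<mu> by unfold_locales (use \<mu> in blast)
  obtain f where f: "f \<in> eigenspace G \<mu> (4 / diam G (resistance G))" "\<not> (AE x in \<mu>. f x = 0)"
    using eigval_attained \<mu> by (metis eigval_min_1)
  obtain x y where xy: "x \<in> points G" "y \<in> points G" "resistance G x y = diam G (resistance G)"
    "measure \<mu> {x} = 1 / 2" "measure \<mu> {y} = 1 / 2"
    using extremal_eigenfunction[OF f] .
  have "x \<noteq> y"
  proof
    assume "x = y"
    obtain h where "potential x y h" using potential_exists[OF xy(1,2)] .
    with \<open>x = y\<close> have "resistance G x y = 0" by (simp add: resistance_eq)
    moreover have "0 < diam G (resistance G)" using resistance_diam by metis
    ultimately show False using xy(3) by simp
  qed
  then have "\<mu> = half_dirac G x y"
    using eq_half_dirac_iff[of \<mu> x y] \<mu> xy by blast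
  with xy show "\<exists>x\<in>points G. \<exists>y\<in>points G. resistance G x y = diam G (resistance G) \<and> \<mu> = half_dirac G x y"
    by blast
next
  assume "\<exists>x\<in>points G. \<exists>y\<in>points G. resistance G x y = diam G (resistance G) \<and> \<mu> = half_dirac G x y"
  then show "borel_prob G \<mu> \<and> eigval G \<mu> 1 = eigval_min G 1"
    by (auto simp: borel_prob_half_dirac eigval_half_dirac eigval_min_1 simp del: One_nat_def)
qed

end

section \<open>Trees\<close>

definition adjacent_avoiding :: "('v, 'e) mgraph \<Rightarrow> 'e \<Rightarrow> ('v \<times> 'v) set" where
  "adjacent_avoiding G e = {(u, v). \<exists>e'. e' \<noteq> e \<and> joins G e' u v}"

text \<open>Loop erasure: if the next vertex has been visited, the path is cut back to it. Distinct
  vertices are what closing up to a cycle requires.\<close>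

lemma simple_path_avoiding:
  assumes "(u, v) \<in> (adjacent_avoiding G e)\<^sup>*"
  shows "\<exists>vs es. distinct vs \<and> length vs = Suc (length es) \<and> vs ! 0 = u \<and> vs ! length es = v \<and>
    (\<forall>i<length es. es ! i \<noteq> e \<and> joins G (es ! i) (vs ! i) (vs ! Suc i))"
  using assms
proof (induction rule: rtrancl_induct)
  case base
  show ?case by (intro exI[of _ "[u]"] exI[of _ "[]"]) simp
next
  case (step y z)
  then obtain e' where e': "e' \<noteq> e" "joins G e' y z" by (auto simp: adjacent_avoiding_def)
  obtain vs es where p: "distinct vs" "length vs = Suc (length es)" "vs ! 0 = u" "vs ! length es = y"
    "\<And>i. i < length es \<Longrightarrow> es ! i \<noteq> e \<and> joins G (es ! i) (vs ! i) (vs ! Suc i)"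
    using step.IH by blast
  show ?case
  proof (cases "z \<in> set vs")
    case True
    then obtain k where k: "k < length vs" "vs ! k = z" by (auto simp: in_set_conv_nth)
    have "min k (length es) = k" "min (Suc k) (length vs) = Suc k" using k(1) p(2) by auto
    then show ?thesis
      by (intro exI[of _ "take (Suc k) vs"] exI[of _ "take k es"]) (use k p in simp)
  next
    case False
    show ?thesis
    proof (intro exI[of _ "vs @ [z]"] exI[of _ "es @ [e']"] conjI allI impI)
      fix i assume i: "i < length (es @ [e'])"
      have "(es @ [e']) ! i \<noteq> e \<and> joins G ((es @ [e']) ! i) ((vs @ [z]) ! i) ((vs @ [z]) ! Suc i)"
      proof (cases "i < length es")
        case True
        then show ?thesis using p(2) p(5)[OF True] by (simp add: nth_append)
      next
        case False
        then have "i = length es" using i by simp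
        then show ?thesis using p(2,4) e' by (simp add: nth_append)
      qed
      then show "(es @ [e']) ! i \<noteq> e" "joins G ((es @ [e']) ! i) ((vs @ [z]) ! i) ((vs @ [z]) ! Suc i)"
        by blast+
    qed (use p False in \<open>auto simp: nth_append\<close>)
  qed
qed

locale tree_graph = metric_graph +
  assumes no_cycle: "\<not> is_cycle G vs es"
begin

text \<open>A detour around \<open>e\<close>, closed by \<open>e\<close>, would be a cycle. For a
  loop the detour is the trivial path, and the cycle is \<open>e\<close> alone.\<close>

lemma edge_is_bridge:
  assumes e: "e \<in> edges G"
  shows "(src G e, tgt G e) \<notin> (adjacent_avoiding G e)\<^sup>*"
proof
  assume detour: "(src G e, tgt G e) \<in> (adjacent_avoiding G e)\<^sup>*"
  obtain vs es where p: "distinct vs" "length vs = Suc (length es)" "vs ! 0 = src G e"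
    "vs ! length es = tgt G e"
    "\<And>i. i < length es \<Longrightarrow> es ! i \<noteq> e \<and> joins G (es ! i) (vs ! i) (vs ! Suc i)"
    using simple_path_avoiding[OF detour] by blast
  \<comment> \<open>A repeated edge would have the same ends at both positions and so repeat a
    vertex of the path.\<close>
  have "es ! i \<noteq> es ! j" if ij: "i < j" "j < length es" for i j
  proof
    assume "es ! i = es ! j"
    then have "{vs ! i, vs ! Suc i} = {vs ! j, vs ! Suc j}"
      using p(5)[of i] p(5)[of j] ij by (auto simp: joins_def)
    then have "vs ! i = vs ! j \<or> vs ! i = vs ! Suc j" by blast
    then show False using p(1,2) ij by (auto simp: nth_eq_iff_index_eq)
  qed
  then have "distinct es"
    by (metis distinct_conv_nth linorder_neqE_nat)
  moreover have "e \<notin> set es" using p(5) by (auto simp: in_set_conv_nth)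
  moreover have "joins G ((es @ [e]) ! i) (vs ! i) (vs ! (Suc i mod length (es @ [e])))"
    if "i < length (es @ [e])" for i
  proof (cases "i < length es")
    case True
    then show ?thesis using p(5)[of i] by (simp add: nth_append)
  next
    case False
    then have "i = length es" using that by simp
    then show ?thesis using p(3,4) e by (auto simp: joins_def)
  qed
  ultimately have "is_cycle G vs (es @ [e])"
    using p(1,2) by (simp add: is_cycle_def)
  then show False using no_cycle by blast
qed

section \<open>Cut functions as explicit potentials on a tree\<close>

definition src_side :: "'b \<Rightarrow> 'a \<Rightarrow> bool" where
  "src_side e v \<longleftrightarrow> (src G e, v) \<in> (adjacent_avoiding G e)\<^sup>*"

lemma src_side_src: "src_side e (src G e)"
  by (simp add: src_side_def)

lemma not_src_side_tgt: "e \<in> edges G \<Longrightarrow> \<not> src_side e (tgt G e)"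
  by (simp add: src_side_def edge_is_bridge)

lemma src_side_edge:
  assumes "e' \<in> edges G" "e' \<noteq> e"
  shows "src_side e (tgt G e') \<longleftrightarrow> src_side e (src G e')"
proof -
  have "(src G e', tgt G e') \<in> adjacent_avoiding G e" "(tgt G e', src G e') \<in> adjacent_avoiding G e"
    using assms by (auto simp: adjacent_avoiding_def joins_def)
  then show ?thesis unfolding src_side_def by (meson rtrancl.rtrancl_into_rtrancl)
qed

text \<open>The function with slope \<open>1\<close> on the segment of \<open>e\<close> from \<open>s\<close> to \<open>t\<close> and slope \<open>0\<close> elsewhere. It is
  well defined on the glued space because removing \<open>e\<close> disconnects the tree.\<close>

definition cut_fun :: "'b \<Rightarrow> real \<Rightarrow> real \<Rightarrow> ('a, 'b) point \<Rightarrow> real" where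
  "cut_fun e s t x = (case x of Vertex v \<Rightarrow> if src_side e v then 0 else t - s
     | Inner e' p \<Rightarrow> if e' = e then min p t - min p s else if src_side e (src G e') then 0 else t - s)"

lemma cut_fun_edge:
  assumes "e \<in> edges G" "0 \<le> s" "s \<le> t" "t \<le> len G e" "p \<in> {0..len G e}"
  shows "cut_fun e s t (edge_pt G e p) = min p t - min p s"
  using assms src_side_src[of e] not_src_side_tgt[OF assms(1)]
  by (auto simp: edge_pt_def cut_fun_def)

lemma cut_fun_bounds: "s \<le> t \<Longrightarrow> 0 \<le> cut_fun e s t x \<and> cut_fun e s t x \<le> t - s"
  by (auto simp: cut_fun_def split: point.split)

lemma potential_cut_fun:
  assumes e: "e \<in> edges G" and st: "0 \<le> s" "s \<le> t" "t \<le> len G e"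
  shows "potential (edge_pt G e t) (edge_pt G e s) (cut_fun e s t)"
proof -
  have eq: "cut_fun e s t (edge_pt G e' p) = (if e' = e then 0 else if src_side e (src G e') then 0 else t - s) +
      (if e' = e then 1 else 0) * min p (if e' = e then t else 0) +
      (if e' = e then - 1 else 0) * min p (if e' = e then s else 0)"
    if "e' \<in> edges G" "p \<in> {0..len G e'}" for e' p
  proof (cases "e' = e")
    case True
    then show ?thesis using cut_fun_edge[OF e st, of p] that by simp
  next
    case False
    then show ?thesis using src_side_edge[OF that(1) False] by (auto simp: cut_fun_def edge_pt_def)
  qed
  have "cut_fun e s t \<in> H1 G"
    by (rule piecewise_affine_in_H1(1)[OF eq]) (use st len_nonneg in auto)
  moreover have "q G (cut_fun e s t) g = g (edge_pt G e t) - g (edge_pt G e s)" if g: "g \<in> H1 G" for g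
  proof -
    have "q G (cut_fun e s t) g = (\<Sum>e'\<in>edges G. if e' = e then g (edge_pt G e t) - g (edge_pt G e s) else 0)"
      by (subst piecewise_affine_in_H1(2)[OF eq _ _ g]) (use st len_nonneg in \<open>auto intro!: sum.cong\<close>)
    then show ?thesis using e finite_edges by simp
  qed
  ultimately show ?thesis by (simp add: potential_def)
qed

text \<open>Reciprocity: the pairing of \<open>h\<close> with the cut function can be evaluated
  through either potential. Slopes of arbitrary potentials are thus read off from cut
  functions.\<close>

lemma potential_increment:
  assumes "e \<in> edges G" "0 \<le> s" "s \<le> t" "t \<le> len G e" "potential x y h"
  shows "h (edge_pt G e t) - h (edge_pt G e s) = cut_fun e s t x - cut_fun e s t y"
  using potential_cut_fun[OF assms(1-4)] assms(5) by (auto simp: potential_def q_sym[of h])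

lemma potential_Lipschitz:
  assumes h: "potential x y h" and e: "e \<in> edges G" "s \<in> {0..len G e}" "t \<in> {0..len G e}"
  shows "\<bar>h (edge_pt G e t) - h (edge_pt G e s)\<bar> \<le> \<bar>t - s\<bar>"
proof -
  have "\<bar>h (edge_pt G e t) - h (edge_pt G e s)\<bar> \<le> t - s" if "0 \<le> s" "s \<le> t" "t \<le> len G e" for s t
    unfolding potential_increment[OF e(1) that h]
    using cut_fun_bounds[OF that(2), of e x] cut_fun_bounds[OF that(2), of e y] by linarith
  from this[of s t] this[of t s] e show ?thesis by (cases "s \<le> t") auto
qed

text \<open>The resistance is an increment of the potential, and the Lipschitz bound adds up along
  the segments of the path.\<close>

lemma resistance_le_path_length:
  assumes "path_length G x y L" "x \<in> points G" "y \<in> points G"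
  shows "resistance G x y \<le> L"
proof -
  obtain h where h: "potential x y h" using potential_exists[OF assms(2,3)] .
  have "\<bar>h z - h x\<bar> \<le> L" if "path_length G x z L" for z L
    using that
  proof (induction rule: path_length.induct)
    case (step e s L t)
    with potential_Lipschitz[OF h step.hyps(2-4)] show ?case by linarith
  qed simp
  from this[OF assms(1)] resistance_eq[OF h] show ?thesis by linarith
qed

section \<open>Paths whose length is the resistance\<close>

lemma resistance_same_edge:
  assumes "e \<in> edges G" "s \<in> {0..len G e}" "t \<in> {0..len G e}"
  shows "resistance G (edge_pt G e s) (edge_pt G e t) = \<bar>t - s\<bar>"
proof -
  have "resistance G (edge_pt G e t) (edge_pt G e s) = t - s" if "0 \<le> s" "s \<le> t" "t \<le> len G e" for s t
    using resistance_eq[OF potential_cut_fun[OF assms(1) that]] assms(1) that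
    by (simp add: cut_fun_edge)
  from this[of s t] this[of t s] resistance_sym[of "edge_pt G e s" "edge_pt G e t"] assms show ?thesis
    by (cases "s \<le> t") (auto simp: edge_pt_in_points)
qed

lemma path_same_edge:
  assumes "e \<in> edges G" "s \<in> {0..len G e}" "t \<in> {0..len G e}"
  shows "path_length G (edge_pt G e s) (edge_pt G e t) (resistance G (edge_pt G e s) (edge_pt G e t))"
  using path_length.step[OF path_length.refl[OF edge_pt_in_points[OF assms(1)]] assms]
  by (simp add: resistance_same_edge[OF assms])

text \<open>Off the edge only \<open>src_side\<close> decides the value, so one of the two
  alternatives holds for all segments at once.\<close>

lemma cut_fun_outside:
  assumes "\<And>p. x \<noteq> Inner e p"
  shows "cut_fun e s t x = 0 \<and> (\<forall>s t. cut_fun e s t x = 0) \<or> cut_fun e s t x = t - s \<and> (\<forall>s t. cut_fun e s t x = t - s)"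
  using assms by (auto simp: cut_fun_def split: point.split)

text \<open>The condition on \<^const>\<open>cut_fun\<close> says that \<open>x\<close> lies on the source side of the edge \<open>e\<close>; in the
  next lemma it lies on the target side.\<close>

lemma resistance_beyond_src:
  assumes x: "x \<in> points G" "\<And>s t. cut_fun e s t x = 0" and e: "e \<in> edges G" and t: "t \<in> {0..len G e}"
  shows "resistance G x (edge_pt G e t) = resistance G x (Vertex (src G e)) + t"
proof -
  obtain h where h: "potential x (edge_pt G e 0) h"
    using potential_exists[OF x(1) edge_pt_in_points[OF e]] .
  have t': "0 \<le> (0::real)" "0 \<le> t" "t \<le> len G e" using t by auto
  note p = potential_cut_fun[OF e t']
  have "resistance G x (edge_pt G e t) = h x - h (edge_pt G e t) + t"
    using resistance_eq[OF potential_add[OF h potential_minus[OF p]]] cut_fun_edge[OF e t' t] x(2) t by simp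
  \<comment> \<open>Both \<open>x\<close> and the source end lie on the same side of the segment, so
    \<open>h\<close> does not change along it.\<close>
  moreover have "h (edge_pt G e t) = h (edge_pt G e 0)"
    using potential_increment[OF e t' h] cut_fun_edge[OF e t', of 0] x(2) len_nonneg[OF e] t by simp
  ultimately show ?thesis using resistance_eq[OF h] by simp
qed

lemma resistance_beyond_tgt:
  assumes x: "x \<in> points G" "\<And>s t. cut_fun e s t x = t - s" and e: "e \<in> edges G" and t: "t \<in> {0..len G e}"
  shows "resistance G x (edge_pt G e t) = resistance G x (Vertex (tgt G e)) + (len G e - t)"
proof -
  obtain h where h: "potential x (edge_pt G e (len G e)) h"
    using potential_exists[OF x(1) edge_pt_in_points[OF e]] .
  have t': "0 \<le> t" "t \<le> len G e" "len G e \<le> len G e" using t by auto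
  note p = potential_cut_fun[OF e t']
  have "resistance G x (edge_pt G e t) = h x - h (edge_pt G e t) + (len G e - t)"
    using resistance_eq[OF potential_add[OF h p]] cut_fun_edge[OF e t' t] x(2) t by simp
  moreover have "h (edge_pt G e t) = h (edge_pt G e (len G e))"
    using potential_increment[OF e t' h] cut_fun_edge[OF e t', of "len G e"] x(2) len_nonneg[OF e] t by simp
  ultimately show ?thesis using resistance_eq[OF h] e by simp
qed

lemma path_through_src:
  assumes "path_length G x (Vertex (src G e)) (resistance G x (Vertex (src G e)))"
    and "x \<in> points G" "\<And>s t. cut_fun e s t x = 0" "e \<in> edges G" "t \<in> {0..len G e}"
  shows "path_length G x (edge_pt G e t) (resistance G x (edge_pt G e t))"
  using path_length.step[of G x e 0 _ t] assms len_nonneg[OF assms(4)]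
  by (simp add: resistance_beyond_src[OF assms(2-5)])

lemma path_through_tgt:
  assumes "path_length G x (Vertex (tgt G e)) (resistance G x (Vertex (tgt G e)))"
    and "x \<in> points G" "\<And>s t. cut_fun e s t x = t - s" "e \<in> edges G" "t \<in> {0..len G e}"
  shows "path_length G x (edge_pt G e t) (resistance G x (edge_pt G e t))"
proof -
  have "path_length G x (edge_pt G e t) (resistance G x (Vertex (tgt G e)) + \<bar>t - len G e\<bar>)"
    using assms(1,4,5) len_nonneg[OF assms(4)] by (intro path_length.step[where s="len G e"]) auto
  then show ?thesis
    using assms(5) by (simp add: resistance_beyond_tgt[OF assms(2-5)] abs_if split: if_splits)
qed

text \<open>The potential of \<open>x\<close> and \<open>w\<close> is not harmonic at \<open>w\<close>, so it has a nonzero slope on some edge at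
  \<open>w\<close>. As this slope is a difference of values of a cut function, \<open>x\<close> lies beyond that edge.\<close>

lemma edge_towards:
  assumes x: "x \<in> points G" and w: "w \<in> verts G" "x \<noteq> Vertex w"
  obtains e where "e \<in> edges G" "w = tgt G e \<and> cut_fun e 0 (len G e) x \<noteq> len G e \<or>
    w = src G e \<and> cut_fun e 0 (len G e) x \<noteq> 0"
proof -
  let ?d = "\<lambda>v. if v = w then 1 else 0 :: real"
  obtain h where h: "potential x (Vertex w) h"
    using potential_exists[of x "Vertex w"] x w by (auto simp: points_def)
  have no_loop: "src G e \<noteq> tgt G e" if "e \<in> edges G" for e
    using src_side_src[of e] not_src_side_tgt[OF that] by auto
  \<comment> \<open>The affine extension of the indicator of \<open>w\<close> equals 1 only at
    \<open>w\<close>; on a loop at \<open>w\<close> it would be constantly 1.\<close>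
  have "affine_ext ?d x \<noteq> 1"
  proof (cases x)
    case (Vertex v)
    then show ?thesis using w(2) by simp
  next
    case (Inner e t)
    then have "e \<in> edges G" "0 < t" "t < len G e" using x by (auto simp: points_def)
    then show ?thesis using no_loop[of e] Inner by (auto simp: field_simps)
  qed
  \<comment> \<open>The pairing equals \<open>affine_ext ?d x - 1\<close>, so some summand of the
    Dirichlet form is nonzero.\<close>
  then have "q G (affine_ext ?d) h \<noteq> 0"
    using h affine_ext_in_H1[of ?d] by (simp add: potential_def q_sym[of "affine_ext ?d"])
  then have "dirichlet ?d (\<lambda>v. h (Vertex v)) \<noteq> 0"
    using h q_affine_ext[of h ?d] by (simp add: potential_def)
  then obtain e where e: "e \<in> edges G"
    "(?d (tgt G e) - ?d (src G e)) * (h (Vertex (tgt G e)) - h (Vertex (src G e))) / len G e \<noteq> 0"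
    unfolding dirichlet_def by (meson sum.neutral)
  then have ends: "w = tgt G e \<or> w = src G e" and ne: "h (Vertex (tgt G e)) - h (Vertex (src G e)) \<noteq> 0"
    by (auto split: if_splits)
  have l: "0 \<le> (0::real)" "0 \<le> len G e" "len G e \<le> len G e" using len_nonneg[OF e(1)] by auto
  have "cut_fun e 0 (len G e) x - cut_fun e 0 (len G e) (Vertex w) \<noteq> 0"
    using potential_increment[OF e(1) l h] ne e(1) by simp
  moreover have "cut_fun e 0 (len G e) (Vertex (tgt G e)) = len G e" "cut_fun e 0 (len G e) (Vertex (src G e)) = 0"
    using src_side_src[of e] not_src_side_tgt[OF e(1)] by (auto simp: cut_fun_def)
  ultimately show thesis using that[OF e(1)] ends by auto
qed

text \<open>Induction on the number of vertices that are strictly closer to \<open>x\<close> in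
  resistance. The edge at \<open>w\<close> towards \<open>x\<close> either contains \<open>x\<close>
  in its interior, or its other end is closer by the length of the edge; the path to that end is
  then extended along the edge.\<close>

lemma geodesic_to_vertex:
  assumes x: "x \<in> points G" and w: "w \<in> verts G"
  shows "path_length G x (Vertex w) (resistance G x (Vertex w))"
  using w
proof (induction w rule: measure_induct_rule[where
      f="\<lambda>w. card {v \<in> verts G. resistance G x (Vertex v) < resistance G x (Vertex w)}"])
  case (less w)
  have closer: "path_length G x (Vertex v) (resistance G x (Vertex v))"
    if v: "v \<in> verts G" "resistance G x (Vertex v) < resistance G x (Vertex w)" for v
  proof (rule less.IH[OF _ v(1)], rule psubset_card_mono)
    show "{u \<in> verts G. resistance G x (Vertex u) < resistance G x (Vertex v)} \<subset>
        {u \<in> verts G. resistance G x (Vertex u) < resistance G x (Vertex w)}"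
      using v by (auto intro: order.strict_trans)
  qed (use finite_verts in auto)
  show ?case
  proof (cases "x = Vertex w")
    case True
    obtain h where h: "potential x x h" using potential_exists[OF x x] .
    show ?thesis using path_length.refl[OF x] resistance_eq[OF h] by (simp add: True)
  next
    case False
    obtain e where e: "e \<in> edges G" "w = tgt G e \<and> cut_fun e 0 (len G e) x \<noteq> len G e \<or>
        w = src G e \<and> cut_fun e 0 (len G e) x \<noteq> 0"
      using edge_towards[OF x less.prems False] .
    have l: "0 \<in> {0..len G e}" "len G e \<in> {0..len G e}" "0 < len G e" using len_pos[OF e(1)] by auto
    show ?thesis
    proof (cases "\<exists>p. x = Inner e p")
      case True
      then obtain p where "x = Inner e p" by blast
      then have p: "p \<in> {0..len G e}" "x = edge_pt G e p"
        using x by (auto simp: points_def)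
      show ?thesis using path_same_edge[OF e(1) p(1) l(1)] path_same_edge[OF e(1) p(1) l(2)] e p(2) by auto
    next
      case False
      then consider "\<And>s t. cut_fun e s t x = 0" | "\<And>s t. cut_fun e s t x = t - s"
        using cut_fun_outside[of x e] by blast
      then show ?thesis
      proof cases
        case 1
        then have w: "w = tgt G e" using e(2) by auto
        have "resistance G x (Vertex w) = resistance G x (Vertex (src G e)) + len G e"
          using resistance_beyond_src[OF x 1 e(1) l(2)] e(1) w by simp
        with closer[of "src G e"] l(3) src_in_verts[OF e(1)]
        have "path_length G x (Vertex (src G e)) (resistance G x (Vertex (src G e)))" by simp
        from path_through_src[OF this x 1 e(1) l(2)] show ?thesis using w e(1) by simp
      next
        case 2
        then have w: "w = src G e" using e(2) by auto
        have "resistance G x (Vertex w) = resistance G x (Vertex (tgt G e)) + len G e"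
          using resistance_beyond_tgt[OF x 2 e(1) l(1)] e(1) w by simp
        with closer[of "tgt G e"] l(3) tgt_in_verts[OF e(1)]
        have "path_length G x (Vertex (tgt G e)) (resistance G x (Vertex (tgt G e)))" by simp
        from path_through_tgt[OF this x 2 e(1) l(1)] show ?thesis using w e(1) by simp
      qed
    qed
  qed
qed

lemma geodesic:
  assumes x: "x \<in> points G" and y: "y \<in> points G"
  shows "path_length G x y (resistance G x y)"
proof -
  obtain e t where t: "e \<in> edges G" "t \<in> {0..len G e}" "y = edge_pt G e t" using pointE[OF y] .
  show ?thesis
  proof (cases "\<exists>p. x = Inner e p")
    case True
    then obtain p where "x = Inner e p" by blast
    then have p: "p \<in> {0..len G e}" "x = edge_pt G e p"
      using x by (auto simp: points_def)
    show ?thesis using path_same_edge[OF t(1) p(1) t(2)] p(2) t(3) by simp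
  next
    case False
    then consider "\<And>s t. cut_fun e s t x = 0" | "\<And>s t. cut_fun e s t x = t - s"
      using cut_fun_outside[of x e] by blast
    then show ?thesis
    proof cases
      case 1
      show ?thesis unfolding t(3)
        by (rule path_through_src[OF geodesic_to_vertex[OF x src_in_verts[OF t(1)]] x 1 t(1,2)])
    next
      case 2
      show ?thesis unfolding t(3)
        by (rule path_through_tgt[OF geodesic_to_vertex[OF x tgt_in_verts[OF t(1)]] x 2 t(1,2)])
    qed
  qed
qed

text \<open>The geodesic attains the resistance and no path is shorter; this also shows that the
  least element in \<open>path_dist\<close> exists.\<close>

lemma path_dist_eq_resistance: "x \<in> points G \<Longrightarrow> y \<in> points G \<Longrightarrow> path_dist G x y = resistance G x y"
  unfolding path_dist_def by (rule Least_equality) (auto intro: geodesic resistance_le_path_length)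

lemma diam_path_dist: "diam G (path_dist G) = diam G (resistance G)"
  unfolding diam_def by (simp add: path_dist_eq_resistance cong: bex_cong)

end

theorem theorem5p9:
  fixes G :: "('v, 'e) mgraph"
  assumes "metric_graph G"
  shows "eigval_min G 1 = ereal (4 / diam G (resistance G)) \<and>
    (\<forall>\<mu>. borel_prob G \<mu> \<and> eigval G \<mu> 1 = eigval_min G 1 \<longleftrightarrow>
         (\<exists>x\<in>points G. \<exists>y\<in>points G.
            resistance G x y = diam G (resistance G) \<and> \<mu> = half_dirac G x y)) \<and>
    (is_tree G \<longrightarrow>
       eigval_min G 1 = ereal (4 / diam G (resistance G)) \<and>
       4 / diam G (resistance G) = 4 / diam G (path_dist G))"
proof -
  interpret metric_graph G by (rule assms)
  have "diam G (path_dist G) = diam G (resistance G)" if "is_tree G"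
  proof -
    interpret tree_graph G
      using that by unfold_locales (auto simp: is_tree_def)
    show ?thesis by (rule diam_path_dist)
  qed
  then show ?thesis
    using eigval_min_1 minimizer_iff by metis
qed

end
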